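(* Let $X$ be the symmetric $\frac23$-stable process on $\mathbb{R}$ with $X_0=1$, and let $\tau=\inf\{t\ge0:X_t\notin(0,\infty)\}$. Then the law of $\tau$ has the density, for $x>0$, $$ \frac1\pi\int_0^\infty e^{-tx}\left(\sin(t^{3/2})+\frac{t^{1/2}\,{}_1F_2\left(1;\tfrac23,\tfrac76;-\tfrac{t^3}{4}\right)}{\Gamma(4/3)}\right)dt , $$ and its Laplace transform is $$ \mathbb{E}^1e^{-t\tau}=\frac{\sqrt3}{2\pi}\,\Gamma(2/3)\,\Gamma(1/3,t^{3/2})\,e^{t^{3/2}},\qquad t>0 . $$
   Context: The symmetric $\frac23$-stable process is the real Lévy process (càdlàg paths) with $\mathbb{E}^0e^{izX_t}=e^{-t|z|^{2/3}}$, $z\in\mathbb{R}$; $\mathbb{P}^1,\mathbb{E}^1$ refer to the process started from $X_0=1$. $\Gamma(a,z)=\int_z^\infty t^{a-1}e^{-t}\,dt$ is the incomplete Gamma function, and ${}_1F_2(a;b,c;z)=\sum_{k=0}^\infty\frac{(a)_kz^k}{(b)_k(c)_kk!}$, with $(a)_k=a(a+1)\cdots(a+k-1)$, $(a)_0=1$. *)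

theory Defs
  imports "HOL-Probability.Probability"
begin

definition cadlag_path :: "(real \<Rightarrow> real) \<Rightarrow> bool" where
  "cadlag_path x \<longleftrightarrow>
     (\<forall>t\<ge>0. continuous (at_right t) x) \<and> (\<forall>t>0. \<exists>l. (x \<longlongrightarrow> l) (at_left t))"

text \<open>Time runs over \<open>t \<ge> 0\<close>; the values of \<open>X\<close> at negative times are irrelevant. Stochastic
  continuity is not listed because it follows from right-continuity and stationarity.\<close>

definition levy_process_from :: "'a measure \<Rightarrow> (real \<Rightarrow> 'a \<Rightarrow> real) \<Rightarrow> real \<Rightarrow> bool" where
  "levy_process_from M X x0 \<longleftrightarrow>
     prob_space M \<and>
     (\<forall>t\<ge>0. X t \<in> borel_measurable M) \<and>
     (AE \<omega> in M. X 0 \<omega> = x0) \<and>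
     (\<forall>(n::nat) (s :: nat \<Rightarrow> real). 0 \<le> s 0 \<and> strict_mono_on {..n} s \<longrightarrow>
        prob_space.indep_vars M (\<lambda>_. borel) (\<lambda>i \<omega>. X (s (Suc i)) \<omega> - X (s i) \<omega>) {..<n}) \<and>
     (\<forall>s\<ge>0. \<forall>h\<ge>0. distr M borel (\<lambda>\<omega>. X (s + h) \<omega> - X s \<omega>)
                  = distr M borel (\<lambda>\<omega>. X h \<omega> - X 0 \<omega>)) \<and>
     (AE \<omega> in M. cadlag_path (\<lambda>t. X t \<omega>))"

text \<open>The law of \<open>X t\<close> for the process started from \<open>0\<close> is the law of \<open>X t - X 0\<close> for the
  process started from \<open>x0\<close>.\<close>

definition symmetric_stable_process_from ::
    "real \<Rightarrow> 'a measure \<Rightarrow> (real \<Rightarrow> 'a \<Rightarrow> real) \<Rightarrow> real \<Rightarrow> bool" where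
  "symmetric_stable_process_from \<alpha> M X x0 \<longleftrightarrow>
     levy_process_from M X x0 \<and>
     (\<forall>t\<ge>0. \<forall>z::real. char (distr M borel (\<lambda>\<omega>. X t \<omega> - X 0 \<omega>)) z
                    = of_real (exp (- t * \<bar>z\<bar> powr \<alpha>)))"

text \<open>The infimum of the empty set is \<open>\<infinity>\<close>. For a cadlag process and a closed complement
  of \<open>D\<close> this time need only be measurable with respect to the completion of the underlying
  probability space.\<close>

definition exit_time :: "(real \<Rightarrow> 'a \<Rightarrow> real) \<Rightarrow> real set \<Rightarrow> 'a \<Rightarrow> ennreal" where
  "exit_time X D \<omega> = Inf {ennreal t | t. 0 \<le> t \<and> X t \<omega> \<notin> D}"

definition exp_neg :: "real \<Rightarrow> ennreal \<Rightarrow> real" where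
  "exp_neg t s = (if s = \<infinity> then 0 else exp (- t * enn2real s))"

definition upper_Gamma :: "real \<Rightarrow> real \<Rightarrow> real" where
  "upper_Gamma a z = (LBINT s:{z..}. s powr (a - 1) * exp (- s))"

definition hypergeom_1F2 :: "real \<Rightarrow> real \<Rightarrow> real \<Rightarrow> real \<Rightarrow> real" where
  "hypergeom_1F2 a b c z =
     (\<Sum>k. pochhammer a k * z ^ k / (pochhammer b k * pochhammer c k * fact k))"

definition exit_integrand :: "real \<Rightarrow> real \<Rightarrow> real" where
  "exit_integrand x t = exp (- t * x) *
     (sin (t powr (3/2))
      + t powr (1/2) * hypergeom_1F2 1 (2/3) (7/6) (- (t ^ 3 / 4)) / Gamma (4/3))"

definition exit_density :: "real \<Rightarrow> real" where
  "exit_density x = 1 / pi * (LBINT t:{0<..}. exit_integrand x t)"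

end

theory Submission
  imports Defs "HOL-Complex_Analysis.Complex_Analysis" "HOL-Real_Asymp.Real_Asymp"
begin

text \<open>Let \<open>e\<close> be an independent exponential time of rate \<open>q\<close>. Scaled by \<open>q\<close> to the power \<open>3/2\<close>, the
  increment of \<open>X\<close> up to \<open>e\<close> has the density \<open>resolvent_density\<close>, a mixture of two-sided exponentials.
  It has a Wiener--Hopf factorization: it is the law of \<open>A - A'\<close> for independent copies of a positive
  variable \<open>A\<close> with density \<open>sup_density\<close>. Integrating the convolution inverse \<open>renewal_kernel\<close> of
  \<open>sup_density\<close> against \<open>resolvent_density\<close> therefore gives the tail \<open>hit_transform\<close> of \<open>A\<close>, which is \<open>1\<close>
  on the negative half-line. So \<open>exp (- q T)\<close>, for \<open>T\<close> the first dyadic time at which \<open>X\<close> is below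
  \<open>\<epsilon>\<close>, is by the Markov property the expected discounted integral of \<open>renewal_kernel\<close> along the path
  after \<open>T\<close>. As the grid is refined the restriction to times after \<open>T\<close> becomes redundant, since the
  kernel vanishes above \<open>\<epsilon>\<close>, and \<open>E exp (- q T)\<close> is identified as a value of \<open>hit_transform\<close>. Letting
  \<open>\<epsilon>\<close> tend to \<open>0\<close> gives the Laplace transform of the exit time.

  As a function of \<open>a = sqrt q\<close> this transform, \<open>hit_laplace\<close>, extends to the entire function \<open>hit_entire\<close>, which
  grows at most linearly in the right half-plane. Cauchy's formula expresses it there by its
  imaginary part on the imaginary axis, and this exhibits it as the Laplace transform of the
  claimed density.\<close>

section \<open>Exponential mixtures and the Wiener--Hopf factorization\<close>

text \<open>The index 2/3 is tractable because the Laplace transform of \<open>A\<close> at k^3 is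
  (1 + k) / (1 + k + k^2), rational in k. Put r^3 = |z| and k = r exp(i pi / 6), so that k^3 = i
  |z|. Then |1 + k + k^2|^2 = (1 + r^2) |1 + k|^2, so the factors at i z and - i z multiply to 1 /
  (1 + |z|^(2/3)). The weights of the mixtures are the jumps of such functions of k^3 across the
  negative half-line, where k = v exp(i pi / 3). The formulas so found are verified by real
  antiderivatives.

  On the side of the process the obstacle is that a level is passed by a jump of unknown size. The
  overshoot does no harm because \<open>hit_transform\<close> is exactly 1 on the whole negative
  half-line, so the integral after the passage is the same from every point reached.

  On the analytic side neither the integrability nor the sign of the claimed density is known in
  advance. Therefore differences of the transform at u and u + 1 are inverted, and nonnegativity
  comes out of the comparison with the law of the exit time.\<close>

definition inv_cubic_prim :: "real \<Rightarrow> real" where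
  "inv_cubic_prim v = ln (1 + v) / 3 - ln (1 - v + v\<^sup>2) / 6 + arctan ((2 * v - 1) / sqrt 3) / sqrt 3"

definition inv_cubic_prim1 :: "real \<Rightarrow> real" where
  "inv_cubic_prim1 v = ln (1 - v + v\<^sup>2) / 6 - ln (1 + v) / 3 + arctan ((2 * v - 1) / sqrt 3) / sqrt 3"

definition quad_prim :: "real \<Rightarrow> real" where
  "quad_prim u = 2 / sqrt 3 * arctan ((2 * u + 1) / sqrt 3)"

lemma quad_pos: "1 - v + v\<^sup>2 > (0::real)" "1 + v + v\<^sup>2 > (0::real)"
proof -
  have "1 - v + v\<^sup>2 = (v - 1/2)\<^sup>2 + 3/4" "1 + v + v\<^sup>2 = (v + 1/2)\<^sup>2 + 3/4"
    by (simp_all add: power2_eq_square algebra_simps)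
  then show "1 - v + v\<^sup>2 > 0" "1 + v + v\<^sup>2 > 0"
    by (simp_all add: add_nonneg_pos)
qed

lemma arctan_affine_deriv:
  "((\<lambda>v. arctan ((2 * v + b) / sqrt 3) / sqrt 3) has_real_derivative 2 / (3 + (2 * v + b)\<^sup>2)) (at v)"
proof -
  have 1: "((\<lambda>v. (2 * v + b) / sqrt 3) has_real_derivative 2 / sqrt 3) (at v)"
    by (rule DERIV_cdivide) (auto intro!: derivative_eq_intros)
  have e: "1 + ((2 * v + b) / sqrt 3)\<^sup>2 = (3 + (2 * v + b)\<^sup>2) / 3"
    by (subst power_divide) (simp add: add_divide_distrib)
  have "(inverse (1 + ((2 * v + b) / sqrt 3)\<^sup>2) * (2 / sqrt 3)) / sqrt 3
      = 3 / (3 + (2 * v + b)\<^sup>2) * 2 / (sqrt 3 * sqrt 3)"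
    unfolding e by (simp only: inverse_eq_divide times_divide_eq_right
        divide_divide_eq_left divide_divide_eq_right mult_1_left)
  also have "\<dots> = 2 / (3 + (2 * v + b)\<^sup>2)"
  proof -
    have "3 / c * 2 / (sqrt 3 * sqrt 3) = 2 / c" for c by simp
    then show ?thesis .
  qed
  finally show ?thesis
    using DERIV_cdivide[OF DERIV_chain2[OF DERIV_arctan 1], of "sqrt 3"] by (simp only:)
qed

lemma arctan_prim_deriv:
  "((\<lambda>v. arctan ((2 * v - 1) / sqrt 3) / sqrt 3) has_real_derivative 1 / (2 * (1 - v + v\<^sup>2))) (at v)"
proof (rule DERIV_cong)
  show "((\<lambda>v. arctan ((2 * v - 1) / sqrt 3) / sqrt 3) has_real_derivative 2 / (3 + (2 * v + -1)\<^sup>2)) (at v)"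
    using arctan_affine_deriv[of "-1" v] by (simp only: add_uminus_conv_diff)
  have e: "3 + (2 * v + - 1)\<^sup>2 = 2 * (2 * (1 - v + v\<^sup>2))"
    by (simp add: power2_eq_square algebra_simps)
  show "2 / (3 + (2 * v + -1)\<^sup>2) = 1 / (2 * (1 - v + v\<^sup>2))"
    unfolding e using nonzero_mult_divide_mult_cancel_left[of 2 1 "2 * (1 - v + v\<^sup>2)"] by simp
qed

lemma ln_prim_deriv: "v \<ge> 0 \<Longrightarrow> ((\<lambda>v. ln (1 + v) / 3) has_real_derivative 1 / (1 + v) / 3) (at v)"
  by (rule DERIV_cdivide) (auto intro!: derivative_eq_intros)

lemma ln_quad_prim_deriv:
  "((\<lambda>v. ln (1 - v + v\<^sup>2) / 6) has_real_derivative (2 * v - 1) / (1 - v + v\<^sup>2) / 6) (at v)"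
  using quad_pos(1)[of v]
  by (intro DERIV_cdivide) (auto intro!: derivative_eq_intros)

lemma cubic_factor: "(1 + v) * (1 - v + v\<^sup>2) = 1 + (v::real) ^ 3"
  by (simp add: power2_eq_square power3_eq_cube algebra_simps)

lemma inv_cubic_prim_deriv:
  assumes "v \<ge> 0"
  shows "(inv_cubic_prim has_real_derivative 1 / (1 + v ^ 3)) (at v)"
  unfolding inv_cubic_prim_def [abs_def]
proof (rule DERIV_cong[OF DERIV_add[OF DERIV_diff[OF ln_prim_deriv ln_quad_prim_deriv] arctan_prim_deriv]])
  have *: "1 / a / 3 - b / d / 6 + 1 / (2 * d) = 1 / (a * d)"
    if "a > 0" "d > 0" "2 * d - b * a + 3 * a = 6" for a b d :: real
  proof -
    have "1 / a / 3 - b / d / 6 + 1 / (2 * d) = (2 * d - b * a + 3 * a) / (6 * (a * d))"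
      using that(1,2) by (simp add: divide_simps)
    then show ?thesis by (simp add: that(3))
  qed
  show "1 / (1 + v) / 3 - (2 * v - 1) / (1 - v + v\<^sup>2) / 6 + 1 / (2 * (1 - v + v\<^sup>2)) = 1 / (1 + v ^ 3)"
    unfolding cubic_factor[symmetric]
    using assms quad_pos[of v] by (intro *) (auto simp: power2_eq_square algebra_simps)
qed (use assms in auto)

lemma inv_cubic_prim1_deriv:
  assumes "v \<ge> 0"
  shows "(inv_cubic_prim1 has_real_derivative v / (1 + v ^ 3)) (at v)"
  unfolding inv_cubic_prim1_def [abs_def]
proof (rule DERIV_cong[OF DERIV_add[OF DERIV_diff[OF ln_quad_prim_deriv ln_prim_deriv] arctan_prim_deriv]])
  have *: "b / d / 6 - 1 / a / 3 + 1 / (2 * d) = v / (a * d)"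
    if "a > 0" "d > 0" "b * a - 2 * d + 3 * a = 6 * v" for a b d :: real
  proof -
    have "b / d / 6 - 1 / a / 3 + 1 / (2 * d) = (b * a - 2 * d + 3 * a) / (6 * (a * d))"
      using that(1,2) by (simp add: divide_simps)
    then show ?thesis by (simp add: that(3))
  qed
  show "(2 * v - 1) / (1 - v + v\<^sup>2) / 6 - 1 / (1 + v) / 3 + 1 / (2 * (1 - v + v\<^sup>2)) = v / (1 + v ^ 3)"
    unfolding cubic_factor[symmetric]
    using assms quad_pos[of v] by (intro *) (auto simp: power2_eq_square algebra_simps)
qed (use assms in auto)

lemma quad_prim_deriv: "(quad_prim has_real_derivative 1 / (1 + u + u\<^sup>2)) (at u)"
proof (rule DERIV_cong)
  show "(quad_prim has_real_derivative 2 * (2 / (3 + (2 * u + 1)\<^sup>2))) (at u)"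
    using DERIV_cmult[OF arctan_affine_deriv[of 1 u], of 2]
    by (simp add: quad_prim_def [abs_def])
  have e: "3 + (2 * u + 1)\<^sup>2 = 4 * (1 + u + u\<^sup>2)"
    by (simp add: power2_eq_square algebra_simps)
  show "2 * (2 / (3 + (2 * u + 1)\<^sup>2)) = 1 / (1 + u + u\<^sup>2)"
    unfolding e using nonzero_mult_divide_mult_cancel_left[of 4 1 "(1 + u + u\<^sup>2)"] by simp
qed

lemma arctan_inv_sqrt3: "arctan (1 / sqrt 3) = pi / 6"
  by (rule arctan_unique) (auto simp: tan_30 intro: order.strict_trans[of _ 0])

lemma inv_cubic_prim_0: "inv_cubic_prim 0 = - (pi / (6 * sqrt 3))" "inv_cubic_prim1 0 = - (pi / (6 * sqrt 3))"
    "quad_prim 0 = pi / (3 * sqrt 3)"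
  by (simp_all add: inv_cubic_prim_def inv_cubic_prim1_def quad_prim_def arctan_inv_sqrt3 arctan_minus)

lemma inv_cubic_prim_at_top: "(inv_cubic_prim \<longlongrightarrow> pi / (2 * sqrt 3)) at_top"
proof -
  have "((\<lambda>v. ln (1 + v) / 3 - ln (1 - v + v\<^sup>2) / 6 + arctan ((2 * v - 1) / s) / s) \<longlongrightarrow> pi / (2 * s)) at_top"
    if "s > 0" for s :: real
    using that by (real_asymp simp: field_simps)
  then show ?thesis by (simp add: inv_cubic_prim_def [abs_def])
qed

lemma inv_cubic_prim1_at_top: "(inv_cubic_prim1 \<longlongrightarrow> pi / (2 * sqrt 3)) at_top"
proof -
  have "((\<lambda>v. ln (1 - v + v\<^sup>2) / 6 - ln (1 + v) / 3 + arctan ((2 * v - 1) / s) / s) \<longlongrightarrow> pi / (2 * s)) at_top"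
    if "s > 0" for s :: real
    using that by (real_asymp simp: field_simps)
  then show ?thesis by (simp add: inv_cubic_prim1_def [abs_def])
qed

lemma quad_prim_at_top: "(quad_prim \<longlongrightarrow> pi / sqrt 3) at_top"
proof -
  have "((\<lambda>v. 2 / s * arctan ((2 * v + 1) / s)) \<longlongrightarrow> pi / s) at_top"
    if "s > 0" for s :: real
    using that by (real_asymp simp: field_simps)
  then show ?thesis by (simp add: quad_prim_def [abs_def])
qed

text \<open>The value is 3 / pi times sin (pi / 3): 1 / pi comes from the inversion across the
  negative half-line, 3 from d(v^3) = 3 v^2 dv, and the sine from the argument pi / 3 of the cube
  root.\<close>

definition mix_const :: real where "mix_const = 3 * sqrt 3 / (2 * pi)"

lemma mix_const_pos [simp]: "mix_const > 0" "mix_const \<ge> 0" "mix_const \<noteq> 0"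
  by (auto simp: mix_const_def)

lemma inverse_mix_const: "1 / mix_const = 2 * pi / (3 * sqrt 3)"
  by (simp add: mix_const_def)

text \<open>The primitives of 1 / (1 + v^3), v / (1 + v^3) and 1 / (1 + u + u^2) grow over the
  half-line by one and the same amount. This coincidence is what makes all the transforms below
  rational in k.\<close>

lemma sqrt3_consts:
  "pi / (2 * sqrt 3) - (- (pi / (6 * sqrt 3))) = 1 / mix_const"
  "pi / sqrt 3 - pi / (3 * sqrt 3) = 1 / mix_const"
  by (simp_all add: inverse_mix_const field_simps)

lemma nn_integral_cubic:
  assumes k: "k > 0"
  shows "(\<integral>\<^sup>+v. ennreal (1 / (v ^ 3 + k ^ 3)) * indicator {0..} v \<partial>lborel) = ennreal (1 / (mix_const * k\<^sup>2))"
    and "(\<integral>\<^sup>+v. ennreal (v / (v ^ 3 + k ^ 3)) * indicator {0..} v \<partial>lborel) = ennreal (1 / (mix_const * k))"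
proof -
  have fl: "filterlim (\<lambda>v::real. v / k) at_top at_top" using k by real_asymp
  have d: "((\<lambda>v. v / k) has_real_derivative 1 / k) (at v)" for v
    using k by (auto intro!: derivative_eq_intros)
  have 1: "((\<lambda>v. inv_cubic_prim (v / k) / k\<^sup>2) has_real_derivative 1 / (v ^ 3 + k ^ 3)) (at v)" if "0 \<le> v" for v
  proof (rule DERIV_cong[OF DERIV_cdivide[OF DERIV_chain2[OF inv_cubic_prim_deriv d]]])
    have "1 + (v / k) ^ 3 = (v ^ 3 + k ^ 3) / k ^ 3" using k by (simp add: field_simps)
    then show "1 / (1 + (v / k) ^ 3) * (1 / k) / k\<^sup>2 = 1 / (v ^ 3 + k ^ 3)"
      using k by (simp add: power2_eq_square power3_eq_cube)
  qed (use that k in auto)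
  have 2: "((\<lambda>v. inv_cubic_prim1 (v / k) / k) has_real_derivative v / (v ^ 3 + k ^ 3)) (at v)" if "0 \<le> v" for v
  proof (rule DERIV_cong[OF DERIV_cdivide[OF DERIV_chain2[OF inv_cubic_prim1_deriv d]]])
    have "1 + (v / k) ^ 3 = (v ^ 3 + k ^ 3) / k ^ 3" using k by (simp add: field_simps)
    then show "v / k / (1 + (v / k) ^ 3) * (1 / k) / k = v / (v ^ 3 + k ^ 3)"
      using k by (simp add: power2_eq_square power3_eq_cube)
  qed (use that k in auto)
  note lim = filterlim_compose[OF inv_cubic_prim_at_top fl] filterlim_compose[OF inv_cubic_prim1_at_top fl]
  have "(\<integral>\<^sup>+v. ennreal (1 / (v ^ 3 + k ^ 3)) * indicator {0..} v \<partial>lborel)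
      = ennreal (pi / (2 * sqrt 3) / k\<^sup>2 - inv_cubic_prim (0 / k) / k\<^sup>2)"
    by (rule nn_integral_FTC_atLeast[OF _ 1 _ tendsto_divide[OF lim(1) tendsto_const]]) (use k in auto)
  also have "pi / (2 * sqrt 3) / k\<^sup>2 - inv_cubic_prim (0 / k) / k\<^sup>2 = 1 / (mix_const * k\<^sup>2)"
    unfolding div_0 inv_cubic_prim_0 diff_divide_distrib[symmetric] sqrt3_consts by simp
  finally show "(\<integral>\<^sup>+v. ennreal (1 / (v ^ 3 + k ^ 3)) * indicator {0..} v \<partial>lborel) = ennreal (1 / (mix_const * k\<^sup>2))" .
  have "(\<integral>\<^sup>+v. ennreal (v / (v ^ 3 + k ^ 3)) * indicator {0..} v \<partial>lborel)
      = ennreal (pi / (2 * sqrt 3) / k - inv_cubic_prim1 (0 / k) / k)"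
    by (rule nn_integral_FTC_atLeast[OF _ 2 _ tendsto_divide[OF lim(2) tendsto_const]]) (use k in auto)
  also have "pi / (2 * sqrt 3) / k - inv_cubic_prim1 (0 / k) / k = 1 / (mix_const * k)"
    unfolding div_0 inv_cubic_prim_0 diff_divide_distrib[symmetric] sqrt3_consts by simp
  finally show "(\<integral>\<^sup>+v. ennreal (v / (v ^ 3 + k ^ 3)) * indicator {0..} v \<partial>lborel) = ennreal (1 / (mix_const * k))" .
qed

text \<open>Antiderivative of \<open>1 / ((u ^ 3 + k ^ 3) * (1 + u + u\<^sup>2))\<close>, from the partial fraction
  \<open>(1 / (1 + u + u\<^sup>2) + (1 - u) / (u ^ 3 + k ^ 3)) / (1 + k ^ 3)\<close>.\<close>

definition mixed_prim :: "real \<Rightarrow> real \<Rightarrow> real" where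
  "mixed_prim k u = (quad_prim u + (inv_cubic_prim (u / k) / k\<^sup>2 - inv_cubic_prim1 (u / k) / k)) / (1 + k ^ 3)"

lemma mixed_prim_deriv:
  assumes k: "k > 0" and u: "u \<ge> 0"
  shows "(mixed_prim k has_real_derivative 1 / ((u ^ 3 + k ^ 3) * (1 + u + u\<^sup>2))) (at u)"
proof -
  have d: "((\<lambda>v. v / k) has_real_derivative 1 / k) (at v)" for v
    using k by (auto intro!: derivative_eq_intros)
  have 1: "((\<lambda>v. inv_cubic_prim (v / k) / k\<^sup>2) has_real_derivative 1 / (u ^ 3 + k ^ 3)) (at u)"
  proof (rule DERIV_cong[OF DERIV_cdivide[OF DERIV_chain2[OF inv_cubic_prim_deriv d]]])
    have "1 + (u / k) ^ 3 = (u ^ 3 + k ^ 3) / k ^ 3" using k by (simp add: field_simps)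
    then show "1 / (1 + (u / k) ^ 3) * (1 / k) / k\<^sup>2 = 1 / (u ^ 3 + k ^ 3)"
      using k by (simp add: power2_eq_square power3_eq_cube)
  qed (use u k in auto)
  have 2: "((\<lambda>v. inv_cubic_prim1 (v / k) / k) has_real_derivative u / (u ^ 3 + k ^ 3)) (at u)"
  proof (rule DERIV_cong[OF DERIV_cdivide[OF DERIV_chain2[OF inv_cubic_prim1_deriv d]]])
    have "1 + (u / k) ^ 3 = (u ^ 3 + k ^ 3) / k ^ 3" using k by (simp add: field_simps)
    then show "u / k / (1 + (u / k) ^ 3) * (1 / k) / k = u / (u ^ 3 + k ^ 3)"
      using k by (simp add: power2_eq_square power3_eq_cube)
  qed (use u k in auto)
  have pos: "u ^ 3 + k ^ 3 > 0" "1 + u + u\<^sup>2 > 0" "1 + k ^ 3 > 0"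
    using k u quad_pos[of u] by (simp_all add: add_nonneg_pos add_pos_nonneg)
  have alg: "1 / b + (1 / a - u / a) = c / (a * b)" if "a > 0" "b > 0" "a + (1 - u) * b = c" for a b c :: real
    using that by (simp add: divide_simps)
  have "(u ^ 3 + k ^ 3) + (1 - u) * (1 + u + u\<^sup>2) = 1 + k ^ 3"
    by (simp add: power2_eq_square power3_eq_cube algebra_simps)
  from alg[OF pos(1,2) this] pos
  have "(1 / (1 + u + u\<^sup>2) + (1 / (u ^ 3 + k ^ 3) - u / (u ^ 3 + k ^ 3))) / (1 + k ^ 3)
      = 1 / ((u ^ 3 + k ^ 3) * (1 + u + u\<^sup>2))" by simp
  with DERIV_cdivide[OF DERIV_add[OF quad_prim_deriv[of u] DERIV_diff[OF 1 2]], of "1 + k ^ 3"]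
  show ?thesis unfolding mixed_prim_def [abs_def] by simp
qed

text \<open>Each of the three primitives contributes the increment 1 / \<open>mix_const\<close>,
  which leaves (1 + 1 / k^2 - 1 / k) / (1 + k^3); the factor 1 - k + k^2 then cancels. The total
  increment serves both for the kernel \<open>renewal_kernel\<close> and for the characteristic
  function of \<open>resolvent_density\<close>.\<close>

lemma mixed_prim_lims:
  assumes k: "k > 0"
  obtains T where "(mixed_prim k \<longlongrightarrow> T) at_top" "T - mixed_prim k 0 = 1 / (mix_const * k\<^sup>2 * (1 + k))"
proof
  have fl: "filterlim (\<lambda>v::real. v / k) at_top at_top" using k by real_asymp
  have k3: "1 + k ^ 3 > 0" using k by (auto intro!: add_pos_nonneg)
  let ?T = "(pi / sqrt 3 + (pi / (2 * sqrt 3) / k\<^sup>2 - pi / (2 * sqrt 3) / k)) / (1 + k ^ 3)"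
  show "(mixed_prim k \<longlongrightarrow> ?T) at_top"
    unfolding mixed_prim_def [abs_def]
    by (intro tendsto_divide tendsto_add tendsto_diff quad_prim_at_top
          filterlim_compose[OF inv_cubic_prim_at_top fl] filterlim_compose[OF inv_cubic_prim1_at_top fl] tendsto_const)
       (use k k3 in auto)
  have *: "(a1 + (a2 / k\<^sup>2 - a2 / k)) / (1 + k ^ 3) - (b1 + (b2 / k\<^sup>2 - b2 / k)) / (1 + k ^ 3)
      = ((a1 - b1) + ((a2 - b2) / k\<^sup>2 - (a2 - b2) / k)) / (1 + k ^ 3)" for a1 a2 b1 b2
    by (simp add: diff_divide_distrib add_divide_distrib)
  have "?T - mixed_prim k 0 = (1 / mix_const + (1 / mix_const / k\<^sup>2 - 1 / mix_const / k)) / (1 + k ^ 3)"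
    unfolding mixed_prim_def div_0 inv_cubic_prim_0 * sqrt3_consts ..
  also have "\<dots> = 1 / mix_const * ((1 + (1 / k\<^sup>2 - 1 / k)) / (1 + k ^ 3))"
    by (simp add: algebra_simps add_divide_distrib diff_divide_distrib)
  also have "(1 + (1 / k\<^sup>2 - 1 / k)) / (1 + k ^ 3) = 1 / (k\<^sup>2 * (1 + k))"
  proof -
    have "1 + (1 / k\<^sup>2 - 1 / k) = (1 - k + k\<^sup>2) / k\<^sup>2"
      using k by (simp add: field_simps power2_eq_square)
    then show ?thesis
      unfolding cubic_factor[symmetric] using quad_pos(1)[of k] by (simp add: mult.commute)
  qed
  finally show "?T - mixed_prim k 0 = 1 / (mix_const * k\<^sup>2 * (1 + k))" by simp
qed

section \<open>Uniqueness of Laplace transforms\<close>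

text \<open>On a bounded support the characteristic function is the power series formed from the
  moments, so \<open>Levy_uniqueness\<close> applies.\<close>

lemma moment_uniqueness_prob:
  fixes M N :: "real measure"
  assumes M: "real_distribution M" and N: "real_distribution N"
    and bM: "AE x in M. \<bar>x\<bar> \<le> 1" and bN: "AE x in N. \<bar>x\<bar> \<le> 1"
    and moments: "\<And>n. (\<integral>x. x ^ n \<partial>M) = (\<integral>x. x ^ n \<partial>N)"
  shows "M = N"
proof -
  have char_sums: "(\<lambda>n. (\<i> * of_real t) ^ n /\<^sub>R fact n * of_real (\<integral>x. x ^ n \<partial>D)) sums char D t"
    if D: "real_distribution D" and b: "AE x in D. \<bar>x\<bar> \<le> 1" for D t
  proof -
    interpret real_distribution D by (rule D)
    have [measurable_cong]: "sets D = sets borel" by simp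
    define f where "f n x = (\<i> * of_real t * of_real x) ^ n /\<^sub>R fact n" for n and x :: real
    have norm_f: "norm (f n x) = (\<bar>t\<bar> * \<bar>x\<bar>) ^ n / fact n" for n x
      by (simp add: f_def norm_mult norm_power divide_inverse mult.commute)
    have meas [measurable]: "f n \<in> borel_measurable D" for n
      unfolding f_def by measurable
    have bound: "AE x in D. norm (f n x) \<le> \<bar>t\<bar> ^ n / fact n" for n
      using b
    proof eventually_elim
      case (elim x)
      have "\<bar>t\<bar> * \<bar>x\<bar> \<le> \<bar>t\<bar>" using elim by (simp add: mult_left_le)
      then show ?case unfolding norm_f
        by (intro divide_right_mono power_mono) auto
    qed
    have int: "integrable D (f n)" for n
      by (rule integrable_const_bound[OF bound meas])
    have "(\<lambda>n. \<integral>x. f n x \<partial>D) sums (\<integral>x. (\<Sum>n. f n x) \<partial>D)"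
    proof (rule sums_integral[OF int])
      show "AE x in D. summable (\<lambda>n. norm (f n x))"
        unfolding norm_f
        using summable_exp by (intro AE_I2) (simp add: divide_inverse mult.commute)
      show "summable (\<lambda>n. \<integral>x. norm (f n x) \<partial>D)"
      proof (rule summable_comparison_test')
        show "summable (\<lambda>n. \<bar>t\<bar> ^ n / fact n)"
          using summable_exp[of "\<bar>t\<bar>"] by (simp add: divide_inverse mult.commute)
        show "norm (\<integral>x. norm (f n x) \<partial>D) \<le> \<bar>t\<bar> ^ n / fact n" for n
        proof -
          have "(\<integral>x. norm (f n x) \<partial>D) \<le> (\<integral>x. \<bar>t\<bar> ^ n / fact n \<partial>D)"
            by (rule integral_mono_AE) (use int bound in auto)
          then show ?thesis using prob_space by simp
        qed
      qed
    qed
    moreover have "(\<Sum>n. f n x) = iexp (t * x)" for x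
      unfolding f_def exp_def by (simp add: scaleR_conv_of_real mult.assoc)
    moreover have "(\<integral>x. f n x \<partial>D) = (\<i> * of_real t) ^ n /\<^sub>R fact n * of_real (\<integral>x. x ^ n \<partial>D)" for n
    proof -
      have "f n = (\<lambda>x. ((\<i> * of_real t) ^ n /\<^sub>R fact n) * of_real (x ^ n))"
        by (auto simp: f_def power_mult_distrib fun_eq_iff)
      moreover have "integrable D (\<lambda>x. x ^ n)"
        by (rule integrable_const_bound[of _ 1])
          (use b in \<open>auto simp: power_abs intro!: power_le_one elim!: eventually_mono\<close>)
      ultimately show ?thesis
        by (simp only: integral_mult_right_zero integral_complex_of_real)
    qed
    ultimately show ?thesis unfolding char_def by simp
  qed
  have "char M = char N"
  proof
    fix t show "char M t = char N t"
      using char_sums[OF M bM, of t] char_sums[OF N bN, of t] unfolding moments by (rule sums_unique2)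
  qed
  then show ?thesis using Levy_uniqueness[OF M N] by simp
qed

text \<open>The map x -> exp (- x) sends the half-line into [0, 1], and the transforms at natural
  numbers become the moments of the image measure. The value at n = 0 says that the total masses
  agree.\<close>

lemma laplace_uniqueness_finite:
  fixes M N :: "real measure"
  assumes M: "finite_measure M" "sets M = sets borel" and N: "finite_measure N" "sets N = sets borel"
    and bM: "AE x in M. x \<ge> 0" and bN: "AE x in N. x \<ge> 0"
    and lap: "\<And>n::nat. (\<integral>x. exp (- real n * x) \<partial>M) = (\<integral>x. exp (- real n * x) \<partial>N)"
  shows "M = N"
proof -
  note [measurable_cong] = M(2) N(2)
  interpret M: finite_measure M by fact
  interpret N: finite_measure N by fact
  have spM [simp]: "space M = UNIV" "space N = UNIV"
    using sets_eq_imp_space_eq[OF M(2)] sets_eq_imp_space_eq[OF N(2)] by auto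
  define m where "m = measure M UNIV"
  have mN: "m = measure N UNIV" using lap[of 0] by (simp add: m_def)
  show ?thesis
  \<comment> \<open>The image is normalised below to a probability measure, which requires positive
    mass.\<close>
  proof (cases "m = 0")
    case True
    have "emeasure M UNIV = 0" "emeasure N UNIV = 0"
      using True mN m_def by (simp_all add: M.emeasure_eq_measure N.emeasure_eq_measure)
    then have "emeasure M A = 0" "emeasure N A = 0" for A
      using emeasure_mono[of A UNIV M] emeasure_mono[of A UNIV N] by auto
    then show ?thesis by (intro measure_eqI) (simp_all add: M N)
  next
    case False
    then have m: "m > 0" by (simp add: m_def order_less_le)
    define nrm where "nrm D = distr (scale_measure (ennreal (1 / m)) D) borel (\<lambda>x. exp (- x))" for D :: "real measure"
    have meas: "(\<lambda>x. exp (-x)) \<in> scale_measure r D \<rightarrow>\<^sub>M borel" if "sets D = sets borel" for r and D :: "real measure"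
      using that measurable_cong_sets[of "scale_measure r D" borel borel borel] by simp
    have nrm: "real_distribution (nrm D)"
      "AE x in nrm D. \<bar>x\<bar> \<le> 1" "(\<integral>x. x ^ n \<partial>nrm D) = (\<integral>x. exp (- real n * x) \<partial>D) / m"
      "\<And>A. A \<in> sets borel \<Longrightarrow> (\<lambda>x. exp (- x)) ` A \<in> sets borel \<Longrightarrow>
        emeasure D A = ennreal m * emeasure (nrm D) ((\<lambda>x. exp (- x)) ` A)"
      if D: "finite_measure D" "sets D = sets borel" "AE x in D. x \<ge> 0" "measure D UNIV = m"
      for D n
    proof -
      note [measurable_cong] = D(2)
      note [measurable] = meas[OF D(2)]
      interpret D: finite_measure D by fact
      have sp: "space D = UNIV" using sets_eq_imp_space_eq[OF D(2)] by auto
      have "emeasure (scale_measure (ennreal (1 / m)) D) UNIV = ennreal (1 / m) * ennreal m"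
        by (simp add: D.emeasure_eq_measure D(4))
      also have "\<dots> = 1" using m by (simp flip: ennreal_mult)
      finally have "prob_space (scale_measure (ennreal (1 / m)) D)"
        by (intro prob_spaceI) (simp add: space_scale_measure sp)
      then have "prob_space (nrm D)" unfolding nrm_def by (rule prob_space.prob_space_distr) fact
      then show "real_distribution (nrm D)"
        by (simp add: real_distribution_def real_distribution_axioms_def nrm_def)
      have sd: "scale_measure (ennreal (1 / m)) D = density D (\<lambda>_. ennreal (1 / m))"
        by (rule measure_eqI) (auto simp: emeasure_density_const)
      show "AE x in nrm D. \<bar>x\<bar> \<le> 1"
        unfolding nrm_def sd using D(3)
        by (subst AE_distr_iff) (auto simp: AE_density elim!: eventually_mono)
      show "(\<integral>x. x ^ n \<partial>nrm D) = (\<integral>x. exp (- real n * x) \<partial>D) / m"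
        unfolding nrm_def sd using m
        by (subst integral_distr) (auto simp: integral_density exp_of_nat_mult[symmetric])
      \<comment> \<open>Injectivity of x -> exp (- x) recovers the original measure from its
        image.\<close>
      fix A :: "real set" assume A: "A \<in> sets borel" "(\<lambda>x. exp (- x)) ` A \<in> sets borel"
      have "emeasure (nrm D) ((\<lambda>x. exp (- x)) ` A) = ennreal (1 / m) * emeasure D A"
        unfolding nrm_def using A
        by (subst emeasure_distr) (auto simp: space_scale_measure sp inj_vimage_image_eq inj_def)
      then show "emeasure D A = ennreal m * emeasure (nrm D) ((\<lambda>x. exp (- x)) ` A)"
        using m by (simp add: mult.assoc[symmetric] flip: ennreal_mult)
    qed
    have "nrm M = nrm N"
      using nrm(1-3)[OF M bM m_def[symmetric]] nrm(1-3)[OF N bN mN[symmetric]] lap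
      by (intro moment_uniqueness_prob) auto
    show ?thesis
    proof (rule measure_eqI)
      fix A assume "A \<in> sets M"
      then have A: "A \<in> sets borel" using M by simp
      \<comment> \<open>Rewritten as a preimage under - ln, the image of a Borel set is seen to be
        Borel.\<close>
      have "(\<lambda>x. exp (- x)) ` A = {y. 0 < y \<and> - ln y \<in> A}"
      proof (intro equalityI subsetI)
        fix y :: real assume "y \<in> {y. 0 < y \<and> - ln y \<in> A}"
        then have "y = exp (- (- ln y))" "- ln y \<in> A" by simp_all
        then show "y \<in> (\<lambda>x. exp (- x)) ` A" by (rule image_eqI)
      qed auto
      also have "\<dots> \<in> sets borel" using A by measurable
      finally have A': "(\<lambda>x. exp (- x)) ` A \<in> sets borel" .
      show "emeasure M A = emeasure N A"
        using nrm(4)[OF M bM m_def[symmetric] A A'] nrm(4)[OF N bN mN[symmetric] A A'] \<open>nrm M = nrm N\<close> by simp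
    qed (simp add: M N)
  qed
qed

lemma laplace_uniqueness:
  fixes f g :: "real \<Rightarrow> ennreal"
  assumes [measurable]: "f \<in> borel_measurable borel" "g \<in> borel_measurable borel"
    and fin: "(\<integral>\<^sup>+x. f x * indicator {0..} x \<partial>lborel) < \<infinity>"
    and lap: "\<And>n::nat. (\<integral>\<^sup>+x. ennreal (exp (- real n * x)) * f x * indicator {0..} x \<partial>lborel)
       = (\<integral>\<^sup>+x. ennreal (exp (- real n * x)) * g x * indicator {0..} x \<partial>lborel)"
  shows "AE x in lborel. x \<ge> 0 \<longrightarrow> f x = g x"
proof -
  let ?M = "\<lambda>f. density lborel (\<lambda>x. f x * indicator {0..} x)"
  have fin': "(\<integral>\<^sup>+x. g x * indicator {0..} x \<partial>lborel) < \<infinity>"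
    using fin lap[of 0] by simp
  have *: "(\<integral>x. exp (- real n * x) \<partial>?M h) = enn2real (\<integral>\<^sup>+x. ennreal (exp (- real n * x)) * h x * indicator {0..} x \<partial>lborel)"
    if [measurable]: "h \<in> borel_measurable borel" for n h
    by (subst integral_eq_nn_integral) (auto simp: nn_integral_density mult_ac)
  have "?M f = ?M g"
  proof (rule laplace_uniqueness_finite)
    show "finite_measure (?M f)" "finite_measure (?M g)"
      using fin fin' by (auto intro!: finite_measureI simp: emeasure_density)
    show "(\<integral>x. exp (- real n * x) \<partial>?M f) = (\<integral>x. exp (- real n * x) \<partial>?M g)" for n
      unfolding *[OF assms(1)] *[OF assms(2)] lap ..
  qed (auto simp: AE_density split: split_indicator)
  then have "AE x in lborel. f x * indicator {0..} x = g x * indicator {0..} x"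
    using fin by (subst (asm) finite_density_unique) auto
  then show ?thesis by eventually_elim (auto split: split_indicator_asm)
qed

section \<open>Mixtures of exponentials and the Wiener--Hopf factor\<close>

text \<open>The values are extended because the integral may diverge, as it does for
  \<open>sup_weight\<close> at x = 0.\<close>

definition exp_mix :: "(real \<Rightarrow> real) \<Rightarrow> real \<Rightarrow> ennreal" where
  "exp_mix w x = (\<integral>\<^sup>+v. ennreal (w v * exp (- (v ^ 3 * x))) * indicator {0..} v \<partial>lborel)"

text \<open>The variable \<open>v\<close> is the cube root of the rate of the exponential, which makes the weights rational.\<close>

definition sup_weight :: "real \<Rightarrow> real" where "sup_weight v = mix_const * v ^ 4 / (1 + v ^ 3)"
definition resolvent_weight :: "real \<Rightarrow> real" where "resolvent_weight v = mix_const * v ^ 4 / (1 + v\<^sup>2 + v ^ 4)"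
definition renewal_weight :: "real \<Rightarrow> real" where "renewal_weight v = mix_const * v * (1 + v) / (1 + v + v\<^sup>2)"
definition hit_weight :: "real \<Rightarrow> real" where "hit_weight v = mix_const * v / (1 + v ^ 3)"

lemma weights_measurable [measurable]:
  "sup_weight \<in> borel_measurable borel" "resolvent_weight \<in> borel_measurable borel"
  "renewal_weight \<in> borel_measurable borel" "hit_weight \<in> borel_measurable borel"
  unfolding sup_weight_def [abs_def] resolvent_weight_def [abs_def] renewal_weight_def [abs_def] hit_weight_def [abs_def] by measurable

lemma weights_nonneg [simp]: "v \<ge> 0 \<Longrightarrow> sup_weight v \<ge> 0" "v \<ge> 0 \<Longrightarrow> resolvent_weight v \<ge> 0" "v \<ge> 0 \<Longrightarrow> renewal_weight v \<ge> 0" "v \<ge> 0 \<Longrightarrow> hit_weight v \<ge> 0"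
  by (auto simp: sup_weight_def resolvent_weight_def renewal_weight_def hit_weight_def)

lemma exp_mix_measurable [measurable]:
  assumes [measurable]: "w \<in> borel_measurable borel"
  shows "exp_mix w \<in> borel_measurable borel"
  unfolding exp_mix_def [abs_def] by measurable

lemma AE_lborel_neq: "AE v in lborel. v \<noteq> (c::real)"
  by (rule AE_lborel_singleton)

lemma nn_integral_exp_Ioi:
  assumes "s > 0"
  shows "(\<integral>\<^sup>+a. ennreal (exp (- (s * a))) * indicator {x<..} a \<partial>lborel) = ennreal (exp (- (s * x)) / s)"
proof -
  have "(\<integral>\<^sup>+a. ennreal (exp (- (s * a))) * indicator {x<..} a \<partial>lborel)
      = (\<integral>\<^sup>+a. ennreal (exp (- (s * a))) * indicator {x..} a \<partial>lborel)"
    using AE_lborel_neq[of x] by (intro nn_integral_cong_AE) (auto elim!: eventually_mono split: split_indicator)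
  also have "\<dots> = ennreal (0 - (- exp (- (s * x)) / s))"
  proof (rule nn_integral_FTC_atLeast)
    show "((\<lambda>a. - exp (- (s * a)) / s) \<longlongrightarrow> 0) at_top" using assms by real_asymp
    show "((\<lambda>a. - exp (- (s * a)) / s) has_real_derivative exp (- (s * a))) (at a)" for a
      using assms by (auto intro!: derivative_eq_intros)
  qed auto
  finally show ?thesis by simp
qed

text \<open>Exchange the integrals over the rate and over a. Taking x = 0 gives the Laplace
  transform of a mixture, taking l = 0 its tail.\<close>

lemma nn_integral_exp_mix_Ioi:
  assumes w [measurable]: "w \<in> borel_measurable borel" and w0: "\<And>v. v \<ge> 0 \<Longrightarrow> w v \<ge> 0" and l: "l \<ge> 0" and x: "x \<ge> 0"
  shows "(\<integral>\<^sup>+a. ennreal (exp (- (l * a))) * exp_mix w a * indicator {x<..} a \<partial>lborel)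
     = (\<integral>\<^sup>+v. ennreal (w v / (v ^ 3 + l) * exp (- ((v ^ 3 + l) * x))) * indicator {0..} v \<partial>lborel)"
proof -
  have "(\<integral>\<^sup>+a. ennreal (exp (- (l * a))) * exp_mix w a * indicator {x<..} a \<partial>lborel)
     = (\<integral>\<^sup>+a. \<integral>\<^sup>+v. ennreal (exp (- (l * a))) * indicator {x<..} a * (ennreal (w v * exp (- (v ^ 3 * a))) * indicator {0..} v) \<partial>lborel \<partial>lborel)"
    unfolding exp_mix_def by (subst nn_integral_cmult) (auto simp: mult_ac intro!: nn_integral_cong)
  also have "\<dots> = (\<integral>\<^sup>+v. \<integral>\<^sup>+a. ennreal (exp (- (l * a))) * indicator {x<..} a * (ennreal (w v * exp (- (v ^ 3 * a))) * indicator {0..} v) \<partial>lborel \<partial>lborel)"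
    by (rule lborel_pair.Fubini') measurable
  also have "\<dots> = (\<integral>\<^sup>+v. ennreal (w v / (v ^ 3 + l) * exp (- ((v ^ 3 + l) * x))) * indicator {0..} v \<partial>lborel)"
  \<comment> \<open>At v = 0 the rate v^3 + l can be 0, and then the exponential integral diverges;
    this single point is discarded.\<close>
  proof (rule nn_integral_cong_AE, use AE_lborel_neq[of 0] in eventually_elim)
    case (elim v)
    show ?case
    proof (cases "v > 0")
      case True
      have s: "v ^ 3 + l > 0" using True l by (auto intro: add_pos_nonneg)
      have "(\<integral>\<^sup>+a. ennreal (exp (- (l * a))) * indicator {x<..} a * (ennreal (w v * exp (- (v ^ 3 * a))) * indicator {0..} v) \<partial>lborel)
        = (\<integral>\<^sup>+a. ennreal (w v) * (ennreal (exp (- ((v ^ 3 + l) * a))) * indicator {x<..} a) \<partial>lborel)"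
        using True w0[of v]
        by (intro nn_integral_cong) (auto split: split_indicator simp: ennreal_mult'[symmetric] exp_add[symmetric] algebra_simps)
      also have "\<dots> = ennreal (w v) * ennreal (exp (- ((v ^ 3 + l) * x)) / (v ^ 3 + l))"
        by (subst nn_integral_cmult) (auto simp: nn_integral_exp_Ioi[OF s])
      also have "\<dots> = ennreal (w v / (v ^ 3 + l) * exp (- ((v ^ 3 + l) * x))) * indicator {0..} v"
        using True w0[of v] s by (simp add: ennreal_mult'[symmetric])
      finally show ?thesis .
    next
      case False
      then show ?thesis using elim by simp
    qed
  qed
  finally show ?thesis .
qed

lemma exp_mix_laplace:
  assumes w [measurable]: "w \<in> borel_measurable borel" and w0: "\<And>v. v \<ge> 0 \<Longrightarrow> w v \<ge> 0" and l: "l \<ge> 0"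
  shows "(\<integral>\<^sup>+a. ennreal (exp (- (l * a))) * exp_mix w a * indicator {0<..} a \<partial>lborel)
     = (\<integral>\<^sup>+v. ennreal (w v / (v ^ 3 + l)) * indicator {0..} v \<partial>lborel)"
  using nn_integral_exp_mix_Ioi[OF assms, of 0] by simp

text \<open>In the Wiener--Hopf factorization this is the density of the scaled supremum of the
  increments up to the exponential time, whence the name.\<close>

definition sup_density :: "real \<Rightarrow> ennreal" where "sup_density x = exp_mix sup_weight x * indicator {0<..} x"

lemma sup_density_measurable [measurable]: "sup_density \<in> borel_measurable borel"
  unfolding sup_density_def [abs_def] by measurable

text \<open>Integrating the exponentials divides the weight by the rate v^3, which turns
  \<open>sup_weight\<close> into \<open>hit_weight\<close>.\<close>

lemma sup_density_tail:
  assumes "x \<ge> 0"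
  shows "(\<integral>\<^sup>+a. sup_density a * indicator {x<..} a \<partial>lborel) = exp_mix hit_weight x"
proof -
  have "(\<integral>\<^sup>+a. sup_density a * indicator {x<..} a \<partial>lborel)
    = (\<integral>\<^sup>+a. ennreal (exp (- (0 * a))) * exp_mix sup_weight a * indicator {x<..} a \<partial>lborel)"
    using assms by (intro nn_integral_cong) (auto simp: sup_density_def split: split_indicator)
  also have "\<dots> = (\<integral>\<^sup>+v. ennreal (sup_weight v / (v ^ 3 + 0) * exp (- ((v ^ 3 + 0) * x))) * indicator {0..} v \<partial>lborel)"
    using assms by (intro nn_integral_exp_mix_Ioi) auto
  also have "\<dots> = exp_mix hit_weight x"
    unfolding exp_mix_def
  proof (rule nn_integral_cong_AE, use AE_lborel_neq[of 0] in eventually_elim)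
    case (elim v)
    have "sup_weight v / (v ^ 3 + 0) = hit_weight v" using elim by (simp add: sup_weight_def hit_weight_def eval_nat_numeral)
    then show ?case by simp
  qed
  finally show ?thesis .
qed

lemma exp_mix_hit_weight_0: "exp_mix hit_weight 0 = 1"
proof -
  have "exp_mix hit_weight 0 = (\<integral>\<^sup>+v. ennreal mix_const * (ennreal (v / (v ^ 3 + 1 ^ 3)) * indicator {0..} v) \<partial>lborel)"
    unfolding exp_mix_def hit_weight_def by (intro nn_integral_cong)
      (auto simp: ennreal_mult'[symmetric] add.commute split: split_indicator)
  also have "\<dots> = ennreal mix_const * ennreal (1 / (mix_const * 1))"
    by (subst nn_integral_cmult) (use nn_integral_cubic(2)[of 1] in auto)
  also have "\<dots> = 1" by (simp flip: ennreal_mult')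
  finally show ?thesis .
qed

text \<open>Partial fractions in v^3 split the integrand into two terms of the type v / (c + v^3),
  with the common denominator 1 - k^3. This excludes k = 1, which the applications avoid by omitting
  a null set or by having k^3 at least 2.\<close>

lemma sup_density_laplace:
  assumes k: "k > 0" "k \<noteq> 1"
  shows "(\<integral>\<^sup>+a. ennreal (exp (- (k ^ 3 * a))) * sup_density a \<partial>lborel) = ennreal ((1 + k) / (1 + k + k\<^sup>2))"
proof -
  have k3: "1 - k ^ 3 \<noteq> 0"
  proof
    assume "1 - k ^ 3 = 0"
    then have "k ^ 3 = 1 ^ 3" by simp
    then have "k = 1" using k(1) by (subst (asm) power_eq_iff_eq_base) auto
    with k show False by simp
  qed
  have "(\<integral>\<^sup>+a. ennreal (exp (- (k ^ 3 * a))) * sup_density a \<partial>lborel)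
      = (\<integral>\<^sup>+a. ennreal (exp (- (k ^ 3 * a))) * exp_mix sup_weight a * indicator {0<..} a \<partial>lborel)"
    by (simp add: sup_density_def mult.assoc)
  also have "\<dots> = (\<integral>\<^sup>+v. ennreal (sup_weight v / (v ^ 3 + k ^ 3)) * indicator {0..} v \<partial>lborel)"
    using k by (intro exp_mix_laplace) auto
  also have "\<dots> = ennreal (mix_const * ((pi / (2 * sqrt 3) - k\<^sup>2 * (pi / (2 * sqrt 3))) / (1 - k ^ 3)) -
       mix_const * ((inv_cubic_prim1 0 - k\<^sup>2 * inv_cubic_prim1 (0 / k)) / (1 - k ^ 3)))"
  proof (rule nn_integral_FTC_atLeast)
    have fl: "filterlim (\<lambda>v::real. v / k) at_top at_top" using k by real_asymp
    show "((\<lambda>v. mix_const * ((inv_cubic_prim1 v - k\<^sup>2 * inv_cubic_prim1 (v / k)) / (1 - k ^ 3)))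
      \<longlongrightarrow> mix_const * ((pi / (2 * sqrt 3) - k\<^sup>2 * (pi / (2 * sqrt 3))) / (1 - k ^ 3))) at_top"
      using k3 by (intro tendsto_divide tendsto_diff tendsto_mult tendsto_const inv_cubic_prim1_at_top
         filterlim_compose[OF inv_cubic_prim1_at_top fl]) auto
    fix v :: real assume v: "0 \<le> v"
    have d: "((\<lambda>v. v / k) has_real_derivative 1 / k) (at v)"
      using k by (auto intro!: derivative_eq_intros)
    have p: "v ^ 3 + k ^ 3 > 0" "1 + v ^ 3 > 0" using v k by (simp_all add: add_nonneg_pos add_pos_nonneg)
    show "((\<lambda>v. mix_const * ((inv_cubic_prim1 v - k\<^sup>2 * inv_cubic_prim1 (v / k)) / (1 - k ^ 3)))
        has_real_derivative sup_weight v / (v ^ 3 + k ^ 3)) (at v)"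
    proof (rule DERIV_cong[OF DERIV_cmult[OF DERIV_cdivide[OF DERIV_diff[OF inv_cubic_prim1_deriv
         DERIV_cmult[OF DERIV_chain2[OF inv_cubic_prim1_deriv d]]]]]])
      have "1 + (v / k) ^ 3 = (v ^ 3 + k ^ 3) / k ^ 3" using k by (simp add: field_simps)
      then have "k\<^sup>2 * (v / k / (1 + (v / k) ^ 3) * (1 / k)) = v * k ^ 3 / (v ^ 3 + k ^ 3)"
        using k by (simp add: power2_eq_square power3_eq_cube)
      moreover have "v / (1 + v ^ 3) - v * k ^ 3 / (v ^ 3 + k ^ 3) = (1 - k ^ 3) * (v ^ 4 / ((1 + v ^ 3) * (v ^ 3 + k ^ 3)))"
        using p by (simp add: divide_simps) (simp add: algebra_simps eval_nat_numeral)
      ultimately show "mix_const * ((v / (1 + v ^ 3) - k\<^sup>2 * (v / k / (1 + (v / k) ^ 3) * (1 / k))) / (1 - k ^ 3))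
         = sup_weight v / (v ^ 3 + k ^ 3)" using k3 by (simp add: sup_weight_def)
    qed (use v k in auto)
    show "0 \<le> sup_weight v / (v ^ 3 + k ^ 3)" using v p by simp
  qed measurable
  also have "mix_const * ((pi / (2 * sqrt 3) - k\<^sup>2 * (pi / (2 * sqrt 3))) / (1 - k ^ 3)) -
       mix_const * ((inv_cubic_prim1 0 - k\<^sup>2 * inv_cubic_prim1 (0 / k)) / (1 - k ^ 3))
      = mix_const * ((pi / (2 * sqrt 3) - inv_cubic_prim1 0) * ((1 - k\<^sup>2) / (1 - k ^ 3)))"
    by (simp add: algebra_simps diff_divide_distrib add_divide_distrib)
  also have "\<dots> = (1 - k\<^sup>2) / (1 - k ^ 3)"
    unfolding inv_cubic_prim_0 sqrt3_consts by simp
  also have "\<dots> = (1 + k) / (1 + k + k\<^sup>2)"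
  proof -
    have "1 - k ^ 3 = (1 - k) * (1 + k + k\<^sup>2)" "1 - k\<^sup>2 = (1 - k) * (1 + k)"
      by (simp_all add: algebra_simps power2_eq_square power3_eq_cube)
    then show ?thesis using k by simp
  qed
  finally show ?thesis .
qed

text \<open>The left-hand side is the density of A - A' at x. Expanding the first factor as a
  mixture, the integral over b becomes the Laplace transform of \<open>sup_density\<close> at v^3,
  and multiplication by it turns \<open>sup_weight\<close> into
  \<open>resolvent_weight\<close>.\<close>

lemma sup_density_shift:
  assumes x: "x > 0"
  shows "(\<integral>\<^sup>+b. sup_density (x + b) * sup_density b \<partial>lborel) = exp_mix resolvent_weight x"
proof -
  let ?A = "\<lambda>v b. ennreal (sup_weight v * exp (- (v ^ 3 * (x + b)))) * indicator {0..} v"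
  have "(\<integral>\<^sup>+b. sup_density (x + b) * sup_density b \<partial>lborel)
    = (\<integral>\<^sup>+b. \<integral>\<^sup>+v. ?A v b * sup_density b \<partial>lborel \<partial>lborel)"
  proof (rule nn_integral_cong)
    fix b :: real
    show "sup_density (x + b) * sup_density b = (\<integral>\<^sup>+v. ?A v b * sup_density b \<partial>lborel)"
    proof (cases "b > 0")
      case True
      then have "sup_density (x + b) = exp_mix sup_weight (x + b)" using x by (simp add: sup_density_def)
      also have "\<dots> * sup_density b = (\<integral>\<^sup>+v. ?A v b * sup_density b \<partial>lborel)"
        unfolding exp_mix_def by (rule nn_integral_multc[symmetric]) measurable
      finally show ?thesis .
    qed (simp add: sup_density_def)
  qed
  also have "\<dots> = (\<integral>\<^sup>+v. \<integral>\<^sup>+b. ?A v b * sup_density b \<partial>lborel \<partial>lborel)"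
    by (rule lborel_pair.Fubini') measurable
  also have "\<dots> = exp_mix resolvent_weight x"
    unfolding exp_mix_def
  proof (rule nn_integral_cong_AE, use AE_lborel_neq[of 0] AE_lborel_neq[of 1] in eventually_elim)
    case (elim v)
    show ?case
    proof (cases "v > 0")
      case True
      have "(\<integral>\<^sup>+b. ?A v b * sup_density b \<partial>lborel)
        = (\<integral>\<^sup>+b. ennreal (sup_weight v * exp (- (v ^ 3 * x))) * (ennreal (exp (- (v ^ 3 * b))) * sup_density b) \<partial>lborel)"
      proof (rule nn_integral_cong)
        fix b :: real
        have "sup_weight v * exp (- (v ^ 3 * (x + b))) = sup_weight v * exp (- (v ^ 3 * x)) * exp (- (v ^ 3 * b))"
          by (simp add: exp_add[symmetric] distrib_left)
        then have "ennreal (sup_weight v * exp (- (v ^ 3 * (x + b)))) = ennreal (sup_weight v * exp (- (v ^ 3 * x))) * ennreal (exp (- (v ^ 3 * b)))"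
          using True by (simp add: ennreal_mult'[symmetric])
        then show "?A v b * sup_density b
          = ennreal (sup_weight v * exp (- (v ^ 3 * x))) * (ennreal (exp (- (v ^ 3 * b))) * sup_density b)"
          using True by (simp add: mult.assoc)
      qed
      also have "\<dots> = ennreal (sup_weight v * exp (- (v ^ 3 * x))) * ennreal ((1 + v) / (1 + v + v\<^sup>2))"
        using True elim by (subst nn_integral_cmult) (auto simp: sup_density_laplace)
      also have "\<dots> = ennreal (sup_weight v * ((1 + v) / (1 + v + v\<^sup>2)) * exp (- (v ^ 3 * x)))"
        using True by (subst ennreal_mult'[symmetric]) (auto simp: mult_ac)
      also have "sup_weight v * ((1 + v) / (1 + v + v\<^sup>2)) = resolvent_weight v"
      proof -
        have *: "mix_const * v ^ 4 / (a * b) * (a / d) = mix_const * v ^ 4 / (b * d)" if "a > 0" for a b d :: real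
          using that by simp
        have "1 + v\<^sup>2 + v ^ 4 = (1 - v + v\<^sup>2) * (1 + v + v\<^sup>2)"
          by (simp add: algebra_simps eval_nat_numeral)
        then show ?thesis
          unfolding sup_weight_def resolvent_weight_def cubic_factor[symmetric] using True by (simp only: *)
      qed
      finally show ?thesis using True by simp
    next
      case False
      then show ?thesis using elim by simp
    qed
  qed
  finally show ?thesis .
qed

definition resolvent_density :: "real \<Rightarrow> ennreal" where "resolvent_density x = exp_mix resolvent_weight \<bar>x\<bar>"

lemma resolvent_density_measurable [measurable]: "resolvent_density \<in> borel_measurable borel"
  unfolding resolvent_density_def [abs_def] by measurable

text \<open>For negative x the translation of b by - x interchanges the two factors, which is the
  symmetry of A - A'.\<close>

lemma resolvent_density_conv: "x \<noteq> 0 \<Longrightarrow> (\<integral>\<^sup>+b. sup_density (x + b) * sup_density b \<partial>lborel) = resolvent_density x"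
proof (cases "x > 0")
  case True
  then show ?thesis by (simp add: sup_density_shift resolvent_density_def)
next
  case False
  assume "x \<noteq> 0"
  with False have x: "- x > 0" by simp
  have "(\<integral>\<^sup>+b. sup_density (x + b) * sup_density b \<partial>lborel) = (\<integral>\<^sup>+b. sup_density (x + (- x + 1 * b)) * sup_density (- x + 1 * b) \<partial>lborel)"
    by (subst nn_integral_real_affine[where c = 1 and t = "- x"]) auto
  also have "\<dots> = (\<integral>\<^sup>+b. sup_density (- x + b) * sup_density b \<partial>lborel)"
    by (simp add: mult.commute)
  also have "\<dots> = resolvent_density x" unfolding sup_density_shift[OF x] using x by (simp add: resolvent_density_def)
  finally show ?thesis .
qed

section \<open>The renewal kernel and the tail identity\<close>

text \<open>The transform at k^3 must be 1 / k^3 divided by that of \<open>sup_density\<close>,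
  because the convolution of the two is to be the constant 1 on the half-line. This quotient is 1 /
  k^3 + 1 / (k (1 + k)): the first term is the summand 1, the second the mixture.\<close>

definition renewal_kernel :: "real \<Rightarrow> ennreal" where "renewal_kernel x = (1 + exp_mix renewal_weight x) * indicator {0<..} x"

lemma renewal_kernel_measurable [measurable]: "renewal_kernel \<in> borel_measurable borel"
  unfolding renewal_kernel_def [abs_def] by measurable

lemma renewal_kernel_laplace:
  assumes k: "k > 0"
  shows "(\<integral>\<^sup>+a. ennreal (exp (- (k ^ 3 * a))) * renewal_kernel a \<partial>lborel) = ennreal ((1 + k + k\<^sup>2) / (k ^ 3 * (1 + k)))"
proof -
  have k3: "k ^ 3 > 0" using k by simp
  have "(\<integral>\<^sup>+a. ennreal (exp (- (k ^ 3 * a))) * renewal_kernel a \<partial>lborel)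
     = (\<integral>\<^sup>+a. ennreal (exp (- (k ^ 3 * a))) * indicator {0<..} a
         + ennreal (exp (- (k ^ 3 * a))) * exp_mix renewal_weight a * indicator {0<..} a \<partial>lborel)"
    by (intro nn_integral_cong) (auto simp: renewal_kernel_def algebra_simps split: split_indicator)
  also have "\<dots> = ennreal (1 / k ^ 3) + (\<integral>\<^sup>+v. ennreal (renewal_weight v / (v ^ 3 + k ^ 3)) * indicator {0..} v \<partial>lborel)"
    using k by (subst nn_integral_add) (auto simp: nn_integral_exp_Ioi[OF k3] exp_mix_laplace)
  also have "(\<integral>\<^sup>+v. ennreal (renewal_weight v / (v ^ 3 + k ^ 3)) * indicator {0..} v \<partial>lborel) = ennreal (1 / (k * (1 + k)))"
  proof -
    obtain T where T: "(mixed_prim k \<longlongrightarrow> T) at_top" "T - mixed_prim k 0 = 1 / (mix_const * k\<^sup>2 * (1 + k))"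
      using mixed_prim_lims[OF k] by blast
    have fl: "filterlim (\<lambda>v::real. v / k) at_top at_top" using k by real_asymp
    \<comment> \<open>The primitive comes from (v + v^2) / (1 + v + v^2) = 1 - 1 / (1 + v + v^2):
      the first part is integrated by \<open>inv_cubic_prim\<close>, the second by
      \<open>mixed_prim\<close>.\<close>
    have "(\<integral>\<^sup>+v. ennreal (renewal_weight v / (v ^ 3 + k ^ 3)) * indicator {0..} v \<partial>lborel)
       = ennreal (mix_const * (pi / (2 * sqrt 3) / k\<^sup>2 - T) - mix_const * (inv_cubic_prim (0 / k) / k\<^sup>2 - mixed_prim k 0))"
    proof (rule nn_integral_FTC_atLeast)
      show "((\<lambda>v. mix_const * (inv_cubic_prim (v / k) / k\<^sup>2 - mixed_prim k v)) \<longlongrightarrow> mix_const * (pi / (2 * sqrt 3) / k\<^sup>2 - T)) at_top"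
        using k by (intro tendsto_intros T(1) filterlim_compose[OF inv_cubic_prim_at_top fl]) auto
      fix v :: real assume v: "0 \<le> v"
      have d: "((\<lambda>v. v / k) has_real_derivative 1 / k) (at v)"
        using k by (auto intro!: derivative_eq_intros)
      have p: "v ^ 3 + k ^ 3 > 0" "1 + v + v\<^sup>2 > 0" using v k quad_pos[of v] by (simp_all add: add_nonneg_pos add_pos_nonneg)
      show "((\<lambda>v. mix_const * (inv_cubic_prim (v / k) / k\<^sup>2 - mixed_prim k v)) has_real_derivative renewal_weight v / (v ^ 3 + k ^ 3)) (at v)"
      proof (rule DERIV_cong[OF DERIV_cmult[OF DERIV_diff[OF DERIV_cdivide[OF DERIV_chain2[OF inv_cubic_prim_deriv d]] mixed_prim_deriv]]])
        have "1 + (v / k) ^ 3 = (v ^ 3 + k ^ 3) / k ^ 3" using k by (simp add: field_simps)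
        then have "1 / (1 + (v / k) ^ 3) * (1 / k) / k\<^sup>2 = 1 / (v ^ 3 + k ^ 3)"
          using k by (simp add: power2_eq_square power3_eq_cube)
        moreover have "1 / a - 1 / (a * b) = (b - 1) / (b * a)" if "a > 0" "b > 0" for a b :: real
          using that by (simp add: field_simps)
        from this[OF p] have "1 / (v ^ 3 + k ^ 3) - 1 / ((v ^ 3 + k ^ 3) * (1 + v + v\<^sup>2))
           = (v + v\<^sup>2) / ((1 + v + v\<^sup>2) * (v ^ 3 + k ^ 3))" by simp
        ultimately show "mix_const * (1 / (1 + (v / k) ^ 3) * (1 / k) / k\<^sup>2 - 1 / ((v ^ 3 + k ^ 3) * (1 + v + v\<^sup>2))) = renewal_weight v / (v ^ 3 + k ^ 3)"
          by (simp only:) (simp add: renewal_weight_def power2_eq_square algebra_simps)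
      qed (use v k in auto)
      show "0 \<le> renewal_weight v / (v ^ 3 + k ^ 3)" using v p by simp
    qed measurable
    also have "mix_const * (pi / (2 * sqrt 3) / k\<^sup>2 - T) - mix_const * (inv_cubic_prim (0 / k) / k\<^sup>2 - mixed_prim k 0)
      = mix_const * ((pi / (2 * sqrt 3) - inv_cubic_prim 0) / k\<^sup>2 - (T - mixed_prim k 0))"
      by (simp add: algebra_simps diff_divide_distrib)
    also have "\<dots> = 1 / k\<^sup>2 - 1 / (k\<^sup>2 * (1 + k))"
      unfolding inv_cubic_prim_0 sqrt3_consts T(2) by (simp add: right_diff_distrib)
    also have "\<dots> = 1 / (k * (1 + k))"
    proof -
      have "1 / k\<^sup>2 - 1 / (k\<^sup>2 * c) = (c - 1) / (k * k * c)" if "c > 0" for c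
        using k that by (simp add: field_simps power2_eq_square)
      from this[of "1 + k"] k show ?thesis by simp
    qed
    finally show ?thesis .
  qed
  also have "ennreal (1 / k ^ 3) + ennreal (1 / (k * (1 + k))) = ennreal (1 / k ^ 3 + 1 / (k * (1 + k)))"
    using k by (intro ennreal_plus[symmetric]) auto
  also have "1 / k ^ 3 + 1 / (k * (1 + k)) = (1 + k + k\<^sup>2) / (k ^ 3 * (1 + k))"
  proof -
    have "1 / k ^ 3 + 1 / (k * c) = (c + k\<^sup>2) / (k ^ 3 * c)" if "c > 0" for c
      using k that by (simp add: divide_simps) (simp add: eval_nat_numeral algebra_simps)
    from this[of "1 + k"] k show ?thesis by simp
  qed
  finally show ?thesis .
qed

lemma nn_integral_shift:
  fixes f :: "real \<Rightarrow> ennreal" and c :: real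
  assumes [measurable]: "f \<in> borel_measurable borel"
  shows "(\<integral>\<^sup>+x. f x \<partial>lborel) = (\<integral>\<^sup>+x. f (x + c) \<partial>lborel)"
  using nn_integral_real_affine[of f 1 c] by (simp add: add.commute)

lemma nn_integral_convolution_laplace:
  fixes f g :: "real \<Rightarrow> ennreal"
  assumes [measurable]: "f \<in> borel_measurable borel" "g \<in> borel_measurable borel"
  shows "(\<integral>\<^sup>+x. ennreal (exp (- (l * x))) * (\<integral>\<^sup>+b. f (x - b) * g b \<partial>lborel) \<partial>lborel)
    = (\<integral>\<^sup>+x. ennreal (exp (- (l * x))) * f x \<partial>lborel) * (\<integral>\<^sup>+x. ennreal (exp (- (l * x))) * g x \<partial>lborel)"
proof -
  let ?e = "\<lambda>x. ennreal (exp (- (l * x)))"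
  have "(\<integral>\<^sup>+x. ?e x * (\<integral>\<^sup>+b. f (x - b) * g b \<partial>lborel) \<partial>lborel)
    = (\<integral>\<^sup>+x. \<integral>\<^sup>+b. ?e x * (f (x - b) * g b) \<partial>lborel \<partial>lborel)"
    by (intro nn_integral_cong nn_integral_cmult[symmetric]) measurable
  also have "\<dots> = (\<integral>\<^sup>+b. \<integral>\<^sup>+x. ?e x * (f (x - b) * g b) \<partial>lborel \<partial>lborel)"
    by (rule lborel_pair.Fubini') measurable
  also have "\<dots> = (\<integral>\<^sup>+b. (\<integral>\<^sup>+x. ?e x * f x \<partial>lborel) * (ennreal (exp (- (l * b))) * g b) \<partial>lborel)"
  proof (rule nn_integral_cong)
    fix b
    have "(\<integral>\<^sup>+x. ?e x * (f (x - b) * g b) \<partial>lborel)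
      = (\<integral>\<^sup>+x. ennreal (exp (- (l * (x + b)))) * (f (x + b - b) * g b) \<partial>lborel)"
      by (rule nn_integral_shift) measurable
    also have "\<dots> = (\<integral>\<^sup>+x. (?e x * f x) * (ennreal (exp (- (l * b))) * g b) \<partial>lborel)"
    proof (rule nn_integral_cong)
      fix x
      have "ennreal (exp (- (l * (x + b)))) = ?e x * ennreal (exp (- (l * b)))"
        by (simp add: ennreal_mult'[symmetric] exp_add[symmetric] distrib_left)
      then show "ennreal (exp (- (l * (x + b)))) * (f (x + b - b) * g b) =
        (?e x * f x) * (ennreal (exp (- (l * b))) * g b)"
        by (simp add: mult_ac)
    qed
    also have "\<dots> = (\<integral>\<^sup>+x. ?e x * f x \<partial>lborel) * (ennreal (exp (- (l * b))) * g b)"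
      by (rule nn_integral_multc) measurable
    finally show "(\<integral>\<^sup>+x. ?e x * (f (x - b) * g b) \<partial>lborel) = \<dots>" .
  qed
  also have "\<dots> = (\<integral>\<^sup>+x. ?e x * f x \<partial>lborel) * (\<integral>\<^sup>+x. ?e x * g x \<partial>lborel)"
    by (rule nn_integral_cmult) measurable
  finally show ?thesis .
qed

lemma renewal_kernel_sup_density_support: "x \<le> 0 \<Longrightarrow> renewal_kernel (x - b) * sup_density b = 0"
  by (auto simp: renewal_kernel_def sup_density_def split: split_indicator)

text \<open>The two transforms multiply to 1 / k^3, the transform of the constant 1. The auxiliary
  factor exp (- 2 x) makes the measures finite, as uniqueness requires, and leads to k^3 = n + 2,
  away from the excluded value k = 1.\<close>

lemma renewal_kernel_conv_sup_density: "AE x in lborel. x \<ge> 0 \<longrightarrow> (\<integral>\<^sup>+b. renewal_kernel (x - b) * sup_density b \<partial>lborel) = 1"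
proof -
  let ?c = "\<lambda>x. \<integral>\<^sup>+b. renewal_kernel (x - b) * sup_density b \<partial>lborel"
  have lap: "(\<integral>\<^sup>+x. ennreal (exp (- real n * x)) * (ennreal (exp (- (2 * x))) * ?c x) * indicator {0..} x \<partial>lborel) = ennreal (1 / (real n + 2))" for n
  proof -
    define k where "k = root 3 (real n + 2)"
    have k: "k ^ 3 = real n + 2" "k > 0" by (simp_all add: k_def real_root_gt_zero)
    have k1: "k \<noteq> 1" using k(1) by auto
    have "(\<integral>\<^sup>+x. ennreal (exp (- real n * x)) * (ennreal (exp (- (2 * x))) * ?c x) * indicator {0..} x \<partial>lborel)
      = (\<integral>\<^sup>+x. ennreal (exp (- (k ^ 3 * x))) * ?c x \<partial>lborel)"
    proof (rule nn_integral_cong)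
      fix x :: real
      have "ennreal (exp (- (k ^ 3 * x))) = ennreal (exp (- real n * x)) * ennreal (exp (- (2 * x)))"
        unfolding k by (simp add: ennreal_mult'[symmetric] exp_add[symmetric] algebra_simps)
      then show "ennreal (exp (- real n * x)) * (ennreal (exp (- (2 * x))) * ?c x) * indicator {0..} x = ennreal (exp (- (k ^ 3 * x))) * ?c x"
        by (auto simp: mult.assoc renewal_kernel_sup_density_support split: split_indicator)
    qed
    also have "\<dots> = ennreal ((1 + k + k\<^sup>2) / (k ^ 3 * (1 + k))) * ennreal ((1 + k) / (1 + k + k\<^sup>2))"
      using k(2) k1 by (subst nn_integral_convolution_laplace) (auto simp: renewal_kernel_laplace sup_density_laplace)
    also have "\<dots> = ennreal ((1 + k + k\<^sup>2) / (k ^ 3 * (1 + k)) * ((1 + k) / (1 + k + k\<^sup>2)))"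
      using k(2) by (intro ennreal_mult'[symmetric]) auto
    also have "(1 + k + k\<^sup>2) / (k ^ 3 * (1 + k)) * ((1 + k) / (1 + k + k\<^sup>2)) = 1 / k ^ 3"
    proof -
      have "a / (k ^ 3 * b) * (b / a) = 1 / k ^ 3" if "a > 0" "b > 0" for a b :: real
        using that k(2) by simp
      then show ?thesis using quad_pos(2)[of k] k(2) by simp
    qed
    finally show ?thesis unfolding k .
  qed
  have e: "(\<integral>\<^sup>+x. ennreal (exp (- real n * x)) * ennreal (exp (- (2 * x))) * indicator {0..} x \<partial>lborel) = ennreal (1 / (real n + 2))" for n
  proof -
    have "(\<integral>\<^sup>+x. ennreal (exp (- real n * x)) * ennreal (exp (- (2 * x))) * indicator {0..} x \<partial>lborel)
       = (\<integral>\<^sup>+x. ennreal (exp (- ((real n + 2) * x))) * indicator {0<..} x \<partial>lborel)"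
      using AE_lborel_neq[of 0]
      by (intro nn_integral_cong_AE) (auto elim!: eventually_mono split: split_indicator
         simp: ennreal_mult'[symmetric] exp_add[symmetric] algebra_simps)
    also have "\<dots> = ennreal (1 / (real n + 2))"
      by (subst nn_integral_exp_Ioi) auto
    finally show ?thesis .
  qed
  have "AE x in lborel. x \<ge> 0 \<longrightarrow> ennreal (exp (- (2 * x))) * ?c x = ennreal (exp (- (2 * x)))"
  proof (rule laplace_uniqueness)
    show "(\<integral>\<^sup>+x. ennreal (exp (- (2 * x))) * ?c x * indicator {0..} x \<partial>lborel) < \<infinity>"
    proof -
      have "(\<integral>\<^sup>+x. ennreal (exp (- (2 * x))) * ?c x * indicator {0..} x \<partial>lborel) = ennreal (1 / (real 0 + 2))"
        using lap[of 0] by simp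
      then show ?thesis by (simp only: infinity_ennreal_def ennreal_less_top)
    qed
  qed (simp_all only: lap e, measurable)
  then show ?thesis
  proof eventually_elim
    case (elim x)
    show ?case
    proof
      assume "x \<ge> 0"
      with elim have *: "ennreal (exp (- (2 * x))) * ?c x = ennreal (exp (- (2 * x)))" by simp
      have "ennreal (exp (2 * x)) * (ennreal (exp (- (2 * x))) * ?c x) = ?c x"
        by (simp add: mult.assoc[symmetric] ennreal_mult'[symmetric] exp_add[symmetric])
      moreover have "ennreal (exp (2 * x)) * ennreal (exp (- (2 * x))) = 1"
        by (simp add: ennreal_mult'[symmetric] exp_add[symmetric])
      ultimately show "?c x = 1" unfolding * by simp
    qed
  qed
qed

definition hit_transform :: "real \<Rightarrow> ennreal" where "hit_transform x = (if x \<le> 0 then 1 else exp_mix hit_weight x)"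

lemma hit_transform_eq: "hit_transform x = exp_mix hit_weight (max 0 x)"
  by (auto simp: hit_transform_def exp_mix_hit_weight_0 max_def)

lemma hit_transform_tail: "hit_transform x = (\<integral>\<^sup>+a. sup_density a * indicator {x<..} a \<partial>lborel)"
proof -
  have "(\<integral>\<^sup>+a. sup_density a * indicator {x<..} a \<partial>lborel) = (\<integral>\<^sup>+a. sup_density a * indicator {max 0 x<..} a \<partial>lborel)"
    by (intro nn_integral_cong) (auto simp: sup_density_def split: split_indicator)
  then show ?thesis by (simp add: hit_transform_eq sup_density_tail)
qed

lemma nn_integral_sup_density: "(\<integral>\<^sup>+a. sup_density a \<partial>lborel) = 1"
proof -
  have "(\<integral>\<^sup>+a. sup_density a \<partial>lborel) = (\<integral>\<^sup>+a. sup_density a * indicator {0<..} a \<partial>lborel)"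
    by (intro nn_integral_cong) (auto simp: sup_density_def split: split_indicator)
  then show ?thesis by (simp add: sup_density_tail exp_mix_hit_weight_0)
qed

text \<open>The right-hand side is the expectation of h (A - A') for independent A and A'; the point
  0, where the convolution formula is not claimed, is a null set.\<close>

lemma nn_integral_resolvent_density_mult:
  assumes [measurable]: "h \<in> borel_measurable borel"
  shows "(\<integral>\<^sup>+z. h z * resolvent_density z \<partial>lborel) = (\<integral>\<^sup>+b. (\<integral>\<^sup>+a. h (a - b) * sup_density a \<partial>lborel) * sup_density b \<partial>lborel)"
proof -
  have "(\<integral>\<^sup>+z. h z * resolvent_density z \<partial>lborel) = (\<integral>\<^sup>+z. \<integral>\<^sup>+b. h z * (sup_density (z + b) * sup_density b) \<partial>lborel \<partial>lborel)"
  proof (rule nn_integral_cong_AE, use AE_lborel_neq[of 0] in eventually_elim)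
    case (elim z)
    show ?case unfolding resolvent_density_conv[OF elim, symmetric] by (rule nn_integral_cmult[symmetric]) measurable
  qed
  also have "\<dots> = (\<integral>\<^sup>+b. \<integral>\<^sup>+z. h z * (sup_density (z + b) * sup_density b) \<partial>lborel \<partial>lborel)"
    by (rule lborel_pair.Fubini') measurable
  also have "\<dots> = (\<integral>\<^sup>+b. (\<integral>\<^sup>+a. h (a - b) * sup_density a \<partial>lborel) * sup_density b \<partial>lborel)"
  proof (rule nn_integral_cong)
    fix b
    have "(\<integral>\<^sup>+z. h z * (sup_density (z + b) * sup_density b) \<partial>lborel) = (\<integral>\<^sup>+z. h (z + - b) * (sup_density (z + - b + b) * sup_density b) \<partial>lborel)"
      by (rule nn_integral_shift) measurable
    also have "\<dots> = (\<integral>\<^sup>+z. h (z - b) * sup_density z * sup_density b \<partial>lborel)" by (simp add: mult.assoc)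
    also have "\<dots> = (\<integral>\<^sup>+a. h (a - b) * sup_density a \<partial>lborel) * sup_density b" by (rule nn_integral_multc) measurable
    finally show "(\<integral>\<^sup>+z. h z * (sup_density (z + b) * sup_density b) \<partial>lborel) = \<dots>" .
  qed
  finally show ?thesis .
qed

lemma nn_integral_resolvent_density: "(\<integral>\<^sup>+z. resolvent_density z \<partial>lborel) = 1"
  using nn_integral_resolvent_density_mult[of "\<lambda>_. 1"] by (simp add: nn_integral_sup_density)

text \<open>With A' = b fixed, the integral over A is the convolution of
  \<open>renewal_kernel\<close> and \<open>sup_density\<close> at b - x. It is 1 if b > x and 0
  otherwise, so integration over b leaves the tail of A' at x.\<close>

lemma renewal_kernel_resolvent_density: "(\<integral>\<^sup>+z. renewal_kernel (- (x + z)) * resolvent_density z \<partial>lborel) = hit_transform x"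
proof -
  let ?c = "\<lambda>x. \<integral>\<^sup>+b. renewal_kernel (x - b) * sup_density b \<partial>lborel"
  have "(\<integral>\<^sup>+z. renewal_kernel (- (x + z)) * resolvent_density z \<partial>lborel) = (\<integral>\<^sup>+b. (\<integral>\<^sup>+a. renewal_kernel (- (x + (a - b))) * sup_density a \<partial>lborel) * sup_density b \<partial>lborel)"
    by (rule nn_integral_resolvent_density_mult) measurable
  also have "\<dots> = (\<integral>\<^sup>+b. ?c (b - x) * sup_density b \<partial>lborel)"
    by (simp add: algebra_simps)
  also have "\<dots> = (\<integral>\<^sup>+b. ?c b * sup_density (b + x) \<partial>lborel)"
    by (subst nn_integral_shift[where c = x]) (auto, measurable)
  also have "\<dots> = (\<integral>\<^sup>+b. indicator {0<..} b * sup_density (b + x) \<partial>lborel)"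
  proof (rule nn_integral_cong_AE, use renewal_kernel_conv_sup_density in eventually_elim)
    case (elim b)
    then show ?case by (cases "b > 0") (auto simp: renewal_kernel_sup_density_support)
  qed
  also have "\<dots> = (\<integral>\<^sup>+b. indicator {0<..} (b + - x) * sup_density (b + - x + x) \<partial>lborel)"
    by (rule nn_integral_shift) measurable
  also have "\<dots> = hit_transform x"
    unfolding hit_transform_tail by (intro nn_integral_cong) (auto split: split_indicator)
  finally show ?thesis .
qed

section \<open>The characteristic function of the resolvent density\<close>

lemma nn_integral_even:
  fixes f :: "real \<Rightarrow> ennreal"
  assumes [measurable]: "f \<in> borel_measurable borel" and even: "\<And>x. f (- x) = f x"
  shows "(\<integral>\<^sup>+x. f x \<partial>lborel) = 2 * (\<integral>\<^sup>+x. f x * indicator {0<..} x \<partial>lborel)"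
proof -
  have "(\<integral>\<^sup>+x. f x \<partial>lborel) = (\<integral>\<^sup>+x. f x * indicator {0<..} x + f x * indicator {..<0} x \<partial>lborel)"
    using AE_lborel_neq[of 0] by (intro nn_integral_cong_AE) (auto elim!: eventually_mono split: split_indicator)
  also have "\<dots> = (\<integral>\<^sup>+x. f x * indicator {0<..} x \<partial>lborel) + (\<integral>\<^sup>+x. f x * indicator {..<0} x \<partial>lborel)"
    by (rule nn_integral_add) measurable
  also have "(\<integral>\<^sup>+x. f x * indicator {..<0} x \<partial>lborel) = (\<integral>\<^sup>+x. f (- x) * indicator {..<0} (- x) \<partial>lborel)"
    using nn_integral_real_affine[of "\<lambda>x. f x * indicator {..<0} x" "-1" 0] by simp
  also have "\<dots> = (\<integral>\<^sup>+x. f x * indicator {0<..} x \<partial>lborel)"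
    by (intro nn_integral_cong) (auto simp: even split: split_indicator)
  finally show ?thesis by (simp add: mult_2)
qed

lemma nn_integral_one_minus_cos:
  assumes s: "s > 0"
  shows "(\<integral>\<^sup>+x. ennreal ((1 - cos (z * x)) * exp (- (s * x))) * indicator {0<..} x \<partial>lborel)
     = ennreal (z\<^sup>2 / (s * (s\<^sup>2 + z\<^sup>2)))"
proof -
  let ?c = "\<lambda>x. (s * cos (z * x) - z * sin (z * x)) / (s\<^sup>2 + z\<^sup>2)"
  have p: "s\<^sup>2 + z\<^sup>2 > 0" using s by (intro add_pos_nonneg) auto
  have "(\<integral>\<^sup>+x. ennreal ((1 - cos (z * x)) * exp (- (s * x))) * indicator {0<..} x \<partial>lborel)
    = (\<integral>\<^sup>+x. ennreal ((1 - cos (z * x)) * exp (- (s * x))) * indicator {0..} x \<partial>lborel)"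
    using AE_lborel_neq[of 0] by (intro nn_integral_cong_AE) (auto elim!: eventually_mono split: split_indicator)
  also have "\<dots> = ennreal (0 - (exp (- (s * 0)) * ((s * cos (z * 0) - z * sin (z * 0)) / (s\<^sup>2 + z\<^sup>2) - 1 / s)))"
  proof (rule nn_integral_FTC_atLeast)
    show "((\<lambda>x. exp (- (s * x)) * (?c x - 1 / s)) \<longlongrightarrow> 0) at_top"
    proof (rule Lim_null_comparison)
      show "((\<lambda>x. exp (- (s * x)) * ((\<bar>s\<bar> + \<bar>z\<bar>) / (s\<^sup>2 + z\<^sup>2) + 1 / s)) \<longlongrightarrow> 0) at_top"
      proof (rule tendsto_mult_left_zero)
        show "((\<lambda>x. exp (- (s * x))) \<longlongrightarrow> 0) at_top" using s by real_asymp
      qed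
      have "\<bar>?c x - 1 / s\<bar> \<le> (\<bar>s\<bar> + \<bar>z\<bar>) / (s\<^sup>2 + z\<^sup>2) + 1 / s" for x
      proof -
        have "\<bar>s * cos (z * x) - z * sin (z * x)\<bar> \<le> \<bar>s * cos (z * x)\<bar> + \<bar>z * sin (z * x)\<bar>" by (rule abs_triangle_ineq4)
        also have "\<dots> \<le> \<bar>s\<bar> + \<bar>z\<bar>" unfolding abs_mult by (intro add_mono mult_left_le) auto
        finally have "\<bar>?c x\<bar> \<le> (\<bar>s\<bar> + \<bar>z\<bar>) / (s\<^sup>2 + z\<^sup>2)"
          unfolding abs_divide using p by (intro divide_mono) auto
        moreover have "\<bar>1 / s\<bar> = 1 / s" using s by simp
        ultimately show ?thesis by linarith
      qed
      then show "\<forall>\<^sub>F x in at_top. norm (exp (- (s * x)) * (?c x - 1 / s))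
        \<le> exp (- (s * x)) * ((\<bar>s\<bar> + \<bar>z\<bar>) / (s\<^sup>2 + z\<^sup>2) + 1 / s)"
        by (intro always_eventually allI) (simp add: abs_mult)
    qed
    fix x :: real
    have 1: "((\<lambda>x. exp (- (s * x))) has_real_derivative - s * exp (- (s * x))) (at x)"
      by (auto intro!: derivative_eq_intros)
    have 2: "((\<lambda>x. s * cos (z * x) - z * sin (z * x)) has_real_derivative - (s * z * sin (z * x)) - z * z * cos (z * x)) (at x)"
      by (auto intro!: derivative_eq_intros)
    show "((\<lambda>x. exp (- (s * x)) * (?c x - 1 / s))
       has_real_derivative (1 - cos (z * x)) * exp (- (s * x))) (at x)"
    proof (rule DERIV_cong[OF DERIV_mult[OF 1 DERIV_diff[OF DERIV_cdivide[OF 2] DERIV_const]]])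
      define E C S D where "E = exp (- (s * x))" and "C = cos (z * x)" and "S = sin (z * x)" and "D = s\<^sup>2 + z\<^sup>2"
      have "- s * E * ((s * C - z * S) / D - 1 / s) + ((- (s * z * S) - z * z * C) / D - 0) * E
        = E * (s * (1 / s)) - E * C * ((s * s + z * z) / D)"
        by (simp add: algebra_simps add_divide_distrib diff_divide_distrib)
      also have "\<dots> = (1 - C) * E"
        using p s by (simp add: D_def power2_eq_square algebra_simps)
      finally show "- s * exp (- (s * x)) * (?c x - 1 / s)
         + ((- (s * z * sin (z * x)) - z * z * cos (z * x)) / (s\<^sup>2 + z\<^sup>2) - 0) * exp (- (s * x)) = (1 - cos (z * x)) * exp (- (s * x))"
        by (simp add: E_def C_def S_def D_def)
    qed
  qed auto
  also have "0 - (exp (- (s * 0)) * ((s * cos (z * 0) - z * sin (z * 0)) / (s\<^sup>2 + z\<^sup>2) - 1 / s)) = z\<^sup>2 / (s * (s\<^sup>2 + z\<^sup>2))"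
  proof -
    have "1 / s - s / d = (d - s * s) / (s * d)" if "d > 0" for d using s that by (simp add: field_simps)
    from this[OF p] show ?thesis by (simp add: power2_eq_square)
  qed
  finally show ?thesis .
qed

text \<open>Using 1 - cos keeps the integrand nonnegative, so that the order of integration can be
  exchanged in \<open>ennreal\<close>. The rate v^3 contributes z^2 / (v^3 (v^6 + z^2)), and the
  substitution u = v^2 reduces the rest to \<open>mixed_prim\<close> with k^3 = z^2.\<close>

lemma resolvent_density_one_minus_cos:
  assumes "z \<noteq> 0" and k: "k = \<bar>z\<bar> powr (2 / 3)"
  shows "(\<integral>\<^sup>+x. ennreal (1 - cos (z * x)) * resolvent_density x \<partial>lborel) = ennreal (k / (1 + k))"
proof -
  let ?V = "\<lambda>v. mix_const * z\<^sup>2 * (v / (((v\<^sup>2) ^ 3 + k ^ 3) * (1 + v\<^sup>2 + (v\<^sup>2)\<^sup>2)))"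
  let ?E = "\<lambda>v x. ennreal (resolvent_weight v * exp (- (v ^ 3 * x))) * indicator {0..} v"
  have k0: "k > 0" using assms by simp
  have k3: "k ^ 3 = z\<^sup>2"
  proof -
    have "k ^ 3 = k powr 3" using k0 using powr_realpow[of k 3] by simp
    also have "\<dots> = \<bar>z\<bar> powr 2" by (simp add: k powr_powr)
    also have "\<dots> = z\<^sup>2" using assms(1) by (simp add: powr_realpow[of "\<bar>z\<bar>" 2, simplified])
    finally show ?thesis .
  qed
  have "(\<integral>\<^sup>+x. ennreal (1 - cos (z * x)) * resolvent_density x \<partial>lborel) = 2 * (\<integral>\<^sup>+x. ennreal (1 - cos (z * x)) * resolvent_density x * indicator {0<..} x \<partial>lborel)"
    by (rule nn_integral_even) (auto simp: resolvent_density_def)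
  also have "(\<integral>\<^sup>+x. ennreal (1 - cos (z * x)) * resolvent_density x * indicator {0<..} x \<partial>lborel)
    = (\<integral>\<^sup>+x. \<integral>\<^sup>+v. ennreal (1 - cos (z * x)) * indicator {0<..} x * (?E v x) \<partial>lborel \<partial>lborel)"
  proof (rule nn_integral_cong)
    fix x
    have "ennreal (1 - cos (z * x)) * resolvent_density x * indicator {0<..} x = ennreal (1 - cos (z * x)) * indicator {0<..} x * exp_mix resolvent_weight x"
      by (auto simp: resolvent_density_def split: split_indicator)
    also have "\<dots> = (\<integral>\<^sup>+v. ennreal (1 - cos (z * x)) * indicator {0<..} x * (?E v x) \<partial>lborel)"
      unfolding exp_mix_def by (rule nn_integral_cmult[symmetric]) measurable
    finally show "ennreal (1 - cos (z * x)) * resolvent_density x * indicator {0<..} x = \<dots>" .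
  qed
  also have "\<dots> = (\<integral>\<^sup>+v. \<integral>\<^sup>+x. ennreal (1 - cos (z * x)) * indicator {0<..} x * (?E v x) \<partial>lborel \<partial>lborel)"
    by (rule lborel_pair.Fubini') measurable
  also have "\<dots> = (\<integral>\<^sup>+v. ennreal (?V v) * indicator {0..} v \<partial>lborel)"
  proof (rule nn_integral_cong_AE, use AE_lborel_neq[of 0] in eventually_elim)
    case (elim v)
    show ?case
    proof (cases "v > 0")
      case True
      have v3: "v ^ 3 > 0" using True by simp
      have "(\<integral>\<^sup>+x. ennreal (1 - cos (z * x)) * indicator {0<..} x * (?E v x) \<partial>lborel)
        = (\<integral>\<^sup>+x. ennreal (resolvent_weight v) * (ennreal ((1 - cos (z * x)) * exp (- (v ^ 3 * x))) * indicator {0<..} x) \<partial>lborel)"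
        using True by (intro nn_integral_cong) (auto simp: ennreal_mult'[symmetric] mult_ac split: split_indicator)
      also have "\<dots> = ennreal (resolvent_weight v) * ennreal (z\<^sup>2 / (v ^ 3 * ((v ^ 3)\<^sup>2 + z\<^sup>2)))"
        by (subst nn_integral_cmult) (auto simp: nn_integral_one_minus_cos[OF v3])
      also have "\<dots> = ennreal (resolvent_weight v * (z\<^sup>2 / (v ^ 3 * ((v ^ 3)\<^sup>2 + z\<^sup>2))))"
        using True by (intro ennreal_mult'[symmetric]) auto
      also have "resolvent_weight v * (z\<^sup>2 / (v ^ 3 * ((v ^ 3)\<^sup>2 + z\<^sup>2))) = ?V v"
      proof -
        have *: "mix_const * v ^ 4 / a * (z\<^sup>2 / (v ^ 3 * b)) = mix_const * z\<^sup>2 * (v / (b * a))" for a b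
          using True by (simp add: divide_simps) (simp add: eval_nat_numeral)
        have "(v ^ 3)\<^sup>2 = (v\<^sup>2) ^ 3" "v ^ 4 = (v\<^sup>2)\<^sup>2" by (simp_all flip: power_mult)
        then show ?thesis unfolding resolvent_weight_def * k3 by simp
      qed
      finally show ?thesis using True by simp
    next
      case False
      then show ?thesis using elim by simp
    qed
  qed
  also have "\<dots> = ennreal (k / (1 + k) / 2)"
  proof -
    obtain T where T: "(mixed_prim k \<longlongrightarrow> T) at_top" "T - mixed_prim k 0 = 1 / (mix_const * k\<^sup>2 * (1 + k))"
      using mixed_prim_lims[OF k0] by blast
    have fl: "filterlim (\<lambda>v::real. v\<^sup>2) at_top at_top" by real_asymp
    have "(\<integral>\<^sup>+v. ennreal (?V v) * indicator {0..} v \<partial>lborel)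
       = ennreal (mix_const * z\<^sup>2 / 2 * T - mix_const * z\<^sup>2 / 2 * mixed_prim k (0\<^sup>2))"
    proof (rule nn_integral_FTC_atLeast)
      show "((\<lambda>v. mix_const * z\<^sup>2 / 2 * mixed_prim k (v\<^sup>2)) \<longlongrightarrow> mix_const * z\<^sup>2 / 2 * T) at_top"
        by (intro tendsto_mult_left filterlim_compose[OF T(1) fl])
      fix v :: real assume v: "0 \<le> v"
      have d: "((\<lambda>v. v\<^sup>2) has_real_derivative 2 * v) (at v)" by (auto intro!: derivative_eq_intros)
      show "((\<lambda>v. mix_const * z\<^sup>2 / 2 * mixed_prim k (v\<^sup>2)) has_real_derivative
         ?V v) (at v)"
        by (rule DERIV_cong[OF DERIV_cmult[OF DERIV_chain2[OF mixed_prim_deriv[OF k0] d]]]) auto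
      show "0 \<le> ?V v"
        using v k0 by (auto intro!: mult_nonneg_nonneg divide_nonneg_nonneg add_nonneg_nonneg)
    qed measurable
    also have "mix_const * z\<^sup>2 / 2 * T - mix_const * z\<^sup>2 / 2 * mixed_prim k (0\<^sup>2) = mix_const * z\<^sup>2 / 2 * (T - mixed_prim k 0)"
      by (simp add: right_diff_distrib)
    also have "\<dots> = k / (1 + k) / 2"
      unfolding T(2) k3[symmetric] using k0 by (simp add: power2_eq_square power3_eq_cube)
    finally show ?thesis .
  qed
  also have "2 * ennreal (k / (1 + k) / 2) = ennreal (2 * (k / (1 + k) / 2))"
    using k0 by (subst ennreal_mult') auto
  also have "2 * (k / (1 + k) / 2) = k / (1 + k)"
  proof -
    have "2 * (c / 2) = c" for c :: real by simp
    then show ?thesis .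
  qed
  finally show ?thesis .
qed

lemma real_distribution_resolvent_density: "real_distribution (density lborel resolvent_density)"
proof -
  have "prob_space (density lborel resolvent_density)"
    by (rule prob_spaceI) (simp add: emeasure_density nn_integral_resolvent_density)
  then show ?thesis by (simp add: real_distribution_def real_distribution_axioms_def)
qed

text \<open>By symmetry of the law the characteristic function equals its own conjugate, so only its
  real part, an integral of cos, has to be computed.\<close>

lemma char_resolvent_density: "char (density lborel resolvent_density) z = of_real (1 / (1 + \<bar>z\<bar> powr (2 / 3)))"
proof -
  interpret R: real_distribution "density lborel resolvent_density" by (rule real_distribution_resolvent_density)
  let ?R = "density lborel resolvent_density"
  have sym: "distr ?R borel uminus = ?R"
  proof (rule measure_eqI)
    fix A assume "A \<in> sets (distr ?R borel uminus)"
    then have [measurable]: "A \<in> sets borel" by simp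
    have "emeasure (distr ?R borel uminus) A = (\<integral>\<^sup>+x. resolvent_density x * indicator A (- x) \<partial>lborel)"
    proof -
      have [measurable]: "uminus -` A \<in> sets borel" using measurable_sets_borel[of uminus borel A] by simp
      show ?thesis
        by (subst emeasure_distr) (auto simp: emeasure_density intro!: nn_integral_cong split: split_indicator)
    qed
    also have "\<dots> = (\<integral>\<^sup>+x. resolvent_density x * indicator A x \<partial>lborel)"
      using nn_integral_real_affine[of "\<lambda>x. resolvent_density x * indicator A x" "-1" 0] by (simp add: resolvent_density_def)
    also have "\<dots> = emeasure ?R A" by (simp add: emeasure_density)
    finally show "emeasure (distr ?R borel uminus) A = emeasure ?R A" .
  qed simp
  have int: "integrable ?R (\<lambda>x. iexp (z * x))" for z
    by (rule R.integrable_const_bound[of _ 1]) (auto simp del: of_real_mult)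
  have "char ?R z = char (distr ?R borel uminus) z" by (simp add: sym)
  also have "\<dots> = (CLINT x|?R. cnj (iexp (z * x)))"
    unfolding char_def by (subst integral_distr) (auto simp: exp_cnj)
  also have "\<dots> = cnj (char ?R z)" unfolding char_def by (rule integral_bounded_linear[OF bounded_linear_cnj int])
  finally have Im: "Im (char ?R z) = 0" by (metis cnj.simps(2) neg_equal_zero)
  have "Re (char ?R z) = (LINT x|?R. Re (iexp (z * x)))"
    unfolding char_def by (rule integral_Re[symmetric]) (rule int)
  also have "\<dots> = (LINT x|?R. cos (z * x))" by (simp add: Re_exp)
  also have "\<dots> = (LINT x|?R. 1 - (1 - cos (z * x)))" by simp
  also have "\<dots> = 1 - (LINT x|?R. 1 - cos (z * x))"
    using R.prob_space by (subst Bochner_Integration.integral_diff) (auto intro!: R.integrable_const_bound[of _ 2] simp: abs_le_iff add_increasing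
       intro: order_trans[OF cos_le_one])
  also have "(LINT x|?R. 1 - cos (z * x)) = enn2real (\<integral>\<^sup>+x. ennreal (1 - cos (z * x)) * resolvent_density x \<partial>lborel)"
    by (subst integral_eq_nn_integral) (auto simp: nn_integral_density mult.commute)
  also have "\<dots> = 1 - 1 / (1 + \<bar>z\<bar> powr (2 / 3))"
  proof (cases "z = 0")
    case False
    have "k / (1 + k) = 1 - 1 / (1 + k)" if "k > 0" for k :: real using that by (simp add: field_simps)
    then have e: "\<bar>z\<bar> powr (2 / 3) / (1 + \<bar>z\<bar> powr (2 / 3)) = 1 - 1 / (1 + \<bar>z\<bar> powr (2 / 3))"
      using False by simp
    have "enn2real (ennreal (\<bar>z\<bar> powr (2 / 3) / (1 + \<bar>z\<bar> powr (2 / 3)))) = \<bar>z\<bar> powr (2 / 3) / (1 + \<bar>z\<bar> powr (2 / 3))"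
      by (rule enn2real_ennreal) simp
    then show ?thesis unfolding resolvent_density_one_minus_cos[OF False refl] e .
  qed simp
  finally show ?thesis using Im by (simp add: complex_eq_iff)
qed

section \<open>The entire extension of the Laplace transform\<close>

text \<open>An entire function has a primitive on the plane, and the normalisation at 0 makes it
  unique: it is the integral of exp (- (w^3)) from 0 to v along any path.\<close>

definition exp_cube_prim :: "complex \<Rightarrow> complex" where
  "exp_cube_prim = (SOME P. P 0 = 0 \<and> (\<forall>v. (P has_field_derivative exp (- (v ^ 3))) (at v)))"

lemma exp_cube_prim: "exp_cube_prim 0 = 0" "(exp_cube_prim has_field_derivative exp (- (v ^ 3))) (at v)"
proof -
  have "(\<lambda>v::complex. exp (- (v ^ 3))) holomorphic_on UNIV" by (intro holomorphic_intros)
  then obtain g where g: "(g has_field_derivative exp (- (v ^ 3))) (at v)" for v :: complex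
    using holomorphic_convex_primitive'[of UNIV "\<lambda>v. exp (- (v ^ 3))"] by auto
  have "((\<lambda>v. g v - g 0) has_field_derivative exp (- (v ^ 3))) (at v)" for v
    using DERIV_diff[OF g DERIV_const[of "g 0"]] by simp
  then have "\<exists>P. P 0 = 0 \<and> (\<forall>v::complex. (P has_field_derivative exp (- (v ^ 3))) (at v))"
    by (intro exI[of _ "\<lambda>v. g v - g 0"]) auto
  from someI_ex[OF this] show "exp_cube_prim 0 = 0" "(exp_cube_prim has_field_derivative exp (- (v ^ 3))) (at v)"
    unfolding exp_cube_prim_def by auto
qed

lemma exp_cube_prim_linepath:
  "((\<lambda>z. exp (- (z ^ 3))) has_contour_integral (exp_cube_prim b - exp_cube_prim a)) (linepath a b)"
  using contour_integral_primitive[of UNIV exp_cube_prim "\<lambda>v. exp (- (v ^ 3))" "linepath a b"] exp_cube_prim(2)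
  by simp

lemma exp_cube_prim_integral:
  "((\<lambda>t. exp (- ((a + of_real t * d) ^ 3)) * d) has_integral (exp_cube_prim (a + d) - exp_cube_prim a)) {0..1}"
proof -
  have "linepath a (a + d) x = a + of_real x * d" for x
    by (simp add: linepath_def scaleR_conv_of_real algebra_simps)
  then show ?thesis
    using exp_cube_prim_linepath[where a = a and b = "a + d"] unfolding has_contour_integral_linepath by simp
qed

definition exp_cube_int :: "real \<Rightarrow> real" where "exp_cube_int a = integral {0..a} (\<lambda>t. exp (- (t ^ 3)))"

lemma exp_cube_int_deriv: "a \<ge> 0 \<Longrightarrow> (exp_cube_int has_real_derivative exp (- (a ^ 3))) (at a within {0..})"
proof -
  assume a: "a \<ge> 0"
  have "(exp_cube_int has_real_derivative exp (- (a ^ 3))) (at a within {0..a+1})"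
    unfolding exp_cube_int_def [abs_def] using a
    by (intro integral_has_real_derivative continuous_intros) auto
  moreover have "at a within {0..} = at a within {0..a+1}"
    by (rule at_within_nhd[of _ "{..<a+1}"]) auto
  ultimately show ?thesis by simp
qed

text \<open>Both sides vanish at 0 and have the same derivative along the half-line.\<close>

lemma exp_cube_prim_of_real: "a \<ge> 0 \<Longrightarrow> exp_cube_prim (of_real a) = of_real (exp_cube_int a)"
proof -
  assume a: "a \<ge> 0"
  have "((\<lambda>t. exp_cube_prim (of_real t) - of_real (exp_cube_int t)) has_derivative (\<lambda>_. 0)) (at t within {0..})" if "t \<in> {0..}" for t
  proof -
    have 1: "((\<lambda>t. exp_cube_prim (of_real t)) has_vector_derivative exp (- (of_real t ^ 3))) (at t within {0..})"
      using field_vector_diff_chain_within[of of_real 1 t "{0..}" exp_cube_prim "exp (- (of_real t ^ 3))"]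
        exp_cube_prim(2)[of "of_real t"]
      by (simp add: o_def has_field_derivative_at_within has_vector_derivative_of_real[OF DERIV_ident, simplified])
    have 2: "((\<lambda>t. of_real (exp_cube_int t) :: complex) has_vector_derivative of_real (exp (- (t ^ 3)))) (at t within {0..})"
      using that by (intro has_vector_derivative_of_real exp_cube_int_deriv) auto
    have "((\<lambda>t. exp_cube_prim (of_real t) - of_real (exp_cube_int t)) has_vector_derivative 0) (at t within {0..})"
      using has_vector_derivative_diff[OF 1 2] by (simp flip: of_real_exp of_real_power of_real_minus)
    then show ?thesis by (simp add: has_vector_derivative_def)
  qed
  from has_derivative_zero_constant[OF _ this]
  obtain c where c: "\<And>t. t \<in> {0..} \<Longrightarrow> exp_cube_prim (of_real t) - of_real (exp_cube_int t) = c" by auto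
  from c[of 0] have "c = 0" by (simp add: exp_cube_prim exp_cube_int_def)
  with c[of a] a show ?thesis by simp
qed

text \<open>This number is Gamma (4 / 3), as shown in \<open>Gamma_third\<close>; its finiteness is
  \<open>exp_cube_total_nn\<close>.\<close>

definition exp_cube_total :: real where "exp_cube_total = enn2real (\<integral>\<^sup>+t. ennreal (exp (- (t ^ 3))) * indicator {0..} t \<partial>lborel)"

lemma exp_cube_int_nn: "a \<ge> 0 \<Longrightarrow> ennreal (exp_cube_int a) = (\<integral>\<^sup>+t. ennreal (exp (- (t ^ 3))) * indicator {0..a} t \<partial>lborel)"
proof -
  assume a: "a \<ge> 0"
  have "(\<lambda>t. exp (- (t ^ 3))) integrable_on {0..a}" for a :: real
    by (intro integrable_continuous_interval continuous_intros)
  then have "((\<lambda>t. exp (- (t ^ 3))) has_integral exp_cube_int a) {0..a}"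
    unfolding exp_cube_int_def by (rule integrable_integral)
  from nn_integral_has_integral_lebesgue[OF _ this]
  have "(\<integral>\<^sup>+t. ennreal (indicator {0..a} t * exp (- (t ^ 3))) \<partial>lborel) = ennreal (exp_cube_int a)"
    by (simp add: nn_integral_completion)
  also have "(\<integral>\<^sup>+t. ennreal (indicator {0..a} t * exp (- (t ^ 3))) \<partial>lborel) = (\<integral>\<^sup>+t. ennreal (exp (- (t ^ 3))) * indicator {0..a} t \<partial>lborel)"
    by (intro nn_integral_cong) (auto split: split_indicator)
  finally show ?thesis by simp
qed

lemma exp_cube_total_nn: "(\<integral>\<^sup>+t. ennreal (exp (- (t ^ 3))) * indicator {0..} t \<partial>lborel) = ennreal exp_cube_total"
proof -
  have "(\<integral>\<^sup>+t. ennreal (exp (- (t ^ 3))) * indicator {0..} t \<partial>lborel)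
    \<le> (\<integral>\<^sup>+t. indicator {0..1} t + ennreal (exp (- (1 * t))) * indicator {0<..} (t::real) \<partial>lborel)"
  proof (rule nn_integral_mono)
    fix t :: real
    have "t \<le> t ^ 3" if "t \<ge> 1" using that power_increasing[of 1 3 t] by simp
    moreover have "exp (- (t ^ 3)) \<le> 1" if "t \<ge> 0" using that by simp
    ultimately show "ennreal (exp (- (t ^ 3))) * indicator {0..} t \<le> indicator {0..1} t + ennreal (exp (- (1 * t))) * indicator {0<..} t"
      by (cases "t \<le> 1") (auto split: split_indicator intro: add_increasing2)
  qed
  also have "\<dots> = 1 + ennreal (exp (- (1 * 0)) / 1)"
    by (subst nn_integral_add) (auto simp: nn_integral_exp_Ioi[of 1, simplified])
  also have "\<dots> < \<top>" by simp
  finally show ?thesis unfolding exp_cube_total_def by simp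
qed

lemma exp_cube_total_pos: "exp_cube_total > 0"
proof -
  have "0 < exp_cube_int 1"
  proof -
    have "integral {0..1} (\<lambda>_::real. exp (- 1) :: real) \<le> integral {0..1} (\<lambda>t. exp (- (t ^ 3)))"
      by (rule integral_le) (auto intro!: integrable_continuous_interval continuous_intros power_le_one)
    then have "exp (- 1) \<le> exp_cube_int 1" by (simp add: exp_cube_int_def)
    then show ?thesis using exp_gt_zero[of "-1::real"] by linarith
  qed
  moreover have "ennreal (exp_cube_int 1) \<le> ennreal exp_cube_total"
    unfolding exp_cube_total_nn[symmetric] by (subst exp_cube_int_nn) (auto intro!: nn_integral_mono split: split_indicator)
  ultimately have "0 < ennreal exp_cube_total" using less_le_trans[of 0 "ennreal (exp_cube_int 1)" "ennreal exp_cube_total"] by simp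
  then show ?thesis by simp
qed

lemma exp_cube_int_nonneg: "exp_cube_int a \<ge> 0"
  unfolding exp_cube_int_def by (rule integral_nonneg) (auto intro!: integrable_continuous_interval continuous_intros)

lemma exp_cube_int_le: "a \<ge> 0 \<Longrightarrow> exp_cube_int a \<le> exp_cube_total"
proof -
  assume "a \<ge> 0"
  then have "ennreal (exp_cube_int a) \<le> ennreal exp_cube_total"
    unfolding exp_cube_total_nn[symmetric] by (subst exp_cube_int_nn) (auto intro!: nn_integral_mono split: split_indicator)
  then show ?thesis using exp_cube_total_pos by (subst (asm) ennreal_le_iff) auto
qed

lemma exp_cube_int_tail:
  assumes a: "a \<ge> 0"
  shows "(\<integral>\<^sup>+t. ennreal (exp (- (t ^ 3))) * indicator {a<..} t \<partial>lborel) = ennreal (exp_cube_total - exp_cube_int a)"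
proof -
  have "ennreal exp_cube_total = (\<integral>\<^sup>+t. ennreal (exp (- (t ^ 3))) * indicator {0..a} t + ennreal (exp (- (t ^ 3))) * indicator {a<..} t \<partial>lborel)"
    unfolding exp_cube_total_nn[symmetric] using a by (intro nn_integral_cong) (auto split: split_indicator)
  also have "\<dots> = ennreal (exp_cube_int a) + (\<integral>\<^sup>+t. ennreal (exp (- (t ^ 3))) * indicator {a<..} t \<partial>lborel)"
    using a by (subst nn_integral_add) (auto simp: exp_cube_int_nn)
  finally have "ennreal exp_cube_total - ennreal (exp_cube_int a) = (\<integral>\<^sup>+t. ennreal (exp (- (t ^ 3))) * indicator {a<..} t \<partial>lborel)"
    by simp
  then show ?thesis by (simp add: ennreal_minus exp_cube_int_nonneg)
qed

lemma exp_cube_int_at_top: "(exp_cube_int \<longlongrightarrow> exp_cube_total) at_top"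
proof -
  have "((\<lambda>a. exp_cube_total - exp_cube_int a) \<longlongrightarrow> 0) at_top"
  proof (rule Lim_null_comparison)
    show "((\<lambda>a. exp (- a)) \<longlongrightarrow> (0::real)) at_top" by real_asymp
    show "\<forall>\<^sub>F a in at_top. norm (exp_cube_total - exp_cube_int a) \<le> exp (- a)"
      using eventually_ge_at_top[of 1]
    proof eventually_elim
      case (elim a)
      have "ennreal (exp_cube_total - exp_cube_int a) \<le> (\<integral>\<^sup>+t. ennreal (exp (- (1 * t))) * indicator {a<..} t \<partial>lborel)"
        using elim unfolding exp_cube_int_tail[of a, symmetric, OF order_trans[OF zero_le_one elim]]
      proof (intro nn_integral_mono)
        fix t :: real
        have "t \<le> t ^ 3" if "t > a" using that elim power_increasing[of 1 3 t] by simp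
        then show "ennreal (exp (- (t ^ 3))) * indicator {a<..} t \<le> ennreal (exp (- (1 * t))) * indicator {a<..} t"
          by (auto split: split_indicator intro!: ennreal_leI)
      qed
      also have "\<dots> = ennreal (exp (- a))" by (subst nn_integral_exp_Ioi) auto
      finally show ?case using exp_cube_int_le[of a] elim by simp
    qed
  qed
  from tendsto_diff[OF tendsto_const[of exp_cube_total] this] show ?thesis by simp
qed

text \<open>In the right half-plane this is exp (v^3) / \<open>exp_cube_total\<close> times the
  integral of exp (- (w^3)) from v to infinity. Writing it with the primitive makes it visibly
  entire.\<close>

definition hit_entire :: "complex \<Rightarrow> complex" where
  "hit_entire v = exp (v ^ 3) * (1 - exp_cube_prim v / of_real exp_cube_total)"

lemma hit_entire_holomorphic: "hit_entire holomorphic_on S"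
proof -
  have "exp_cube_prim holomorphic_on S"
    unfolding holomorphic_on_def field_differentiable_def
    using has_field_derivative_at_within[OF exp_cube_prim(2)] by blast
  then show ?thesis unfolding hit_entire_def [abs_def] using exp_cube_total_pos
    by (intro holomorphic_on_mult holomorphic_on_diff holomorphic_on_divide holomorphic_on_const
        holomorphic_on_exp holomorphic_on_power holomorphic_on_ident holomorphic_on_compose[of _ _ exp, unfolded o_def]) auto
qed

lemma Re_cube: "Re (z ^ 3) = Re z ^ 3 - 3 * Re z * (Im z)\<^sup>2"
  by (simp add: power3_eq_cube power2_eq_square algebra_simps)

text \<open>On the real axis this is the definition of the total integral. The vertical segment from
  the real point with the same real part contributes an amount of order exp (3 x y^2 - x^3), where x
  tends to infinity and y stays fixed.\<close>

lemma exp_cube_prim_shift_tendsto: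
  assumes "Re v \<ge> 0"
  shows "((\<lambda>l. exp_cube_prim (v + of_real l)) \<longlongrightarrow> of_real exp_cube_total) at_top"
proof -
  let ?x = "Re v" and ?y = "Im v"
  have 1: "((\<lambda>l. exp_cube_prim (of_real (?x + l))) \<longlongrightarrow> of_real exp_cube_total) at_top"
  proof -
    have "((\<lambda>l. of_real (exp_cube_int (?x + l)) :: complex) \<longlongrightarrow> of_real exp_cube_total) at_top"
      by (intro tendsto_of_real filterlim_compose[OF exp_cube_int_at_top] filterlim_tendsto_add_at_top[OF tendsto_const] filterlim_ident)
    then show ?thesis
    proof (rule Lim_transform_eventually)
      show "\<forall>\<^sub>F l in at_top. of_real (exp_cube_int (?x + l)) = exp_cube_prim (of_real (?x + l))"
        using eventually_ge_at_top[of 0]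
      proof eventually_elim
        case (elim l)
        then show ?case using assms by (intro exp_cube_prim_of_real[symmetric]) simp
      qed
    qed
  qed
  have 2: "((\<lambda>l. exp_cube_prim (v + of_real l) - exp_cube_prim (of_real (?x + l))) \<longlongrightarrow> 0) at_top"
  proof (rule Lim_null_comparison)
    show "((\<lambda>l. exp (3 * (?x + l) * ?y\<^sup>2 - (?x + l) ^ 3) * \<bar>?y\<bar>) \<longlongrightarrow> 0) at_top"
    proof (rule tendsto_mult_left_zero)
      have "((\<lambda>l. exp (3 * l * c - l ^ 3)) \<longlongrightarrow> 0) at_top" for c :: real by real_asymp
      then show "((\<lambda>l. exp (3 * (?x + l) * ?y\<^sup>2 - (?x + l) ^ 3)) \<longlongrightarrow> 0) at_top"
        by (rule filterlim_compose) (intro filterlim_tendsto_add_at_top[OF tendsto_const] filterlim_ident)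
    qed
    show "\<forall>\<^sub>F l in at_top. norm (exp_cube_prim (v + of_real l) - exp_cube_prim (of_real (?x + l)))
        \<le> exp (3 * (?x + l) * ?y\<^sup>2 - (?x + l) ^ 3) * \<bar>?y\<bar>"
      using eventually_ge_at_top[of 0]
    proof eventually_elim
      case (elim l)
      have "norm (exp_cube_prim (v + of_real l) - exp_cube_prim (of_real (?x + l)))
        \<le> exp (3 * (?x + l) * ?y\<^sup>2 - (?x + l) ^ 3) * norm (v + of_real l - of_real (?x + l))"
      proof (rule has_contour_integral_bound_linepath[OF exp_cube_prim_linepath])
        fix z assume "z \<in> closed_segment (of_real (?x + l)) (v + of_real l)"
        then obtain t where t: "0 \<le> t" "t \<le> 1" "z = (1 - t) *\<^sub>R of_real (?x + l) + t *\<^sub>R (v + of_real l)"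
          unfolding closed_segment_def by auto
        have z: "Re z = ?x + l" "Im z = t * ?y" unfolding t(3) by (simp_all add: algebra_simps)
        have "(t * ?y)\<^sup>2 \<le> ?y\<^sup>2" using t by (simp add: power_mult_distrib mult_left_le_one_le power_le_one)
        then have "(?x + l) * (t * ?y)\<^sup>2 \<le> (?x + l) * ?y\<^sup>2" using elim assms by (intro mult_left_mono) auto
        then show "norm (exp (- (z ^ 3))) \<le> exp (3 * (?x + l) * ?y\<^sup>2 - (?x + l) ^ 3)"
          unfolding norm_exp_eq_Re by (simp only: uminus_complex.sel Re_cube z exp_le_cancel_iff)
      qed simp
      moreover have "v + of_real l - of_real (?x + l) = \<i> * of_real ?y" by (simp add: complex_eq_iff)
      ultimately show ?case by (simp only: norm_mult norm_ii norm_of_real real_norm_def mult_1_left)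
    qed
  qed
  from tendsto_add[OF 2 1] show ?thesis by simp
qed

lemma exp_cube_int_scaled: "l \<ge> 0 \<Longrightarrow> ((\<lambda>t. exp (- ((t * l) ^ 3)) * l) has_integral exp_cube_int l) {0..1}"
proof -
  assume l: "l \<ge> 0"
  have "exp (- ((0 + of_real t * of_real l) ^ 3)) * of_real l = (of_real (exp (- ((t * l) ^ 3)) * l) :: complex)" for t
    by (simp only: of_real_mult exp_of_real[symmetric] of_real_minus of_real_power add_0_left)
  moreover have "exp_cube_prim (0 + of_real l) - exp_cube_prim 0 = of_real (exp_cube_int l)"
    using l by (simp add: exp_cube_prim exp_cube_prim_of_real)
  ultimately have "((\<lambda>t. of_real (exp (- ((t * l) ^ 3)) * l) :: complex) has_integral of_real (exp_cube_int l)) {0..1}"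
    using exp_cube_prim_integral[of 0 "of_real l"] by (simp only:)
  from has_integral_linear[OF this bounded_linear_Re] show ?thesis by (simp only: o_def Re_complex_of_real)
qed

text \<open>The tail integral is taken along the horizontal ray v + s. In this sector Re (v^3 - (v +
  s)^3) is at most - (s^3), so the integrand is dominated by the one for v = 0, whose integral is
  \<open>exp_cube_total\<close>.\<close>

lemma hit_entire_bound_quarter:
  assumes "Re v \<ge> 0" "\<bar>Im v\<bar> \<le> Re v"
  shows "norm (hit_entire v) \<le> 1"
proof -
  have "norm (exp (v ^ 3) * (of_real exp_cube_total - exp_cube_prim v)) \<le> exp_cube_total"
  proof (rule tendsto_upperbound[where F = at_top])
    show "((\<lambda>l. norm (exp (v ^ 3) * (exp_cube_prim (v + of_real l) - exp_cube_prim v))) \<longlongrightarrow> norm (exp (v ^ 3) * (of_real exp_cube_total - exp_cube_prim v))) at_top"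
      by (intro tendsto_intros exp_cube_prim_shift_tendsto assms)
    show "\<forall>\<^sub>F l in at_top. norm (exp (v ^ 3) * (exp_cube_prim (v + of_real l) - exp_cube_prim v)) \<le> exp_cube_total"
      using eventually_ge_at_top[of 0]
    proof eventually_elim
      case (elim l)
      have 1: "((\<lambda>t. exp (v ^ 3) * (exp (- ((v + of_real t * of_real l) ^ 3)) * of_real l)) has_integral (exp (v ^ 3) * (exp_cube_prim (v + of_real l) - exp_cube_prim v))) {0..1}"
        by (intro has_integral_mult_right exp_cube_prim_integral)
      have "norm (exp (v ^ 3) * (exp_cube_prim (v + of_real l) - exp_cube_prim v)) \<le> exp_cube_int l"
        unfolding integral_unique[OF 1, symmetric] integral_unique[OF exp_cube_int_scaled[OF elim], symmetric]
      proof (rule integral_norm_bound_integral)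
        show "(\<lambda>t. exp (v ^ 3) * (exp (- ((v + of_real t * of_real l) ^ 3)) * of_real l)) integrable_on {0..1}"
          using 1 by (rule has_integral_integrable)
        show "(\<lambda>t. exp (- ((t * l) ^ 3)) * l) integrable_on {0..1}"
          using exp_cube_int_scaled[OF elim] by (rule has_integral_integrable)
        fix t :: real assume t: "t \<in> {0..1}"
        define s where "s = t * l"
        have s: "s \<ge> 0" using t elim by (simp add: s_def)
        have "Re (v ^ 3 - (v + of_real s) ^ 3) = - (s ^ 3) - 3 * s\<^sup>2 * Re v - 3 * s * ((Re v)\<^sup>2 - (Im v)\<^sup>2)"
          unfolding minus_complex.sel Re_cube by (simp add: power3_eq_cube power2_eq_square algebra_simps)
        also have "\<dots> \<le> - (s ^ 3)"
        proof -
          have "(Im v)\<^sup>2 \<le> (Re v)\<^sup>2" using assms by (subst abs_le_square_iff[symmetric]) auto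
          then have "0 \<le> 3 * s * ((Re v)\<^sup>2 - (Im v)\<^sup>2)" "0 \<le> 3 * s\<^sup>2 * Re v"
            using s assms by (intro mult_nonneg_nonneg; simp)+
          then show ?thesis by linarith
        qed
        finally have "norm (exp (v ^ 3 - (v + of_real s) ^ 3)) \<le> exp (- (s ^ 3))"
          by (simp only: norm_exp_eq_Re exp_le_cancel_iff)
        then have "norm (exp (v ^ 3 - (v + of_real s) ^ 3)) * l \<le> exp (- (s ^ 3)) * l"
          using elim by (rule mult_right_mono)
        moreover have e: "exp (v ^ 3) * (exp (- ((v + of_real t * of_real l) ^ 3)) * of_real l) = exp (v ^ 3 - (v + of_real s) ^ 3) * of_real l"
          unfolding s_def of_real_mult[symmetric] diff_conv_add_uminus exp_add by (simp only: mult.assoc)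
        ultimately show "norm (exp (v ^ 3) * (exp (- ((v + of_real t * of_real l) ^ 3)) * of_real l)) \<le> exp (- ((t * l) ^ 3)) * l"
          unfolding e norm_mult s_def[symmetric] norm_of_real using elim by (simp only: abs_of_nonneg)
      qed
      then show ?case using exp_cube_int_le[OF elim] by simp
    qed
  qed simp
  moreover have "hit_entire v = exp (v ^ 3) * (of_real exp_cube_total - exp_cube_prim v) / of_real exp_cube_total"
    unfolding hit_entire_def using exp_cube_total_pos by (simp add: field_simps)
  ultimately show ?thesis using exp_cube_total_pos by (simp add: norm_divide)
qed

text \<open>Here exp (v^3) is bounded by 1, and on the segment from 0 to v the modulus of exp (v^3 -
  (t v)^3) is at most 1 as well. The length of the segment gives the linear term.\<close>

lemma hit_entire_bound_lateral:
  assumes "Re (v ^ 3) \<le> 0"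
  shows "norm (hit_entire v) \<le> 1 + norm v / exp_cube_total"
proof -
  have bd: "norm (exp (v ^ 3) * (exp (- ((0 + of_real t * v) ^ 3)) * v)) \<le> norm v" if t: "t \<in> {0..1} - {}" for t :: real
  proof -
    have "Re (v ^ 3 - (of_real t * v) ^ 3) = (1 - t ^ 3) * Re (v ^ 3)"
      by (simp add: power_mult_distrib algebra_simps flip: of_real_power)
    also have "\<dots> \<le> 0" using t assms by (intro mult_nonneg_nonpos) (auto intro: power_le_one)
    finally have "norm (exp (v ^ 3 - (of_real t * v) ^ 3)) \<le> 1" by (simp only: norm_exp_eq_Re exp_le_one_iff)
    then have "norm (exp (v ^ 3 - (of_real t * v) ^ 3)) * norm v \<le> 1 * norm v" by (rule mult_right_mono) simp
    moreover have e: "exp (v ^ 3) * (exp (- ((0 + of_real t * v) ^ 3)) * v) = exp (v ^ 3 - (of_real t * v) ^ 3) * v"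
      by (simp add: exp_diff exp_minus field_simps)
    ultimately show ?thesis unfolding e norm_mult by (simp only: mult_1_left)
  qed
  have "((\<lambda>t. exp (v ^ 3) * (exp (- ((0 + of_real t * v) ^ 3)) * v)) has_integral (exp (v ^ 3) * (exp_cube_prim (0 + v) - exp_cube_prim 0))) {0..1}"
    by (intro has_integral_mult_right exp_cube_prim_integral)
  from has_integral_bound_real[OF norm_ge_zero finite.emptyI this bd]
  have "norm (exp (v ^ 3) * (exp_cube_prim (0 + v) - exp_cube_prim 0)) \<le> norm v" by simp
  then have *: "norm (exp (v ^ 3) * exp_cube_prim v) \<le> norm v" by (simp add: exp_cube_prim)
  have "hit_entire v = exp (v ^ 3) - exp (v ^ 3) * exp_cube_prim v / of_real exp_cube_total"
    by (simp add: hit_entire_def algebra_simps)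
  then have "norm (hit_entire v) \<le> norm (exp (v ^ 3)) + norm (exp (v ^ 3) * exp_cube_prim v / of_real exp_cube_total)"
    by (simp only: norm_triangle_ineq4)
  also have "\<dots> \<le> 1 + norm v / exp_cube_total"
    unfolding norm_divide norm_of_real using * assms exp_cube_total_pos
    by (intro add_mono) (auto simp only: norm_exp_eq_Re exp_le_one_iff real_norm_def abs_of_pos divide_right_mono less_imp_le)
  finally show ?thesis .
qed

text \<open>The two regions cover the half-plane with an overlap: the real part of v^3 is
  nonpositive from the angle pi / 6 on, while the sector of \<open>hit_entire_bound_quarter\<close>
  reaches up to pi / 4.\<close>

lemma hit_entire_bound:
  assumes "Re v \<ge> 0"
  shows "norm (hit_entire v) \<le> 1 + norm v / exp_cube_total"
proof (cases "\<bar>Im v\<bar> \<le> Re v")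
  case True
  have "norm (hit_entire v) \<le> 1" by (rule hit_entire_bound_quarter) fact+
  also have "\<dots> \<le> 1 + norm v / exp_cube_total" using exp_cube_total_pos by simp
  finally show ?thesis .
next
  case False
  have "(Re v)\<^sup>2 \<le> (Im v)\<^sup>2" using False assms by (subst abs_le_square_iff[symmetric]) auto
  then have "(Re v)\<^sup>2 \<le> 3 * (Im v)\<^sup>2" using zero_le_power2[of "Im v"] by linarith
  then have "Re v * (Re v)\<^sup>2 \<le> Re v * (3 * (Im v)\<^sup>2)" using assms by (intro mult_left_mono) auto
  then have "Re (v ^ 3) \<le> 0" unfolding Re_cube by (simp add: power3_eq_cube power2_eq_square)
  then show ?thesis by (rule hit_entire_bound_lateral)
qed

section \<open>Values on the imaginary axis and Cauchy's formula\<close>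

text \<open>Minus the imaginary part of \<open>hit_entire\<close> at i r, by
  \<open>Im_hit_entire\<close>. For r > 0 it is the bracket of the claimed density at t = r^2: the
  integral is the hypergeometric factor and \<open>exp_cube_total\<close> is Gamma (4 / 3).\<close>

definition hit_im :: "real \<Rightarrow> real" where
  "hit_im r = sin (r ^ 3) + r / exp_cube_total * integral {0..1} (\<lambda>t. cos (r ^ 3 * (1 - t ^ 3)))"

lemma imaginary_cube: "(\<i> * of_real r) ^ 3 = - (\<i> * of_real (r ^ 3))"
  by (simp add: power_mult_distrib power3_eq_cube[of \<i>])

lemma Im_hit_entire: "Im (hit_entire (\<i> * of_real r)) = - hit_im r"
proof -
  let ?r = "\<i> * of_real r"
  have e: "exp (?r ^ 3) = cis (- (r ^ 3))"
    unfolding imaginary_cube cis_conv_exp by simp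
  have "((\<lambda>t. exp (?r ^ 3) * (exp (- ((0 + of_real t * ?r) ^ 3)) * ?r))
      has_integral (exp (?r ^ 3) * (exp_cube_prim (0 + \<i> * of_real r) - exp_cube_prim 0))) {0..1}"
    by (intro has_integral_mult_right exp_cube_prim_integral)
  moreover have "exp (?r ^ 3) * (exp (- ((0 + of_real t * ?r) ^ 3)) * ?r)
     = cis (- (r ^ 3 * (1 - t ^ 3))) * ?r" for t
  proof -
    have "0 + of_real t * ?r = \<i> * of_real (t * r)" by simp
    then have "exp (- ((0 + of_real t * ?r) ^ 3)) = cis ((t * r) ^ 3)"
      unfolding cis_conv_exp by (simp only: imaginary_cube minus_minus)
    moreover have "- (r ^ 3) + (t * r) ^ 3 = - (r ^ 3 * (1 - t ^ 3))"
      by (simp add: power_mult_distrib algebra_simps)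
    ultimately show ?thesis unfolding e by (simp only: mult.assoc[symmetric] cis_mult)
  qed
  ultimately have "((\<lambda>t. cis (- (r ^ 3 * (1 - t ^ 3))) * ?r) has_integral
      (exp (?r ^ 3) * exp_cube_prim ?r)) {0..1}"
    by (simp only: exp_cube_prim(1) add_0_left diff_zero)
  from has_integral_linear[OF this bounded_linear_Im]
  have "((\<lambda>t. cos (r ^ 3 * (1 - t ^ 3)) * r) has_integral Im (exp (?r ^ 3) * exp_cube_prim ?r)) {0..1}"
    by (simp add: o_def)
  then have "integral {0..1} (\<lambda>t. cos (r ^ 3 * (1 - t ^ 3)) * r) = Im (exp (?r ^ 3) * exp_cube_prim ?r)"
    by (rule integral_unique)
  then have "Im (exp (?r ^ 3) * exp_cube_prim ?r) = integral {0..1} (\<lambda>t. cos (r ^ 3 * (1 - t ^ 3))) * r"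
    unfolding integral_mult_left by (rule sym)
  then have i: "Im (exp (?r ^ 3) * exp_cube_prim ?r) = r * integral {0..1} (\<lambda>t. cos (r ^ 3 * (1 - t ^ 3)))"
    by (simp only: mult.commute)
  have "hit_entire ?r = exp (?r ^ 3) - exp (?r ^ 3) * exp_cube_prim ?r / of_real exp_cube_total"
    by (simp add: hit_entire_def algebra_simps)
  then have "Im (hit_entire ?r) = Im (exp (?r ^ 3)) - Im (exp (?r ^ 3) * exp_cube_prim ?r) / exp_cube_total"
    by (simp only: minus_complex.sel Im_divide_of_real)
  then show ?thesis unfolding i by (simp add: e hit_im_def)
qed

lemma hit_im_odd: "hit_im (- r) = - hit_im r"
  by (simp add: hit_im_def)

lemma hit_im_bound: "\<bar>hit_im r\<bar> \<le> 1 + \<bar>r\<bar> / exp_cube_total"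
proof -
  have "\<bar>hit_im r\<bar> \<le> norm (hit_entire (\<i> * of_real r))"
    using abs_Im_le_cmod[of "hit_entire (\<i> * of_real r)"] by (simp add: Im_hit_entire)
  also have "\<dots> \<le> 1 + norm (\<i> * of_real r) / exp_cube_total" by (rule hit_entire_bound) simp
  finally show ?thesis by (simp add: norm_mult)
qed

lemma hit_im_continuous: "continuous_on S hit_im"
proof -
  have "continuous_on UNIV hit_entire" by (rule holomorphic_on_imp_continuous_on[OF hit_entire_holomorphic])
  then have "continuous_on S (\<lambda>r. hit_entire (\<i> * of_real r))"
    by (rule continuous_on_compose2) (auto intro!: continuous_intros)
  then have "continuous_on S (\<lambda>r. - Im (hit_entire (\<i> * of_real r)))"
    by (intro continuous_on_minus continuous_on_Im)
  then show ?thesis by (simp add: Im_hit_entire)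
qed

lemma hit_im_measurable [measurable]: "hit_im \<in> borel_measurable borel"
  by (rule borel_measurable_continuous_onI[OF hit_im_continuous])

definition hit_laplace :: "real \<Rightarrow> real" where "hit_laplace a = exp (a ^ 3) * (1 - exp_cube_int a / exp_cube_total)"

lemma hit_entire_of_real: "a \<ge> 0 \<Longrightarrow> hit_entire (of_real a) = of_real (hit_laplace a)"
  by (simp add: hit_entire_def hit_laplace_def exp_cube_prim_of_real exp_of_real[symmetric])

text \<open>The difference of the kernels at \<open>u\<close> and \<open>u + 1\<close> decays fast enough to compensate the linear growth
  of \<open>hit_entire\<close>; a single kernel does not.\<close>

definition diff_kernel :: "real \<Rightarrow> real \<Rightarrow> real" where
  "diff_kernel u r = 1 / (r\<^sup>2 + u) - 1 / (r\<^sup>2 + u + 1)"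

lemma diff_kernel_eq: "u > 0 \<Longrightarrow> diff_kernel u r = 1 / ((r\<^sup>2 + u) * (r\<^sup>2 + u + 1))"
proof -
  assume u: "u > 0"
  have "1 / a - 1 / (a + 1) = 1 / (a * (a + 1))" if "a > 0" for a :: real
    using that by (simp add: field_simps)
  from this[of "r\<^sup>2 + u"] u show ?thesis unfolding diff_kernel_def by (simp add: add_nonneg_pos)
qed

lemma diff_kernel_nonneg: "u > 0 \<Longrightarrow> diff_kernel u r \<ge> 0"
  by (simp add: diff_kernel_eq)

lemma diff_kernel_measurable [measurable]: "diff_kernel u \<in> borel_measurable borel"
  unfolding diff_kernel_def [abs_def] by measurable

lemma integrable_inverse_quadratic: "u > 0 \<Longrightarrow> integrable lborel (\<lambda>x::real. 1 / (x\<^sup>2 + u))"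
proof -
  assume u: "u > 0"
  have "integrable lborel (\<lambda>x::real. inverse (1 + x\<^sup>2))"
    using integrable_inverse_1_plus_square by (simp add: set_integrable_def)
  then have "integrable lborel (\<lambda>x::real. max 1 (1 / u) * inverse (1 + x\<^sup>2))" by simp
  then show ?thesis
  proof (rule Bochner_Integration.integrable_bound)
    show "AE x in lborel. norm (1 / (x\<^sup>2 + u)) \<le> norm (max 1 (1 / u) * inverse (1 + x\<^sup>2))"
    proof (rule AE_I2)
      fix x :: real
      have "1 + x\<^sup>2 \<le> max 1 (1 / u) * (x\<^sup>2 + u)"
      proof -
        have "1 * x\<^sup>2 \<le> max 1 (1 / u) * x\<^sup>2" by (intro mult_right_mono) auto
        moreover have "(1 / u) * u \<le> max 1 (1 / u) * u" using u by (intro mult_right_mono) auto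
        ultimately show ?thesis using u by (simp add: distrib_left)
      qed
      moreover have "x\<^sup>2 + u > 0" "1 + x\<^sup>2 > 0" using u by (auto intro: add_nonneg_pos add_pos_nonneg)
      ultimately show "norm (1 / (x\<^sup>2 + u)) \<le> norm (max 1 (1 / u) * inverse (1 + x\<^sup>2))"
        using u by (simp add: field_simps)
    qed
  qed measurable
qed

text \<open>The factor r and the linear growth of \<open>hit_im\<close> give r^2 against the r^4 in
  the denominator of \<open>diff_kernel\<close>.\<close>

lemma kernel_hit_im_integrable:
  assumes u: "u > 0"
  shows "integrable lborel (\<lambda>r. 2 * r * diff_kernel u r * hit_im r)"
proof (rule Bochner_Integration.integrable_bound)
  let ?C = "1 + 2 / exp_cube_total"
  show "integrable lborel (\<lambda>r. ?C * (1 / (r\<^sup>2 + u)))" using integrable_inverse_quadratic[OF u] by (intro integrable_mult_right)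
  show "AE r in lborel. norm (2 * r * diff_kernel u r * hit_im r) \<le> norm (?C * (1 / (r\<^sup>2 + u)))"
  proof (rule AE_I2)
    fix r :: real
    have p: "r\<^sup>2 + u > 0" "r\<^sup>2 + u + 1 > 0" using u by (auto intro: add_nonneg_pos add_pos_pos)
    have "2 * \<bar>r\<bar> * \<bar>hit_im r\<bar> \<le> 2 * \<bar>r\<bar> * (1 + \<bar>r\<bar> / exp_cube_total)"
      using hit_im_bound by (intro mult_left_mono) auto
    also have "\<dots> = 2 * \<bar>r\<bar> + 2 / exp_cube_total * r\<^sup>2"
      by (simp add: algebra_simps power2_eq_square)
    also have "\<dots> \<le> (r\<^sup>2 + u + 1) + 2 / exp_cube_total * (r\<^sup>2 + u + 1)"
    proof (intro add_mono mult_left_mono)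
      have "0 \<le> (\<bar>r\<bar> - 1)\<^sup>2" by simp
      then show "2 * \<bar>r\<bar> \<le> r\<^sup>2 + u + 1" using u by (simp add: power2_eq_square algebra_simps)
    qed (use u exp_cube_total_pos in auto)
    also have "\<dots> = ?C * (r\<^sup>2 + u + 1)" by (simp add: distrib_right)
    finally have "2 * \<bar>r\<bar> * \<bar>hit_im r\<bar> / ((r\<^sup>2 + u) * (r\<^sup>2 + u + 1)) \<le> ?C * (r\<^sup>2 + u + 1) / ((r\<^sup>2 + u) * (r\<^sup>2 + u + 1))"
      using p by (intro divide_right_mono) auto
    also have "\<dots> = ?C / (r\<^sup>2 + u)" using p by simp
    finally show "norm (2 * r * diff_kernel u r * hit_im r) \<le> norm (?C * (1 / (r\<^sup>2 + u)))"
      using p exp_cube_total_pos unfolding diff_kernel_eq[OF u] by (simp add: abs_mult)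
  qed
qed measurable

lemma kernel_partial_fractions:
  fixes w a b :: complex
  assumes "w\<^sup>2 - a\<^sup>2 \<noteq> 0" "w\<^sup>2 - b\<^sup>2 \<noteq> 0"
  shows "1 / (w - a) + 1 / (w + a) - (1 / (w - b) + 1 / (w + b)) = 2 * w * (a\<^sup>2 - b\<^sup>2) / ((w\<^sup>2 - a\<^sup>2) * (w\<^sup>2 - b\<^sup>2))"
proof -
  have *: "1 / (w - c) + 1 / (w + c) = 2 * w / (w\<^sup>2 - c\<^sup>2)" if "w\<^sup>2 - c\<^sup>2 \<noteq> 0" for c
  proof -
    have f: "w\<^sup>2 - c\<^sup>2 = (w - c) * (w + c)" by (simp add: power2_eq_square algebra_simps)
    then have "w - c \<noteq> 0" "w + c \<noteq> 0" using that by auto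
    then have "1 / (w - c) + 1 / (w + c) = ((w + c) + (w - c)) / ((w - c) * (w + c))"
      by (subst add_frac_eq) auto
    then show ?thesis unfolding f by simp
  qed
  have "2 * w / A - 2 * w / B = 2 * w * (B - A) / (A * B)" if "A \<noteq> 0" "B \<noteq> 0" for A B :: complex
    using that by (simp add: divide_simps) (simp add: algebra_simps)
  from this[OF assms] show ?thesis unfolding *[OF assms(1)] *[OF assms(2)] by simp
qed

text \<open>Cauchy's formula on the boundary of the rectangle with real part in [0, R] and imaginary
  part in [-R, R]. The left side yields the integral; the other three sides, of total length 4 R,
  yield the error. The condition on R keeps both poles inside and away from these sides.\<close>

lemma kernel_identity_truncated:
  assumes u: "u > 0" and R: "R > 0" "R\<^sup>2 \<ge> 2 * (u + 1)"
  shows "\<bar>2 * pi * (hit_laplace (sqrt u) - hit_laplace (sqrt (u + 1))) - integral {-R..R} (\<lambda>r. 2 * r * diff_kernel u r * hit_im r)\<bar>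
     \<le> (1 + 2 * R / exp_cube_total) * (64 / R\<^sup>2)"
proof -
  define a b where "a = sqrt u" and "b = sqrt (u + 1)"
  have ab: "0 < a" "0 < b" "a\<^sup>2 = u" "b\<^sup>2 = u + 1" using u by (auto simp: a_def b_def)
  have "b\<^sup>2 < R\<^sup>2" using R u ab by simp
  then have bR: "b < R" using R by (simp add: power_less_imp_less_base)
  have "a\<^sup>2 < R\<^sup>2" using R u ab by simp
  then have aR: "a < R" using R by (simp add: power_less_imp_less_base)
  define a1 a2 a3 a4 where "a1 = Complex 0 (-R)" "a2 = Complex R (-R)" "a3 = Complex R R" "a4 = Complex 0 R"
  define \<gamma> where "\<gamma> = rectpath a1 a3"
  have \<gamma>: "\<gamma> = linepath a1 a2 +++ linepath a2 a3 +++ linepath a3 a4 +++ linepath a4 a1"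
    unfolding \<gamma>_def rectpath_def by (simp add: a1_a2_a3_a4_def Let_def)
  \<comment> \<open>The reflected poles - a and - b lie outside the contour and add no residue. They
    make the kernel odd in w, so that on the imaginary axis, together with dw = i dx, it becomes
    real; the imaginary part of the identity then involves \<open>hit_im\<close> alone.\<close>
  define q where "q w = hit_entire w * (1 / (w - of_real a) + 1 / (w + of_real a) - (1 / (w - of_real b) + 1 / (w + of_real b)))" for w
  have pim: "path_image \<gamma> = {z. Re z \<in> {0, R} \<and> Im z \<in> {-R..R}} \<union> {z. Im z \<in> {-R, R} \<and> Re z \<in> {0..R}}"
    unfolding \<gamma>_def by (subst path_image_rectpath) (use R in \<open>auto simp: a1_a2_a3_a4_def\<close>)
  have cf: "((\<lambda>w. hit_entire w / (w - of_real c)) has_contour_integral (2 * pi * \<i> * hit_entire (of_real c))) \<gamma>"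
    if "0 < c" "c < R" for c
  proof -
    have "winding_number \<gamma> (of_real c) = 1" unfolding \<gamma>_def
      by (rule winding_number_rectpath) (use that in \<open>auto simp: in_box_complex_iff a1_a2_a3_a4_def\<close>)
    moreover have "((\<lambda>w. hit_entire w / (w - of_real c)) has_contour_integral (2 * pi * \<i> * winding_number \<gamma> (of_real c) * hit_entire (of_real c))) \<gamma>"
      by (rule Cauchy_integral_formula_convex_simple[of UNIV]) (use that in \<open>auto simp: hit_entire_holomorphic pim, auto simp: \<gamma>_def\<close>)
    ultimately show ?thesis by simp
  qed
  have cf': "((\<lambda>w. hit_entire w / (w + of_real c)) has_contour_integral 0) \<gamma>"
    if "0 < c" for c
  proof -
    have "winding_number \<gamma> (of_real (- c)) = 0" unfolding \<gamma>_def
      by (rule winding_number_rectpath_outside) (use that R in \<open>auto simp: in_cbox_complex_iff a1_a2_a3_a4_def\<close>)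
    moreover have "((\<lambda>w. hit_entire w / (w - of_real (- c))) has_contour_integral (2 * pi * \<i> * winding_number \<gamma> (of_real (- c)) * hit_entire (of_real (- c)))) \<gamma>"
      by (rule Cauchy_integral_formula_convex_simple[of UNIV]) (use that R in \<open>auto simp: hit_entire_holomorphic pim, auto simp: \<gamma>_def\<close>)
    ultimately show ?thesis by simp
  qed
  have raw: "((\<lambda>w. hit_entire w / (w - of_real a) + hit_entire w / (w + of_real a) - (hit_entire w / (w - of_real b) + hit_entire w / (w + of_real b)))
      has_contour_integral (2 * pi * \<i> * hit_entire (of_real a) + 0 - (2 * pi * \<i> * hit_entire (of_real b) + 0))) \<gamma>"
    using ab aR bR by (intro has_contour_integral_diff has_contour_integral_add cf cf') auto
  have q_int: "(q has_contour_integral (2 * pi * \<i> * (hit_entire (of_real a) - hit_entire (of_real b)))) \<gamma>"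
  proof -
    have alg: "h / x + h / y - (h / s + h / t) = h * (1 / x + 1 / y - (1 / s + 1 / t))" for h x y s t :: complex
      by (simp add: divide_inverse distrib_left right_diff_distrib)
    have e: "(\<lambda>w. hit_entire w / (w - of_real a) + hit_entire w / (w + of_real a) - (hit_entire w / (w - of_real b) + hit_entire w / (w + of_real b))) = q"
      unfolding q_def [abs_def] by (rule ext) (rule alg)
    show ?thesis using raw unfolding e by (simp only: right_diff_distrib add_0_right)
  qed
  have nz: "w\<^sup>2 - (of_real a)\<^sup>2 \<noteq> 0" "w\<^sup>2 - (of_real b)\<^sup>2 \<noteq> 0" if "w \<in> path_image \<gamma>" for w
  proof -
    have *: "w\<^sup>2 - (of_real c)\<^sup>2 \<noteq> 0" if c: "0 < c" "c < R" for c
    proof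
      assume "w\<^sup>2 - (of_real c)\<^sup>2 = 0"
      then have "w = of_real c \<or> w = - of_real c" by (simp add: power2_eq_iff)
      then show False using \<open>w \<in> path_image \<gamma>\<close> c R unfolding pim by auto
    qed
    show "w\<^sup>2 - (of_real a)\<^sup>2 \<noteq> 0" "w\<^sup>2 - (of_real b)\<^sup>2 \<noteq> 0" using *[OF ab(1) aR] *[OF ab(2) bR] by auto
  qed
  have q_eq: "q w = hit_entire w * (- (2 * w) / ((w\<^sup>2 - of_real u) * (w\<^sup>2 - of_real (u + 1))))" if "w \<in> path_image \<gamma>" for w
  proof -
    have "(of_real a)\<^sup>2 = (of_real u :: complex)" "(of_real b)\<^sup>2 = (of_real (u + 1) :: complex)"
      using ab by (simp_all only: of_real_power[symmetric])
    then show ?thesis using kernel_partial_fractions[OF nz[OF that]] unfolding q_def by simp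
  qed
  have cont: "continuous_on (path_image \<gamma>) q"
  proof -
    have "w - of_real a \<noteq> 0" "w + of_real a \<noteq> 0" "w - of_real b \<noteq> 0" "w + of_real b \<noteq> 0" if "w \<in> path_image \<gamma>" for w
      using nz[OF that] by (auto simp: add_eq_0_iff2)
    then show ?thesis unfolding q_def [abs_def]
      by (intro continuous_intros holomorphic_on_imp_continuous_on hit_entire_holomorphic) auto
  qed
  have seg: "closed_segment a1 a2 \<subseteq> path_image \<gamma>" "closed_segment a2 a3 \<subseteq> path_image \<gamma>"
    "closed_segment a3 a4 \<subseteq> path_image \<gamma>" "closed_segment a4 a1 \<subseteq> path_image \<gamma>"
    unfolding \<gamma> by (auto simp: path_image_join)
  have ci: "q contour_integrable_on linepath a1 a2" "q contour_integrable_on linepath a2 a3"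
    "q contour_integrable_on linepath a3 a4" "q contour_integrable_on linepath a4 a1"
    using seg by (auto intro!: contour_integrable_continuous_linepath intro: continuous_on_subset[OF cont])
  have sum: "contour_integral \<gamma> q = contour_integral (linepath a1 a2) q + (contour_integral (linepath a2 a3) q
      + (contour_integral (linepath a3 a4) q + contour_integral (linepath a4 a1) q))"
    unfolding \<gamma> using ci by simp
  \<comment> \<open>Away from the left side |w| is at most 2 R and |w^2 - c| at least R^2 / 2, so
    the kernel is at most 4 R / (R^4 / 4); the first factor bounds
    \<open>hit_entire\<close>.\<close>
  define B where "B = (1 + 2 * R / exp_cube_total) * (16 / R ^ 3)"
  have B0: "B \<ge> 0" using R exp_cube_total_pos by (simp add: B_def)
  have bound: "norm (q w) \<le> B" if w: "w \<in> path_image \<gamma>" "norm w \<ge> R" for w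
  proof -
    have Re: "Re w \<ge> 0" using w(1) R unfolding pim by auto
    have "\<bar>Re w\<bar> \<le> R" "\<bar>Im w\<bar> \<le> R" using w(1) R unfolding pim by auto
    then have w2: "norm w \<le> 2 * R" using cmod_le[of w] by linarith
    have R2: "R\<^sup>2 \<le> (norm w)\<^sup>2" using w(2) R by (intro power_mono) auto
    have lower: "R\<^sup>2 / 2 \<le> norm (w\<^sup>2 - of_real c)" if "0 < c" "c \<le> u + 1" for c
    proof -
      have "norm (w\<^sup>2) - norm (of_real c :: complex) \<le> norm (w\<^sup>2 - of_real c)" by (rule norm_triangle_ineq2)
      moreover have "norm (w\<^sup>2) = (norm w)\<^sup>2" by (rule norm_power)
      ultimately show ?thesis using that R2 R(2) by simp
    qed
    have "norm (- (2 * w) / ((w\<^sup>2 - of_real u) * (w\<^sup>2 - of_real (u + 1))))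
        = 2 * norm w / (norm (w\<^sup>2 - of_real u) * norm (w\<^sup>2 - of_real (u + 1)))"
      by (simp add: norm_divide norm_mult)
    also have "\<dots> \<le> 2 * (2 * R) / (R\<^sup>2 / 2 * (R\<^sup>2 / 2))"
      using R w2 u by (intro frac_le mult_mono lower mult_pos_pos) auto
    also have "\<dots> = 16 / R ^ 3" using R by (simp add: field_simps power2_eq_square power3_eq_cube)
    finally have k: "norm (- (2 * w) / ((w\<^sup>2 - of_real u) * (w\<^sup>2 - of_real (u + 1)))) \<le> 16 / R ^ 3" .
    have "norm (hit_entire w) \<le> 1 + norm w / exp_cube_total" by (rule hit_entire_bound[OF Re])
    also have "\<dots> \<le> 1 + 2 * R / exp_cube_total" using w2 exp_cube_total_pos by (simp add: divide_right_mono)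
    finally show ?thesis unfolding q_eq[OF w(1)] norm_mult B_def using k exp_cube_total_pos R by (intro mult_mono) auto
  qed
  have n: "R \<le> norm w" if "\<bar>Re w\<bar> = R \<or> \<bar>Im w\<bar> = R" for w
    using that abs_Re_le_cmod[of w] abs_Im_le_cmod[of w] by auto
  have far: "R \<le> norm w" if "w \<in> closed_segment a1 a2 \<or> w \<in> closed_segment a2 a3 \<or> w \<in> closed_segment a3 a4" for w
  proof (rule n)
    show "\<bar>Re w\<bar> = R \<or> \<bar>Im w\<bar> = R"
      using that R by (auto simp: a1_a2_a3_a4_def closed_segment_same_Im closed_segment_same_Re)
  qed
  have "a2 - a1 = of_real R" "a3 - a2 = \<i> * of_real (2 * R)" "a4 - a3 = - of_real R"
    by (simp_all add: a1_a2_a3_a4_def complex_eq_iff)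
  then have len: "norm (a2 - a1) = R" "norm (a3 - a2) = 2 * R" "norm (a4 - a3) = R"
    using R by (simp_all add: norm_mult)
  have E1: "norm (contour_integral (linepath a1 a2) q) \<le> B * R"
    using contour_integral_bound_linepath[OF ci(1) B0] bound far seg(1) unfolding len by blast
  have E2: "norm (contour_integral (linepath a2 a3) q) \<le> B * (2 * R)"
    using contour_integral_bound_linepath[OF ci(2) B0] bound far seg(2) unfolding len by blast
  have E3: "norm (contour_integral (linepath a3 a4) q) \<le> B * R"
    using contour_integral_bound_linepath[OF ci(3) B0] bound far seg(3) unfolding len by blast
  \<comment> \<open>The left side is traversed downwards, hence the minus sign.\<close>
  have E4: "contour_integral (linepath a4 a1) q = - integral {-R..R} (\<lambda>x. of_real (2 * x * diff_kernel u x) * hit_entire (\<i> * of_real x))"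
  proof -
    have "contour_integral (linepath a4 a1) q = - contour_integral (linepath a1 a4) q"
      using seg(4) by (intro contour_integral_reverse_linepath continuous_on_subset[OF cont])
    also have "contour_integral (linepath a1 a4) q = \<i> * integral {-R..R} (\<lambda>x. q (Complex 0 x))"
      by (rule contour_integral_linepath_same_Re) (use R in \<open>auto simp: a1_a2_a3_a4_def\<close>)
    also have "\<dots> = integral {-R..R} (\<lambda>x. \<i> * q (Complex 0 x))" by (rule integral_mult_right[symmetric])
    also have "\<dots> = integral {-R..R} (\<lambda>x. of_real (2 * x * diff_kernel u x) * hit_entire (\<i> * of_real x))"
    proof (rule integral_cong)
      fix x assume x: "x \<in> {-R..R}"
      have e: "Complex 0 x = \<i> * of_real x" by (simp add: complex_eq_iff)
      have "Complex 0 x \<in> path_image \<gamma>" using x unfolding pim by auto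
      from q_eq[OF this] have "\<i> * q (Complex 0 x) = \<i> * (- (2 * (\<i> * of_real x)) / (((\<i> * of_real x)\<^sup>2 - of_real u) * ((\<i> * of_real x)\<^sup>2 - of_real (u + 1)))) * hit_entire (\<i> * of_real x)"
        unfolding e by (simp only: mult_ac)
      also have "\<i> * (- (2 * (\<i> * of_real x)) / (((\<i> * of_real x)\<^sup>2 - of_real u) * ((\<i> * of_real x)\<^sup>2 - of_real (u + 1))))
         = of_real (2 * x / ((x\<^sup>2 + u) * (x\<^sup>2 + u + 1)))"
      proof -
        have "(\<i> * of_real x)\<^sup>2 - of_real u = - of_real (x\<^sup>2 + u)" "(\<i> * of_real x)\<^sup>2 - of_real (u + 1) = - of_real (x\<^sup>2 + u + 1)"
          by (simp_all add: power_mult_distrib)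
        moreover have "\<i> * - (2 * (\<i> * of_real x)) = of_real (2 * x)" by simp
        ultimately show ?thesis by (simp only: times_divide_eq_right minus_mult_minus of_real_divide of_real_mult)
      qed
      finally show "\<i> * q (Complex 0 x) = of_real (2 * x * diff_kernel u x) * hit_entire (\<i> * of_real x)"
        unfolding diff_kernel_eq[OF u] by simp
    qed
    finally show ?thesis .
  qed
  have E4': "Im (contour_integral (linepath a4 a1) q) = integral {-R..R} (\<lambda>r. 2 * r * diff_kernel u r * hit_im r)"
  proof -
    have kc: "continuous_on {-R..R} (\<lambda>x. diff_kernel u x)"
      unfolding diff_kernel_eq[OF u, abs_def] using u
      by (intro continuous_intros) (auto simp: add_nonneg_eq_0_iff)
    have hc: "continuous_on {-R..R} (\<lambda>x. hit_entire (\<i> * of_real x))"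
      by (intro continuous_on_compose2[OF holomorphic_on_imp_continuous_on[OF hit_entire_holomorphic[of UNIV]]] continuous_intros) auto
    have "(\<lambda>x. of_real (2 * x * diff_kernel u x) * hit_entire (\<i> * of_real x)) integrable_on {-R..R}"
      by (intro integrable_continuous_interval continuous_intros kc hc)
    from integral_linear[OF this bounded_linear_Im]
    have "Im (integral {-R..R} (\<lambda>x. of_real (2 * x * diff_kernel u x) * hit_entire (\<i> * of_real x)))
      = integral {-R..R} (\<lambda>x. - (2 * x * diff_kernel u x * hit_im x))"
      by (simp add: o_def Im_hit_entire mult.assoc)
    also have "\<dots> = - integral {-R..R} (\<lambda>x. 2 * x * diff_kernel u x * hit_im x)" by (rule integral_neg)
    finally show ?thesis unfolding E4 by simp
  qed
  have lin: "X - d = a' + b' + c'" if "X = a' + (b' + (c' + d))" for X a' b' c' d :: real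
    using that by simp
  have "2 * pi * \<i> * (hit_entire (of_real a) - hit_entire (of_real b)) = contour_integral \<gamma> q"
    using q_int by (simp add: contour_integral_unique)
  moreover have "2 * pi * \<i> * (hit_entire (of_real a) - hit_entire (of_real b)) = of_real (2 * pi * (hit_laplace a - hit_laplace b)) * \<i>"
    using ab by (simp add: hit_entire_of_real)
  ultimately have "contour_integral \<gamma> q = of_real (2 * pi * (hit_laplace a - hit_laplace b)) * \<i>" by (simp only:)
  then have "2 * pi * (hit_laplace a - hit_laplace b) = Im (contour_integral \<gamma> q)"
    by simp
  then have eq: "2 * pi * (hit_laplace a - hit_laplace b) - integral {-R..R} (\<lambda>r. 2 * r * diff_kernel u r * hit_im r)
     = Im (contour_integral (linepath a1 a2) q + contour_integral (linepath a2 a3) q + contour_integral (linepath a3 a4) q)"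
    unfolding E4'[symmetric] sum plus_complex.sel by (rule lin)
  have "\<bar>2 * pi * (hit_laplace a - hit_laplace b) - integral {-R..R} (\<lambda>r. 2 * r * diff_kernel u r * hit_im r)\<bar>
     \<le> norm (contour_integral (linepath a1 a2) q + contour_integral (linepath a2 a3) q + contour_integral (linepath a3 a4) q)"
    unfolding eq by (rule abs_Im_le_cmod)
  also have "\<dots> \<le> norm (contour_integral (linepath a1 a2) q) + norm (contour_integral (linepath a2 a3) q) + norm (contour_integral (linepath a3 a4) q)"
    by (rule order_trans[OF norm_triangle_ineq add_right_mono[OF norm_triangle_ineq]])
  also have "\<dots> \<le> B * R + B * (2 * R) + B * R"
    by (rule add_mono[OF add_mono[OF E1 E2] E3])
  also have "\<dots> = B * (4 * R)" by simp
  also have "\<dots> = (1 + 2 * R / exp_cube_total) * (16 / R ^ 3 * (4 * R))"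
    unfolding B_def by (rule mult.assoc)
  also have "16 / R ^ 3 * (4 * R) = 64 / R\<^sup>2"
    using R by (simp add: power2_eq_square power3_eq_cube)
  finally show ?thesis unfolding a_def b_def .
qed

lemma kernel_identity:
  assumes u: "u > 0"
  shows "(LBINT r. 2 * r * diff_kernel u r * hit_im r) = 2 * pi * (hit_laplace (sqrt u) - hit_laplace (sqrt (u + 1)))"
proof (rule LIMSEQ_unique)
  let ?d = "2 * pi * (hit_laplace (sqrt u) - hit_laplace (sqrt (u + 1)))"
  let ?g = "\<lambda>r. 2 * r * diff_kernel u r * hit_im r"
  note int = kernel_hit_im_integrable[OF u]
  have "(\<lambda>n. LBINT r. indicator {- real n..real n} r *\<^sub>R ?g r) \<longlonglongrightarrow> (LBINT r. ?g r)"
  proof (rule integral_dominated_convergence)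
    show "AE r in lborel. (\<lambda>n. indicator {- real n..real n} r *\<^sub>R ?g r) \<longlonglongrightarrow> ?g r"
    proof (rule AE_I2)
      fix r :: real
      show "(\<lambda>n. indicator {- real n..real n} r *\<^sub>R ?g r) \<longlonglongrightarrow> ?g r"
      proof (rule tendsto_eventually)
        show "\<forall>\<^sub>F n in sequentially. indicator {- real n..real n} r *\<^sub>R ?g r = ?g r"
          using eventually_ge_at_top[of "nat \<lceil>\<bar>r\<bar>\<rceil>"]
          by eventually_elim (auto simp: indicator_def abs_le_iff)
      qed
    qed
    show "integrable lborel (\<lambda>r. norm (?g r))" using int by (rule integrable_norm)
  qed (auto split: split_indicator)
  also have "(\<lambda>n. LBINT r. indicator {- real n..real n} r *\<^sub>R ?g r) = (\<lambda>n. integral {- real n..real n} ?g)"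
  proof
    fix n
    have "set_integrable lborel {- real n..real n} ?g"
      unfolding set_integrable_def by (rule integrable_mult_indicator[OF _ int]) simp
    from set_borel_integral_eq_integral(2)[OF this]
    show "(LBINT r. indicator {- real n..real n} r *\<^sub>R ?g r) = integral {- real n..real n} ?g"
      by (simp add: set_lebesgue_integral_def)
  qed
  finally show "(\<lambda>n. integral {- real n..real n} ?g) \<longlonglongrightarrow> (LBINT r. ?g r)" .
  have "(\<lambda>n. ?d - integral {- real n..real n} ?g) \<longlonglongrightarrow> 0"
  proof (rule Lim_null_comparison)
    have "((\<lambda>x. (1 + 2 * x / c) * (64 / x\<^sup>2)) \<longlongrightarrow> 0) at_top" if "c > 0" for c :: real
      using that by real_asymp
    from filterlim_compose[OF this[OF exp_cube_total_pos] filterlim_real_sequentially]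
    show "(\<lambda>n. (1 + 2 * real n / exp_cube_total) * (64 / (real n)\<^sup>2)) \<longlonglongrightarrow> 0" .
    show "\<forall>\<^sub>F n in sequentially. norm (?d - integral {- real n..real n} ?g)
       \<le> (1 + 2 * real n / exp_cube_total) * (64 / (real n)\<^sup>2)"
      using eventually_ge_at_top[of "nat \<lceil>2 * (u + 1)\<rceil>"]
    proof eventually_elim
      case (elim n)
      then have n: "real n \<ge> 2 * (u + 1)" using u by linarith
      moreover have "1 \<le> 2 * (u + 1)" using u by simp
      ultimately have n1: "real n \<ge> 1" by (rule order_trans[rotated])
      then have "real n \<le> (real n)\<^sup>2" by (simp add: power2_eq_square)
      with n have "2 * (u + 1) \<le> (real n)\<^sup>2" by (rule order_trans)
      then show ?case unfolding real_norm_def using n1 u by (intro kernel_identity_truncated) auto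
    qed
  qed
  from tendsto_diff[OF tendsto_const[of "?d"] this]
  show "(\<lambda>n. integral {- real n..real n} ?g) \<longlonglongrightarrow> ?d" by simp
qed

section \<open>The tail as an incomplete Gamma function\<close>

text \<open>With s = v^3 + 1, the factor exp (- (s a^3)) / s is the integral of 3 t^2 exp (- (s
  t^3)) over t > a. After exchanging the integrals, the one over v scales like t^(-2) and cancels
  t^2, which leaves a constant times the tail of exp (- (t^3)). The case a = 0, where the mixture
  equals 1, determines the constant.\<close>

lemma exp_mix_hit_weight_cube:
  assumes a: "a \<ge> 0"
  shows "exp_mix hit_weight (a ^ 3) = ennreal (hit_laplace a)"
proof -
  define K where "K = (\<integral>\<^sup>+v. ennreal (v * exp (- (v ^ 3))) * indicator {0..} v \<partial>lborel)"
  have scaled: "(\<integral>\<^sup>+v. ennreal (v * exp (- ((v * t) ^ 3))) * indicator {0..} v \<partial>lborel) = ennreal (1 / t\<^sup>2) * K" if t: "t > 0" for t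
  proof -
    have "(\<integral>\<^sup>+v. ennreal (v * exp (- ((v * t) ^ 3))) * indicator {0..} v \<partial>lborel)
      = ennreal (1 / t) * (\<integral>\<^sup>+u. ennreal ((u / t) * exp (- ((u / t * t) ^ 3))) * indicator {0..} (u / t) \<partial>lborel)"
      using t nn_integral_real_affine[of "\<lambda>v. ennreal (v * exp (- ((v * t) ^ 3))) * indicator {0..} v" "1 / t" 0]
      by simp
    also have "(\<integral>\<^sup>+u. ennreal ((u / t) * exp (- ((u / t * t) ^ 3))) * indicator {0..} (u / t) \<partial>lborel)
      = (\<integral>\<^sup>+u. ennreal (1 / t) * (ennreal (u * exp (- (u ^ 3))) * indicator {0..} u) \<partial>lborel)"
      using t by (intro nn_integral_cong) (auto simp: ennreal_mult'[symmetric] zero_le_divide_iff split: split_indicator)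
    also have "\<dots> = ennreal (1 / t) * K" unfolding K_def by (rule nn_integral_cmult) measurable
    finally show ?thesis using t by (simp add: mult.assoc[symmetric] ennreal_mult'[symmetric] power2_eq_square)
  qed
  have tail: "ennreal (exp (- (a ^ 3))) * exp_mix hit_weight (a ^ 3) = ennreal (3 * mix_const) * K * ennreal (exp_cube_total - exp_cube_int a)" if a: "a \<ge> 0" for a
  proof -
    have "ennreal (exp (- (a ^ 3))) * exp_mix hit_weight (a ^ 3) =
      (\<integral>\<^sup>+v. ennreal (exp (- (a ^ 3))) * (ennreal (hit_weight v * exp (- (v ^ 3 * a ^ 3))) * indicator {0..} v) \<partial>lborel)"
      unfolding exp_mix_def by (rule nn_integral_cmult[symmetric]) measurable
    also have "\<dots> = (\<integral>\<^sup>+v. \<integral>\<^sup>+t. ennreal (mix_const * v * indicator {0..} v) * (ennreal (3 * t\<^sup>2 * exp (- ((v ^ 3 + 1) * t ^ 3))) * indicator {a..} t) \<partial>lborel \<partial>lborel)"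
    proof (rule nn_integral_cong)
      fix v :: real
      show "ennreal (exp (- (a ^ 3))) * (ennreal (hit_weight v * exp (- (v ^ 3 * a ^ 3))) * indicator {0..} v)
        = (\<integral>\<^sup>+t. ennreal (mix_const * v * indicator {0..} v) * (ennreal (3 * t\<^sup>2 * exp (- ((v ^ 3 + 1) * t ^ 3))) * indicator {a..} t) \<partial>lborel)"
      proof (cases "v \<ge> 0")
        case v: True
        define s where "s = v ^ 3 + 1"
        have s: "s > 0" using v by (simp add: s_def add_nonneg_pos)
        have "(\<integral>\<^sup>+t. ennreal (3 * t\<^sup>2 * exp (- (s * t ^ 3))) * indicator {a..} t \<partial>lborel) = ennreal (0 - (- exp (- (s * a ^ 3)) / s))"
        proof (rule nn_integral_FTC_atLeast)
          show "((\<lambda>t. - exp (- (s * t ^ 3)) / s) \<longlongrightarrow> 0) at_top" using s by real_asymp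
          show "((\<lambda>t. - exp (- (s * t ^ 3)) / s) has_real_derivative 3 * t\<^sup>2 * exp (- (s * t ^ 3))) (at t)" for t
            using s by (auto intro!: derivative_eq_intros)
        qed auto
        then have "(\<integral>\<^sup>+t. ennreal (mix_const * v * indicator {0..} v) * (ennreal (3 * t\<^sup>2 * exp (- (s * t ^ 3))) * indicator {a..} t) \<partial>lborel)
          = ennreal (mix_const * v) * ennreal (exp (- (s * a ^ 3)) / s)"
          using v by (subst nn_integral_cmult) auto
        also have "\<dots> = ennreal (mix_const * v * (exp (- (s * a ^ 3)) / s))"
          using v by (intro ennreal_mult'[symmetric]) auto
        also have "mix_const * v * (exp (- (s * a ^ 3)) / s) = exp (- (a ^ 3)) * (hit_weight v * exp (- (v ^ 3 * a ^ 3)))"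
        proof -
          have "exp (- (s * a ^ 3)) = exp (- (a ^ 3)) * exp (- (v ^ 3 * a ^ 3))"
            by (simp add: s_def exp_add[symmetric] distrib_right)
          moreover have "hit_weight v = mix_const * v / s" by (simp add: hit_weight_def s_def add.commute)
          ultimately show ?thesis by simp
        qed
        finally show ?thesis using v unfolding s_def by (simp add: ennreal_mult')
      qed simp
    qed
    also have "\<dots> = (\<integral>\<^sup>+t. \<integral>\<^sup>+v. ennreal (mix_const * v * indicator {0..} v) * (ennreal (3 * t\<^sup>2 * exp (- ((v ^ 3 + 1) * t ^ 3))) * indicator {a..} t) \<partial>lborel \<partial>lborel)"
      by (rule lborel_pair.Fubini') measurable
    also have "\<dots> = (\<integral>\<^sup>+t. ennreal (3 * mix_const) * K * (ennreal (exp (- (t ^ 3))) * indicator {a<..} t) \<partial>lborel)"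
    proof (rule nn_integral_cong_AE, use AE_lborel_neq[of a] in eventually_elim)
      case (elim t)
      show ?case
      proof (cases "t > a")
        case True
        then have t: "t > 0" using a by simp
        have "(\<integral>\<^sup>+v. ennreal (mix_const * v * indicator {0..} v) * (ennreal (3 * t\<^sup>2 * exp (- ((v ^ 3 + 1) * t ^ 3))) * indicator {a..} t) \<partial>lborel)
          = (\<integral>\<^sup>+v. ennreal (3 * mix_const * t\<^sup>2 * exp (- (t ^ 3))) * (ennreal (v * exp (- ((v * t) ^ 3))) * indicator {0..} v) \<partial>lborel)"
        proof (rule nn_integral_cong)
          fix v :: real
          have "exp (- ((v ^ 3 + 1) * t ^ 3)) = exp (- (t ^ 3)) * exp (- ((v * t) ^ 3))"
            by (simp add: exp_add[symmetric] distrib_right power_mult_distrib)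
          then show "ennreal (mix_const * v * indicator {0..} v) * (ennreal (3 * t\<^sup>2 * exp (- ((v ^ 3 + 1) * t ^ 3))) * indicator {a..} t)
            = ennreal (3 * mix_const * t\<^sup>2 * exp (- (t ^ 3))) * (ennreal (v * exp (- ((v * t) ^ 3))) * indicator {0..} v)"
            using True by (auto split: split_indicator simp: ennreal_mult'[symmetric] ac_simps)
        qed
        also have "\<dots> = ennreal (3 * mix_const * t\<^sup>2 * exp (- (t ^ 3))) * (ennreal (1 / t\<^sup>2) * K)"
          by (subst nn_integral_cmult) (auto simp: scaled[OF t])
        also have "\<dots> = (ennreal (3 * mix_const * t\<^sup>2 * exp (- (t ^ 3))) * ennreal (1 / t\<^sup>2)) * K"
          by (rule mult.assoc[symmetric])
        also have "ennreal (3 * mix_const * t\<^sup>2 * exp (- (t ^ 3))) * ennreal (1 / t\<^sup>2) = ennreal (3 * mix_const * exp (- (t ^ 3)))"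
          using t by (subst ennreal_mult'[symmetric]) auto
        also have "\<dots> = ennreal (3 * mix_const) * ennreal (exp (- (t ^ 3)))" by (rule ennreal_mult') simp
        finally show ?thesis using True by (simp add: mult_ac)
      next
        case False
        then show ?thesis using elim by simp
      qed
    qed
    also have "\<dots> = ennreal (3 * mix_const) * K * ennreal (exp_cube_total - exp_cube_int a)"
      by (subst nn_integral_cmult) (auto simp: exp_cube_int_tail[OF a])
    finally show ?thesis .
  qed
  have "exp_cube_int 0 = 0" by (simp add: exp_cube_int_def)
  then have 1: "ennreal (3 * mix_const) * K * ennreal exp_cube_total = 1" using tail[of 0] by (simp add: exp_mix_hit_weight_0)
  have C: "ennreal (3 * mix_const) * K = ennreal (1 / exp_cube_total)"
  proof -
    have "ennreal (3 * mix_const) * K = ennreal (3 * mix_const) * K * (ennreal exp_cube_total * ennreal (1 / exp_cube_total))"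
      using exp_cube_total_pos by (simp add: ennreal_mult'[symmetric])
    also have "\<dots> = 1 * ennreal (1 / exp_cube_total)" unfolding 1[symmetric] by (simp only: mult.assoc)
    finally show ?thesis by simp
  qed
  have "exp_mix hit_weight (a ^ 3) = ennreal (exp (a ^ 3)) * (ennreal (exp (- (a ^ 3))) * exp_mix hit_weight (a ^ 3))"
    by (simp add: mult.assoc[symmetric] ennreal_mult'[symmetric] exp_add[symmetric])
  also have "\<dots> = ennreal (exp (a ^ 3)) * (ennreal (1 / exp_cube_total) * ennreal (exp_cube_total - exp_cube_int a))"
    unfolding tail[OF a] C ..
  also have "\<dots> = ennreal (exp (a ^ 3) * (1 / exp_cube_total * (exp_cube_total - exp_cube_int a)))"
    using exp_cube_total_pos by (simp add: ennreal_mult'[symmetric])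
  also have "1 / exp_cube_total * (exp_cube_total - exp_cube_int a) = 1 - exp_cube_int a / exp_cube_total"
    using exp_cube_total_pos by (simp add: field_simps)
  finally show ?thesis by (simp add: hit_laplace_def)
qed

lemma hit_transform_eq_hit_laplace: "hit_transform x = ennreal (hit_laplace (root 3 (max 0 x)))"
proof -
  have "root 3 (max 0 x) ^ 3 = max 0 x" by simp
  then show ?thesis unfolding hit_transform_eq using exp_mix_hit_weight_cube[of "root 3 (max 0 x)"] by simp
qed

lemma hit_laplace_nonneg: "a \<ge> 0 \<Longrightarrow> hit_laplace a \<ge> 0"
  unfolding hit_laplace_def using exp_cube_int_le[of a] exp_cube_total_pos by (intro mult_nonneg_nonneg) auto

lemma hit_laplace_0: "hit_laplace 0 = 1" by (simp add: hit_laplace_def exp_cube_int_def)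

lemma hit_laplace_continuous: "continuous_on {0..} hit_laplace"
proof -
  have "continuous_on UNIV hit_entire" by (rule holomorphic_on_imp_continuous_on[OF hit_entire_holomorphic])
  then have "continuous_on {0..} (\<lambda>a. hit_entire (of_real a))"
    by (rule continuous_on_compose2) (auto intro!: continuous_intros)
  then have "continuous_on {0..} (\<lambda>a. Re (hit_entire (of_real a)))" by (rule continuous_on_Re)
  then show ?thesis
    by (rule continuous_on_eq) (simp add: hit_entire_of_real)
qed

text \<open>Inserting t^2 / a^2, which is at least 1 for t > a, makes the tail integral elementary.
  The decay at infinity will exclude an atom of the law at 0.\<close>

lemma hit_laplace_le:
  assumes a: "a \<ge> 1"
  shows "hit_laplace a \<le> 1 / (3 * a\<^sup>2 * exp_cube_total)"
proof -
  have "ennreal (exp_cube_total - exp_cube_int a) = (\<integral>\<^sup>+t. ennreal (exp (- (t ^ 3))) * indicator {a<..} t \<partial>lborel)"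
    using a by (intro exp_cube_int_tail[symmetric]) auto
  also have "\<dots> \<le> (\<integral>\<^sup>+t. ennreal (t\<^sup>2 / a\<^sup>2 * exp (- (t ^ 3))) * indicator {a..} t \<partial>lborel)"
  proof (rule nn_integral_mono)
    fix t :: real
    have "1 * exp (- (t ^ 3)) \<le> t\<^sup>2 / a\<^sup>2 * exp (- (t ^ 3))" if "t > a"
      using that a by (intro mult_right_mono) (auto simp: power_mono)
    then show "ennreal (exp (- (t ^ 3))) * indicator {a<..} t \<le> ennreal (t\<^sup>2 / a\<^sup>2 * exp (- (t ^ 3))) * indicator {a..} t"
      by (auto split: split_indicator intro!: ennreal_leI)
  qed
  also have "\<dots> = ennreal (0 - (- exp (- (a ^ 3)) / (3 * a\<^sup>2)))"
  proof (rule nn_integral_FTC_atLeast[where F = "\<lambda>t. - exp (- (t ^ 3)) / (3 * a\<^sup>2)"])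
    show "((\<lambda>t. - exp (- (t ^ 3)) / (3 * a\<^sup>2)) \<longlongrightarrow> 0) at_top" using a by real_asymp
    show "((\<lambda>t. - exp (- (t ^ 3)) / (3 * a\<^sup>2)) has_real_derivative t\<^sup>2 / a\<^sup>2 * exp (- (t ^ 3))) (at t)" for t
      using a by (auto intro!: derivative_eq_intros simp: divide_simps power2_eq_square power4_eq_xxxx)
  qed (use a in auto)
  finally have *: "exp_cube_total - exp_cube_int a \<le> exp (- (a ^ 3)) / (3 * a\<^sup>2)"
    using a by (subst (asm) ennreal_le_iff) auto
  have "hit_laplace a = exp (a ^ 3) * (exp_cube_total - exp_cube_int a) / exp_cube_total"
    unfolding hit_laplace_def using exp_cube_total_pos by (simp add: field_simps)
  also have "\<dots> \<le> exp (a ^ 3) * (exp (- (a ^ 3)) / (3 * a\<^sup>2)) / exp_cube_total"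
    using * exp_cube_total_pos by (intro divide_right_mono mult_left_mono) auto
  also have "\<dots> = (exp (a ^ 3) * exp (- (a ^ 3))) / (3 * a\<^sup>2 * exp_cube_total)" by simp
  also have "exp (a ^ 3) * exp (- (a ^ 3)) = 1" by (simp add: exp_minus)
  finally show ?thesis .
qed

text \<open>Substitution s = t^3: the factor t^2 of the derivative cancels s powr (1 / 3 - 1). The
  case a = 0 gives Gamma (1 / 3), the others the incomplete Gamma function.\<close>

lemma gamma_kernel_cube:
  assumes a: "a \<ge> 0"
  shows "set_integrable lborel {a ^ 3<..} (\<lambda>s. s powr (1 / 3 - 1) * exp (- s))"
    and "(LBINT s:{a ^ 3<..}. s powr (1 / 3 - 1) * exp (- s)) = 3 * (exp_cube_total - exp_cube_int a)"
    and "integral {a ^ 3<..} (\<lambda>s. s powr (1 / 3 - 1) * exp (- s)) = 3 * (exp_cube_total - exp_cube_int a)"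
proof -
  let ?T = "3 * (exp_cube_total - exp_cube_int a)"
  let ?f = "\<lambda>s::real. s powr (1 / 3 - 1) * exp (- s)"
  have int: "integrable lborel (\<lambda>t. indicator {a<..} t * (3 * exp (- (t ^ 3))))"
    "(LBINT t. indicator {a<..} t * (3 * exp (- (t ^ 3)))) = ?T"
  proof -
    have e: "(\<integral>\<^sup>+t. ennreal (indicator {a<..} t * (3 * exp (- (t ^ 3)))) \<partial>lborel) = ennreal (?T)"
    proof -
      have "(\<integral>\<^sup>+t. ennreal (indicator {a<..} t * (3 * exp (- (t ^ 3)))) \<partial>lborel) = (\<integral>\<^sup>+t. ennreal 3 * (ennreal (exp (- (t ^ 3))) * indicator {a<..} t) \<partial>lborel)"
        by (intro nn_integral_cong) (auto split: split_indicator simp: ennreal_mult')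
      also have "\<dots> = ennreal 3 * ennreal (exp_cube_total - exp_cube_int a)"
        by (subst nn_integral_cmult) (auto simp: exp_cube_int_tail[OF a])
      also have "\<dots> = ennreal (?T)" by (rule ennreal_mult'[symmetric]) simp
      finally show ?thesis .
    qed
    show "integrable lborel (\<lambda>t. indicator {a<..} t * (3 * exp (- (t ^ 3))))"
      by (rule integrableI_nn_integral_finite[OF _ _ e]) auto
    show "(LBINT t. indicator {a<..} t * (3 * exp (- (t ^ 3)))) = ?T"
      by (subst integral_eq_nn_integral) (use e exp_cube_int_le[OF a] in auto)
  qed
  have img: "(\<lambda>t. t ^ 3) ` {a<..} = {a ^ 3<..}"
  proof (intro equalityI subsetI)
    fix y assume "y \<in> {a ^ 3<..}"
    then have y: "a ^ 3 < y" by simp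
    then have "y = root 3 y ^ 3" "a < root 3 y"
      using a real_root_less_iff[of 3 "a ^ 3" y] by (auto simp: real_root_pos2 odd_real_root_power_cancel odd_real_root_pow)
    then show "y \<in> (\<lambda>t. t ^ 3) ` {a<..}" by auto
  qed (use a in \<open>auto intro: power_strict_mono\<close>)
  have simp_f: "\<bar>3 * t\<^sup>2\<bar> * ?f (t ^ 3) = 3 * exp (- (t ^ 3))" if "t \<in> {a<..}" for t
  proof -
    have t: "t > 0" using that a by simp
    have "t\<^sup>2 * (t ^ 3) powr (1 / 3 - 1) = t powr 2 * (t powr 3) powr (1 / 3 - 1)"
      using t by simp
    also have "\<dots> = t powr (2 + 3 * (1 / 3 - 1))" unfolding powr_powr powr_add ..
    also have "\<dots> = 1" using t by simp
    finally show ?thesis using t by simp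
  qed
  have ab: "(\<lambda>t. \<bar>3 * t\<^sup>2\<bar> * ?f (t ^ 3)) absolutely_integrable_on {a<..} \<and>
      integral {a<..} (\<lambda>t. \<bar>3 * t\<^sup>2\<bar> * ?f (t ^ 3)) = ?T"
  proof -
    have s: "set_integrable lborel {a<..} (\<lambda>t. 3 * exp (- (t ^ 3)))"
      using int(1) by (simp add: set_integrable_def)
    have "set_integrable lebesgue {a<..} (\<lambda>t. 3 * exp (- (t ^ 3)))"
      using int(1) unfolding set_integrable_def by (subst integrable_completion) auto
    moreover have "(\<lambda>t. indicator {a<..} t *\<^sub>R (\<bar>3 * t\<^sup>2\<bar> * ?f (t ^ 3))) = (\<lambda>t. indicator {a<..} t *\<^sub>R (3 * exp (- (t ^ 3))))"
    proof (rule ext)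
      fix t
      show "indicator {a<..} t *\<^sub>R (\<bar>3 * t\<^sup>2\<bar> * ?f (t ^ 3)) = indicator {a<..} t *\<^sub>R (3 * exp (- (t ^ 3)))"
      proof (cases "t \<in> {a<..}")
        case True
        show ?thesis unfolding simp_f[OF True] ..
      qed simp
    qed
    ultimately have "(\<lambda>t. \<bar>3 * t\<^sup>2\<bar> * ?f (t ^ 3)) absolutely_integrable_on {a<..}"
      unfolding set_integrable_def by (simp only:)
    moreover have "integral {a<..} (\<lambda>t. \<bar>3 * t\<^sup>2\<bar> * ?f (t ^ 3)) = integral {a<..} (\<lambda>t. 3 * exp (- (t ^ 3)))"
      by (rule integral_cong) (rule simp_f)
    moreover have "\<dots> = ?T"
      using int(2) unfolding set_borel_integral_eq_integral(2)[OF s, symmetric] set_lebesgue_integral_def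
      by (simp only: real_scaleR_def)
    ultimately show ?thesis by simp
  qed
  have "?f absolutely_integrable_on ((\<lambda>t. t ^ 3) ` {a<..}) \<and> integral ((\<lambda>t. t ^ 3) ` {a<..}) ?f = ?T"
  proof (rule has_absolute_integral_change_of_variables_1'[where g = "\<lambda>t. t ^ 3" and g' = "\<lambda>t. 3 * t\<^sup>2", THEN iffD1])
    show "((\<lambda>t. t ^ 3) has_real_derivative 3 * t\<^sup>2) (at t within {a<..})" for t
      by (auto intro!: derivative_eq_intros)
    show "inj_on (\<lambda>t. t ^ 3) {a<..}"
      using a by (intro inj_onI) (auto simp: power_eq_iff_eq_base)
  qed (use ab in simp_all)
  then have r: "?f absolutely_integrable_on {a ^ 3<..}" "integral {a ^ 3<..} ?f = ?T"
    unfolding img by auto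
  show "set_integrable lborel {a ^ 3<..} ?f"
    using r(1) unfolding set_integrable_def by (subst (asm) integrable_completion) auto
  then show "(LBINT s:{a ^ 3<..}. ?f s) = ?T"
    using set_borel_integral_eq_integral(2) r(2) by metis
  show "integral {a ^ 3<..} ?f = ?T" by (rule r(2))
qed

text \<open>In turn: the substitution above, the functional equation at 1 / 3, and the reflection
  formula with sin (pi / 3) = sqrt 3 / 2.\<close>

lemma Gamma_third: "Gamma (1 / 3 :: real) = 3 * exp_cube_total" "Gamma (4 / 3 :: real) = exp_cube_total"
  "Gamma (2 / 3 :: real) * Gamma (1 / 3) = 2 * pi / sqrt 3"
proof -
  have "Gamma (1 / 3 :: real) = integral {0..} (\<lambda>s. s powr (1 / 3 - 1) * exp (- s))"
  proof -
    have "(\<lambda>s::real. s powr (1 / 3 - 1) * exp (- s)) = (\<lambda>t. t powr (1 / 3 - 1) / exp t)"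
      by (rule ext) (simp only: exp_minus divide_inverse)
    moreover have "Gamma (1 / 3 :: real) = integral {0..} (\<lambda>t. t powr (1 / 3 - 1) / exp t)"
      by (rule integral_unique[OF Gamma_integral_real, symmetric]) simp
    ultimately show ?thesis by (simp only:)
  qed
  also have "\<dots> = integral {0<..} (\<lambda>s. s powr (1 / 3 - 1) * exp (- s))"
    by (rule integral_spike_set) (auto intro: negligible_subset[of "{0}"])
  also have "\<dots> = 3 * exp_cube_total"
    using gamma_kernel_cube(3)[of 0] by (simp add: exp_cube_int_def)
  finally show "Gamma (1 / 3 :: real) = 3 * exp_cube_total" .
  then show "Gamma (4 / 3 :: real) = exp_cube_total"
    using Gamma_plus1[of "1 / 3 :: real"] nonpos_Ints_nonpos[of "1 / 3 :: real"] by fastforce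
  have "Gamma (complex_of_real (1 / 3)) * Gamma (complex_of_real (1 - 1 / 3)) = complex_of_real (pi / sin (pi * (1 / 3)))"
    using Gamma_reflection_complex[of "complex_of_real (1 / 3)"]
    by (simp only: of_real_diff of_real_1 of_real_divide sin_of_real[symmetric] of_real_mult)
  then have "Gamma (1 / 3 :: real) * Gamma (1 - 1 / 3) = pi / sin (pi * (1 / 3))"
    unfolding Gamma_complex_of_real of_real_mult[symmetric] of_real_eq_iff .
  then show "Gamma (2 / 3 :: real) * Gamma (1 / 3) = 2 * pi / sqrt 3"
    by (simp add: sin_60 mult.commute)
qed

lemma laplace_closed_form:
  assumes a: "a \<ge> 0"
  shows "sqrt 3 / (2 * pi) * Gamma (2 / 3) * upper_Gamma (1 / 3) (a ^ 3) * exp (a ^ 3) = hit_laplace a"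
proof -
  have "upper_Gamma (1 / 3) (a ^ 3) = (LBINT s:{a ^ 3<..}. s powr (1 / 3 - 1) * exp (- s))"
    unfolding upper_Gamma_def set_lebesgue_integral_def
    using AE_lborel_neq[of "a ^ 3"]
    by (intro integral_cong_AE) (auto elim!: eventually_mono split: split_indicator)
  also have "\<dots> = 3 * (exp_cube_total - exp_cube_int a)" by (rule gamma_kernel_cube(2)[OF a])
  finally have u: "upper_Gamma (1 / 3) (a ^ 3) = 3 * (exp_cube_total - exp_cube_int a)" .
  have "Gamma (2 / 3) * (3 * exp_cube_total) = 2 * pi / sqrt 3" using Gamma_third by simp
  then have g: "sqrt 3 / (2 * pi) * Gamma (2 / 3) = 1 / (3 * exp_cube_total)"
    using exp_cube_total_pos by (simp add: field_simps)
  show ?thesis unfolding u g hit_laplace_def using exp_cube_total_pos by (simp add: field_simps)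
qed

section \<open>The hypergeometric function as a cosine integral\<close>

text \<open>A Beta integral, obtained by recursion: s (1 - s^3)^(n + 1) vanishes at both ends of
  [0, 1], and the integral of its derivative links the exponents n and n + 1.\<close>

lemma integral_one_minus_cube_power:
  "((\<lambda>s::real. (1 - s ^ 3) ^ n) has_integral fact n / pochhammer (4 / 3) n) {0..1}"
proof (induction n)
  case 0
  show ?case using has_integral_const_real[of "1::real" 0 1] by simp
next
  case (Suc n)
  have p: "pochhammer (4 / 3 :: real) n > 0" by (intro pochhammer_pos) simp
  let ?D = "\<lambda>s::real. (1 + 3 * real (Suc n)) * (1 - s ^ 3) ^ Suc n - 3 * real (Suc n) * (1 - s ^ 3) ^ n"
  have "(?D has_integral (1 * (1 - 1 ^ 3) ^ Suc n - 0 * (1 - 0 ^ 3) ^ Suc n)) {0..1}"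
  proof (rule fundamental_theorem_of_calculus)
    fix s :: real
    have "((\<lambda>s. s * (1 - s ^ 3) ^ Suc n) has_real_derivative
       (1 - s ^ 3) ^ Suc n + s * (real (Suc n) * (1 - s ^ 3) ^ n * (- (3 * s\<^sup>2)))) (at s)"
      by (rule DERIV_cong, (rule derivative_eq_intros refl)+) (simp add: algebra_simps)
    moreover have "(1 - s ^ 3) ^ Suc n + s * (real (Suc n) * (1 - s ^ 3) ^ n * (- (3 * s\<^sup>2))) = ?D s"
    proof -
      define A where "A = (1 - s ^ 3) ^ n"
      have "s * s\<^sup>2 = s ^ 3" by (simp add: eval_nat_numeral)
      then have "s * (real (Suc n) * A * (- (3 * s\<^sup>2))) = - (3 * real (Suc n) * A * s ^ 3)"
        by (metis (no_types, opaque_lifting) mult.assoc mult.commute mult_minus_right mult.left_commute)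
      then show ?thesis unfolding A_def[symmetric] power_Suc by (simp add: algebra_simps)
    qed
    ultimately show "((\<lambda>s. s * (1 - s ^ 3) ^ Suc n) has_vector_derivative ?D s) (at s within {0..1})"
      by (auto intro: has_vector_derivative_at_within simp: has_real_derivative_iff_has_vector_derivative)
  qed simp
  then have D: "(?D has_integral 0) {0..1}" by simp
  have "((\<lambda>s. (?D s + 3 * real (Suc n) * (1 - s ^ 3) ^ n) / (1 + 3 * real (Suc n))) has_integral
     (0 + 3 * real (Suc n) * (fact n / pochhammer (4 / 3) n)) / (1 + 3 * real (Suc n))) {0..1}"
    by (intro has_integral_divide has_integral_add D has_integral_mult_right Suc)
  moreover have "(?D s + 3 * real (Suc n) * (1 - s ^ 3) ^ n) / (1 + 3 * real (Suc n)) = (1 - s ^ 3) ^ Suc n" for s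
    by (simp del: of_nat_Suc power_Suc)
  moreover have "(0 + 3 * real (Suc n) * (fact n / pochhammer (4 / 3) n)) / (1 + 3 * real (Suc n)) = fact (Suc n) / pochhammer (4 / 3) (Suc n)"
    using p by (simp add: pochhammer_Suc divide_simps) (simp add: algebra_simps)
  ultimately show ?case by simp
qed

text \<open>Expand the cosine and integrate term by term. Only even powers occur, and the
  duplication formula splits pochhammer (4/3) (2 k) into 4^k times the two symbols with parameters
  2/3 and 7/6. The numerator pochhammer 1 k cancels the factorial of the series.\<close>

lemma hypergeom_cos_integral:
  assumes y: "y\<^sup>2 = t ^ 3"
  shows "hypergeom_1F2 1 (2 / 3) (7 / 6) (- (t ^ 3 / 4)) = integral {0..1} (\<lambda>s. cos (y * (1 - s ^ 3)))"
proof -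
  define f where "f k s = (- 1) ^ k * (y * (1 - s ^ 3)) ^ (2 * k) / fact (2 * k)" for k and s :: real
  have has_int: "(f k has_integral (- 1) ^ k * y ^ (2 * k) / pochhammer (4 / 3) (2 * k)) {0..1}" for k
  proof -
    have "((\<lambda>s. (- 1) ^ k * y ^ (2 * k) / fact (2 * k) * (1 - s ^ 3) ^ (2 * k)) has_integral
       (- 1) ^ k * y ^ (2 * k) / fact (2 * k) * (fact (2 * k) / pochhammer (4 / 3) (2 * k))) {0..1}"
      by (intro has_integral_mult_right integral_one_minus_cube_power)
    then show ?thesis by (simp add: f_def [abs_def] power_mult_distrib mult.assoc)
  qed
  have unif: "uniform_limit {0..1} (\<lambda>n s. \<Sum>k<n. f k s) (\<lambda>s. \<Sum>k. f k s) sequentially"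
  proof (rule Weierstrass_m_test)
    show "summable (\<lambda>k. \<bar>y\<bar> ^ (2 * k) / fact (2 * k))"
    proof (rule summable_comparison_test')
      show "summable (\<lambda>k. (y\<^sup>2) ^ k / fact k)"
        using summable_exp[of "y\<^sup>2"] by (simp add: divide_inverse mult.commute)
      fix k :: nat
      have "(y\<^sup>2) ^ k / fact (2 * k) \<le> (y\<^sup>2) ^ k / fact k"
        by (intro divide_left_mono fact_mono) auto
      then show "norm (\<bar>y\<bar> ^ (2 * k) / fact (2 * k)) \<le> (y\<^sup>2) ^ k / fact k"
        by (simp add: power_mult)
    qed
    fix k and s :: real assume s: "s \<in> {0..1}"
    have "\<bar>1 - s ^ 3\<bar> \<le> 1" using s by (auto simp: abs_le_iff power_le_one)
    then have "\<bar>y * (1 - s ^ 3)\<bar> \<le> \<bar>y\<bar>" by (simp add: abs_mult mult_left_le)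
    then have "\<bar>y * (1 - s ^ 3)\<bar> ^ (2 * k) \<le> \<bar>y\<bar> ^ (2 * k)" by (rule power_mono) simp
    then show "norm (f k s) \<le> \<bar>y\<bar> ^ (2 * k) / fact (2 * k)"
      by (simp add: f_def abs_mult power_abs divide_right_mono)
  qed
  have sumf: "(\<lambda>s. \<Sum>k. f k s) = (\<lambda>s. cos (y * (1 - s ^ 3)))"
  proof
    fix s
    have "(\<lambda>k. f k s) sums cos (y * (1 - s ^ 3))"
      using cos_paired[of "y * (1 - s ^ 3)"] by (simp add: f_def [abs_def])
    then show "(\<Sum>k. f k s) = cos (y * (1 - s ^ 3))" by (rule sums_unique[symmetric])
  qed
  obtain I J where IJ: "\<And>n. ((\<lambda>s. \<Sum>k<n. f k s) has_integral I n) {0..1}" "((\<lambda>s. \<Sum>k. f k s) has_integral J) {0..1}"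
    "I \<longlonglongrightarrow> J"
    by (rule uniform_limit_integral[OF unif]) (auto simp: f_def intro!: continuous_intros)
  then have "(\<lambda>n. integral {0..1} (\<lambda>s. \<Sum>k<n. f k s)) \<longlonglongrightarrow> integral {0..1} (\<lambda>s. \<Sum>k. f k s)"
    by (simp add: integral_unique[OF IJ(1)] integral_unique[OF IJ(2)])
  moreover have "integral {0..1} (\<lambda>s. \<Sum>k<n. f k s) = (\<Sum>k<n. (- 1) ^ k * y ^ (2 * k) / pochhammer (4 / 3) (2 * k))" for n
    by (rule integral_unique) (intro has_integral_sum has_int finite_lessThan)
  ultimately have "(\<lambda>k. (- 1) ^ k * y ^ (2 * k) / pochhammer (4 / 3) (2 * k)) sums integral {0..1} (\<lambda>s. cos (y * (1 - s ^ 3)))"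
    unfolding sums_def sumf by simp
  moreover have "(- 1) ^ k * y ^ (2 * k) / pochhammer (4 / 3) (2 * k) =
     pochhammer 1 k * (- (t ^ 3 / 4)) ^ k / (pochhammer (2 / 3) k * pochhammer (7 / 6) k * fact k)" for k
  proof -
    have "pochhammer (4 / 3 :: real) (2 * k) = 4 ^ k * pochhammer (2 / 3) k * pochhammer (7 / 6) k"
      using pochhammer_double[of "2 / 3 :: real" k] by (simp add: power_mult)
    moreover have "pochhammer (1::real) k = fact k" by (simp add: pochhammer_fact)
    moreover have "y ^ (2 * k) = (t ^ 3) ^ k" by (simp add: power_mult y)
    moreover have "(- (t ^ 3 / 4)) ^ k = (- 1) ^ k * (t ^ 3) ^ k / 4 ^ k"
      by (metis mult_minus1 power_divide power_mult_distrib times_divide_eq_right)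
    ultimately show ?thesis by simp
  qed
  ultimately have "(\<lambda>k. pochhammer 1 k * (- (t ^ 3 / 4)) ^ k / (pochhammer (2 / 3) k * pochhammer (7 / 6) k * fact k)) sums
      integral {0..1} (\<lambda>s. cos (y * (1 - s ^ 3)))" by simp
  then show ?thesis unfolding hypergeom_1F2_def by (rule sums_unique[symmetric])
qed

lemma exit_integrand_hit_im:
  assumes "r > 0"
  shows "exit_integrand x (r\<^sup>2) = exp (- (r\<^sup>2 * x)) * hit_im r"
proof -
  have "(r ^ 3)\<^sup>2 = (r\<^sup>2) ^ 3" by (simp flip: power_mult)
  then have h: "hypergeom_1F2 1 (2 / 3) (7 / 6) (- ((r\<^sup>2) ^ 3 / 4)) = integral {0..1} (\<lambda>s. cos (r ^ 3 * (1 - s ^ 3)))"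
    by (rule hypergeom_cos_integral)
  have "(r\<^sup>2) powr (3 / 2) = (r powr 2) powr (3 / 2)" using assms by simp
  also have "\<dots> = r powr 3" by (simp add: powr_powr)
  also have "\<dots> = r ^ 3" using assms by simp
  finally have p: "(r\<^sup>2) powr (3 / 2) = r ^ 3" .
  have q: "(r\<^sup>2) powr (1 / 2) = r" using assms by (simp add: powr_half_sqrt)
  show ?thesis unfolding exit_integrand_def h p q Gamma_third hit_im_def by simp
qed

section \<open>Inversion of the Laplace transform\<close>

text \<open>Needed in \<open>exit_law\<close>, where a comparison of signed quantities is rewritten
  as an equality between sums of positive measures.\<close>

definition add_measure :: "'a measure \<Rightarrow> 'a measure \<Rightarrow> 'a measure" where
  "add_measure M N = measure_of (space M) (sets M) (\<lambda>A. emeasure M A + emeasure N A)"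

lemma sets_add_measure [simp, measurable_cong]: "sets (add_measure M N) = sets M"
  by (simp add: add_measure_def)

lemma space_add_measure [simp]: "space (add_measure M N) = space M"
  by (simp add: add_measure_def)

lemma emeasure_add_measure:
  assumes "sets N = sets M" "A \<in> sets M"
  shows "emeasure (add_measure M N) A = emeasure M A + emeasure N A"
  unfolding add_measure_def
proof (rule emeasure_measure_of_sigma)
  show "countably_additive (sets M) (\<lambda>A. emeasure M A + emeasure N A)"
  proof (rule countably_additiveI)
    fix A :: "nat \<Rightarrow> 'a set" assume A: "range A \<subseteq> sets M" "disjoint_family A"
    have "(\<Sum>i. emeasure M (A i) + emeasure N (A i)) = (\<Sum>i. emeasure M (A i)) + (\<Sum>i. emeasure N (A i))"
      by (rule suminf_add[symmetric]) auto
    then show "(\<Sum>i. emeasure M (A i) + emeasure N (A i)) = emeasure M (\<Union> (range A)) + emeasure N (\<Union> (range A))"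
      using A assms(1) suminf_emeasure[of A M] suminf_emeasure[of A N] by simp
  qed
qed (auto simp: sets.sigma_algebra_axioms positive_def assms)

lemma nn_integral_add_measure:
  assumes s: "sets N = sets M" and f: "f \<in> borel_measurable M"
  shows "(\<integral>\<^sup>+x. f x \<partial>add_measure M N) = (\<integral>\<^sup>+x. f x \<partial>M) + (\<integral>\<^sup>+x. f x \<partial>N)"
  using f
proof (induction rule: borel_measurable_induct)
  case (cong f g)
  have "(\<integral>\<^sup>+x. f x \<partial>D) = (\<integral>\<^sup>+x. g x \<partial>D)" if "space D = space M" for D
    using cong(3) that by (intro nn_integral_cong) auto
  then show ?case using cong sets_eq_imp_space_eq[OF s] by simp
next
  case (set A)
  then show ?case using s by (simp add: emeasure_add_measure)
next
  case (mult u c)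
  have u: "u \<in> borel_measurable N" using mult(2) s by (simp cong: measurable_cong_sets)
  show ?case using mult u by (simp add: nn_integral_cmult distrib_left)
next
  case (add u v)
  have u: "u \<in> borel_measurable N" "v \<in> borel_measurable N" using add s by (simp_all cong: measurable_cong_sets)
  show ?case using add u by (simp add: nn_integral_add ac_simps)
next
  case (seq U)
  have U: "U i \<in> borel_measurable N" "U i \<in> borel_measurable M" "U i \<in> borel_measurable (add_measure M N)" for i
    using seq(1) s by (simp_all cong: measurable_cong_sets)
  have *: "(\<integral>\<^sup>+x. (SUP i. U i) x \<partial>D) = (SUP i. \<integral>\<^sup>+x. U i x \<partial>D)" if "\<And>i. U i \<in> borel_measurable D" for D
    unfolding SUP_apply using \<open>incseq U\<close> that by (rule nn_integral_monotone_convergence_SUP)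
  have "(SUP i. integral\<^sup>N M (U i) + integral\<^sup>N N (U i)) = (SUP i. integral\<^sup>N M (U i)) + (SUP i. integral\<^sup>N N (U i))"
    using \<open>incseq U\<close> by (intro ennreal_SUP_add incseq_nn_integral)
  then show ?case unfolding *[OF U(1)] *[OF U(2)] *[OF U(3)] by (simp add: seq.IH)
qed

text \<open>This is \<open>exit_density\<close> after the substitution \<open>t = r\<^sup>2\<close>; see \<open>exit_density_eq\<close>.\<close>

definition exit_density_sq :: "real \<Rightarrow> real" where
  "exit_density_sq x = 1 / pi * (LBINT r:{0<..}. 2 * r * exp (- (r\<^sup>2 * x)) * hit_im r)"

lemma hit_im_kernel_bound:
  assumes x: "x > 0"
  obtains C where "C \<ge> 0" "\<And>r. r \<ge> 0 \<Longrightarrow> \<bar>2 * r * exp (- (r\<^sup>2 * x)) * hit_im r\<bar> \<le> C * (1 / (r\<^sup>2 + 1))"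
proof
  \<comment> \<open>Chosen so that m (r^2 + 1) is at most 1 + r^2 x / 2, hence at most exp (r^2 x /
    2). Squaring gives decay of order (r^2 + 1)^(-2), which beats the growth r^2 + 1 of the
    remaining factors.\<close>
  define m where "m = min 1 (x / 2)"
  have m: "m > 0" "m \<le> 1" "m \<le> x / 2" using x by (auto simp: m_def)
  let ?C = "(1 + 2 / exp_cube_total) / m\<^sup>2"
  show "?C \<ge> 0" using exp_cube_total_pos by simp
  fix r :: real assume r: "r \<ge> 0"
  define w where "w = r\<^sup>2 + 1"
  have w: "w \<ge> 1" by (simp add: w_def)
  have "m * w \<le> 1 + r\<^sup>2 * x / 2"
  proof -
    have "m * r\<^sup>2 \<le> x / 2 * r\<^sup>2" using m by (intro mult_right_mono) auto
    then show ?thesis using m by (simp add: w_def distrib_left mult.commute)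
  qed
  also have "\<dots> \<le> exp (r\<^sup>2 * x / 2)" by (rule exp_ge_add_one_self)
  finally have "(m * w)\<^sup>2 \<le> (exp (r\<^sup>2 * x / 2))\<^sup>2" using m w by (intro power_mono) auto
  also have "\<dots> = exp (r\<^sup>2 * x)" by (simp add: power2_eq_square exp_add[symmetric])
  finally have e: "exp (- (r\<^sup>2 * x)) \<le> 1 / (m * w)\<^sup>2"
    using m w by (simp add: exp_minus inverse_eq_divide frac_le)
  have "2 * r * \<bar>hit_im r\<bar> \<le> 2 * r * (1 + r / exp_cube_total)"
    using hit_im_bound[of r] r by (intro mult_left_mono) auto
  also have "\<dots> = 2 * r + 2 / exp_cube_total * r\<^sup>2" by (simp add: algebra_simps power2_eq_square)
  also have "\<dots> \<le> w + 2 / exp_cube_total * w"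
  proof (intro add_mono mult_left_mono)
    have "0 \<le> (r - 1)\<^sup>2" by simp
    then show "2 * r \<le> w" by (simp add: w_def power2_eq_square algebra_simps)
  qed (use exp_cube_total_pos in \<open>auto simp: w_def\<close>)
  finally have p: "2 * r * \<bar>hit_im r\<bar> \<le> (1 + 2 / exp_cube_total) * w" by (simp add: distrib_right)
  have "\<bar>2 * r * exp (- (r\<^sup>2 * x)) * hit_im r\<bar> = (2 * r * \<bar>hit_im r\<bar>) * exp (- (r\<^sup>2 * x))"
    using r by (simp add: abs_mult)
  also have "\<dots> \<le> ((1 + 2 / exp_cube_total) * w) * (1 / (m * w)\<^sup>2)"
    using exp_cube_total_pos w by (intro mult_mono[OF p e]) auto
  also have "\<dots> = ?C * (1 / w)" using w m by (simp add: power2_eq_square)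
  finally show "\<bar>2 * r * exp (- (r\<^sup>2 * x)) * hit_im r\<bar> \<le> ?C * (1 / (r\<^sup>2 + 1))" by (simp add: w_def)
qed

lemma hit_im_kernel_integrable:
  assumes x: "x > 0"
  shows "set_integrable lborel {0<..} (\<lambda>r. 2 * r * exp (- (r\<^sup>2 * x)) * hit_im r)"
proof -
  obtain C where C: "C \<ge> 0" "\<And>r. r \<ge> 0 \<Longrightarrow> \<bar>2 * r * exp (- (r\<^sup>2 * x)) * hit_im r\<bar> \<le> C * (1 / (r\<^sup>2 + 1))"
    using hit_im_kernel_bound[OF x] by blast
  show ?thesis unfolding set_integrable_def
  proof (rule Bochner_Integration.integrable_bound)
    show "integrable lborel (\<lambda>r. C * (1 / (r\<^sup>2 + 1)))"
      using integrable_inverse_quadratic[of 1] by (intro integrable_mult_right) auto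
    show "AE r in lborel. norm (indicator {0<..} r *\<^sub>R (2 * r * exp (- (r\<^sup>2 * x)) * hit_im r)) \<le> norm (C * (1 / (r\<^sup>2 + 1)))"
    proof (rule AE_I2)
      fix r :: real
      have "0 \<le> C * (1 / (r\<^sup>2 + 1))" using C(1) by simp
      then show "norm (indicator {0<..} r *\<^sub>R (2 * r * exp (- (r\<^sup>2 * x)) * hit_im r)) \<le> norm (C * (1 / (r\<^sup>2 + 1)))"
        using C(2)[of r] C(1) by (auto split: split_indicator)
    qed
  qed measurable
qed

lemma exit_density_sq_measurable [measurable]: "exit_density_sq \<in> borel_measurable borel"
  unfolding exit_density_sq_def [abs_def] set_lebesgue_integral_def by measurable

text \<open>Dominated convergence. Continuity is what later upgrades nonnegativity almost everywhere
  to nonnegativity everywhere.\<close>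

lemma exit_density_sq_continuous: "continuous_on {0<..} exit_density_sq"
proof -
  have "(\<lambda>n. exit_density_sq (X n)) \<longlonglongrightarrow> exit_density_sq x" if X: "X \<longlonglongrightarrow> x" "x > 0" for X x
  proof -
    \<comment> \<open>The exponential decreases in x, so the bound at x / 2 dominates all terms with
      X n > x / 2; finitely many terms are dropped to ensure this.\<close>
    have x2: "x / 2 > 0" using that by simp
    obtain C where C: "C \<ge> 0" "\<And>r. r \<ge> 0 \<Longrightarrow> \<bar>2 * r * exp (- (r\<^sup>2 * (x / 2))) * hit_im r\<bar> \<le> C * (1 / (r\<^sup>2 + 1))"
      using hit_im_kernel_bound[OF x2] by blast
    have "eventually (\<lambda>n. X n > x / 2) sequentially"
      using X by (intro order_tendstoD) auto
    then obtain N where N: "\<And>n. n \<ge> N \<Longrightarrow> X n > x / 2" unfolding eventually_sequentially by blast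
    have "(\<lambda>n. LBINT r:{0<..}. 2 * r * exp (- (r\<^sup>2 * X (n + N))) * hit_im r) \<longlonglongrightarrow> (LBINT r:{0<..}. 2 * r * exp (- (r\<^sup>2 * x)) * hit_im r)"
      unfolding set_lebesgue_integral_def
    proof (rule integral_dominated_convergence)
      show "integrable lborel (\<lambda>r. C * (1 / (r\<^sup>2 + 1)))"
        using integrable_inverse_quadratic[of 1] by (intro integrable_mult_right) auto
      show "AE r in lborel. (\<lambda>n. indicator {0<..} r *\<^sub>R (2 * r * exp (- (r\<^sup>2 * X (n + N))) * hit_im r))
         \<longlonglongrightarrow> indicator {0<..} r *\<^sub>R (2 * r * exp (- (r\<^sup>2 * x)) * hit_im r)"
        using LIMSEQ_ignore_initial_segment[OF X(1), of N] by (intro AE_I2 tendsto_intros)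
      show "AE r in lborel. norm (indicator {0<..} r *\<^sub>R (2 * r * exp (- (r\<^sup>2 * X (n + N))) * hit_im r)) \<le> C * (1 / (r\<^sup>2 + 1))" for n
      proof (rule AE_I2)
        fix r :: real
        show "norm (indicator {0<..} r *\<^sub>R (2 * r * exp (- (r\<^sup>2 * X (n + N))) * hit_im r)) \<le> C * (1 / (r\<^sup>2 + 1))"
        proof (cases "r > 0")
          case True
          have "exp (- (r\<^sup>2 * X (n + N))) \<le> exp (- (r\<^sup>2 * (x / 2)))"
          proof -
            have "r\<^sup>2 * (x / 2) \<le> r\<^sup>2 * X (n + N)" using N[of "n + N"] by (intro mult_left_mono) auto
            then show ?thesis by simp
          qed
          then have "2 * r * \<bar>hit_im r\<bar> * exp (- (r\<^sup>2 * X (n + N))) \<le> 2 * r * \<bar>hit_im r\<bar> * exp (- (r\<^sup>2 * (x / 2)))"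
            using True by (intro mult_left_mono) auto
          also have "\<dots> = \<bar>2 * r * exp (- (r\<^sup>2 * (x / 2))) * hit_im r\<bar>" using True by (simp add: abs_mult)
          also have "\<dots> \<le> C * (1 / (r\<^sup>2 + 1))" using True by (intro C(2)) simp
          finally show ?thesis using True by (simp add: abs_mult mult_ac)
        next
          case False
          have "0 \<le> C * (1 / (r\<^sup>2 + 1))" using C(1) by simp
          then show ?thesis using False by simp
        qed
      qed
    qed measurable
    then have "(\<lambda>n. exit_density_sq (X (n + N))) \<longlonglongrightarrow> exit_density_sq x"
      unfolding exit_density_sq_def by (intro tendsto_mult_left)
    then show ?thesis by (rule LIMSEQ_offset)
  qed
  then show ?thesis
    unfolding continuous_on_sequentially by (auto simp: comp_def)
qed

section \<open>Laplace transforms of the candidate density\<close>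

text \<open>The counterpart of \<open>diff_kernel\<close>: its Laplace transform at r^2 is
  \<open>diff_kernel u r\<close>, which makes the double integral below absolutely
  convergent.\<close>

definition diff_exp :: "real \<Rightarrow> real \<Rightarrow> real" where
  "diff_exp u x = exp (- (u * x)) - exp (- ((u + 1) * x))"

lemma diff_exp_eq: "diff_exp u x = exp (- (u * x)) * (1 - exp (- x))"
  by (simp add: diff_exp_def algebra_simps exp_add[symmetric])

lemma diff_exp_pos: "x > 0 \<Longrightarrow> diff_exp u x > 0"
  by (simp add: diff_exp_eq)

lemma diff_exp_measurable [measurable]: "diff_exp u \<in> borel_measurable borel"
  unfolding diff_exp_def [abs_def] by measurable

lemma nn_integral_diff_exp:
  assumes u: "u > 0"
  shows "(\<integral>\<^sup>+x. ennreal (diff_exp u x * exp (- (r\<^sup>2 * x))) * indicator {0<..} x \<partial>lborel) = ennreal (diff_kernel u r)"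
proof -
  have p: "r\<^sup>2 + u > 0" "r\<^sup>2 + u + 1 > 0" using u by (auto intro: add_nonneg_pos add_pos_pos)
  have "(\<integral>\<^sup>+x. ennreal (diff_exp u x * exp (- (r\<^sup>2 * x))) * indicator {0<..} x \<partial>lborel)
    = (\<integral>\<^sup>+x. ennreal (diff_exp u x * exp (- (r\<^sup>2 * x))) * indicator {0..} x \<partial>lborel)"
    using AE_lborel_neq[of 0] by (intro nn_integral_cong_AE) (auto elim!: eventually_mono split: split_indicator)
  also have "\<dots> = ennreal (0 - (- exp (- ((r\<^sup>2 + u) * 0)) / (r\<^sup>2 + u) + exp (- ((r\<^sup>2 + u + 1) * 0)) / (r\<^sup>2 + u + 1)))"
  proof (rule nn_integral_FTC_atLeast[where F = "\<lambda>x. - exp (- ((r\<^sup>2 + u) * x)) / (r\<^sup>2 + u) + exp (- ((r\<^sup>2 + u + 1) * x)) / (r\<^sup>2 + u + 1)"])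
    have "((\<lambda>x. - exp (- (a * x)) / a + exp (- (b * x)) / b) \<longlongrightarrow> 0) at_top" if "a > 0" "b > 0" for a b :: real
    proof -
      have e: "((\<lambda>x. exp (- (c * x))) \<longlongrightarrow> 0) at_top" if "c > 0" for c :: real using that by real_asymp
      have "((\<lambda>x. - exp (- (a * x)) / a + exp (- (b * x)) / b) \<longlongrightarrow> - 0 / a + 0 / b) at_top"
        using that by (intro tendsto_intros e) auto
      then show ?thesis by simp
    qed
    from this[OF p] show "((\<lambda>x. - exp (- ((r\<^sup>2 + u) * x)) / (r\<^sup>2 + u) + exp (- ((r\<^sup>2 + u + 1) * x)) / (r\<^sup>2 + u + 1)) \<longlongrightarrow> 0) at_top" .
    fix x :: real assume x: "0 \<le> x"
    have "((\<lambda>x. - exp (- (a * x)) / a + exp (- (b * x)) / b) has_real_derivative exp (- (a * x)) - exp (- (b * x))) (at x)" if "a > 0" "b > 0" for a b :: real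
      using that by (auto intro!: derivative_eq_intros)
    from this[OF p] have "((\<lambda>x. - exp (- ((r\<^sup>2 + u) * x)) / (r\<^sup>2 + u) + exp (- ((r\<^sup>2 + u + 1) * x)) / (r\<^sup>2 + u + 1)) has_real_derivative
      exp (- ((r\<^sup>2 + u) * x)) - exp (- ((r\<^sup>2 + u + 1) * x))) (at x)" .
    moreover have "exp (- ((r\<^sup>2 + u) * x)) - exp (- ((r\<^sup>2 + u + 1) * x)) = diff_exp u x * exp (- (r\<^sup>2 * x))"
      by (simp add: diff_exp_def left_diff_distrib exp_add[symmetric] algebra_simps)
    ultimately show "((\<lambda>x. - exp (- ((r\<^sup>2 + u) * x)) / (r\<^sup>2 + u) + exp (- ((r\<^sup>2 + u + 1) * x)) / (r\<^sup>2 + u + 1)) has_real_derivative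
       diff_exp u x * exp (- (r\<^sup>2 * x))) (at x)" by simp
    show "0 \<le> diff_exp u x * exp (- (r\<^sup>2 * x))" using x by (simp add: diff_exp_eq)
  qed measurable
  also have "0 - (- exp (- ((r\<^sup>2 + u) * 0)) / (r\<^sup>2 + u) + exp (- ((r\<^sup>2 + u + 1) * 0)) / (r\<^sup>2 + u + 1)) = diff_kernel u r"
    by (simp add: diff_kernel_def)
  finally show ?thesis .
qed

lemma integral_even:
  fixes f :: "real \<Rightarrow> real"
  assumes f: "integrable lborel f" and even: "\<And>x. f (- x) = f x"
  shows "(LBINT x. f x) = 2 * (LBINT x:{0<..}. f x)"
proof -
  have i: "integrable lborel (\<lambda>x. indicator A x *\<^sub>R f x)" if "A \<in> sets borel" for A
    using that f by (intro integrable_mult_indicator) auto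
  have "(LBINT x. f x) = (LBINT x. indicator {0<..} x *\<^sub>R f x + indicator {..<0} x *\<^sub>R f x)"
    using AE_lborel_neq[of 0] f by (intro integral_cong_AE) (auto elim!: eventually_mono split: split_indicator)
  also have "\<dots> = (LBINT x. indicator {0<..} x *\<^sub>R f x) + (LBINT x. indicator {..<0} x *\<^sub>R f x)"
    by (intro Bochner_Integration.integral_add i) auto
  also have "(LBINT x. indicator {..<0} x *\<^sub>R f x) = (LBINT x. indicator {..<0} (- x) *\<^sub>R f (- x))"
    using lborel_integral_real_affine[of "-1" "\<lambda>x. indicator {..<0} x *\<^sub>R f x" 0] by simp
  also have "\<dots> = (LBINT x. indicator {0<..} x *\<^sub>R f x)"
    by (intro Bochner_Integration.integral_cong) (auto simp: even split: split_indicator)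
  finally show ?thesis by (simp add: set_lebesgue_integral_def)
qed

text \<open>By Fubini, integration over x first produces \<open>diff_kernel\<close>, and
  \<open>kernel_identity\<close> evaluates the integral over r. Its integrand is even because
  \<open>hit_im\<close> is odd; half of the 2 pi then cancels the 1 / pi in
  \<open>exit_density_sq\<close>.\<close>

lemma exit_density_sq_transform:
  assumes u: "u > 0"
  shows "set_integrable lborel {0<..} (\<lambda>x. diff_exp u x * exit_density_sq x)"
    and "(LBINT x:{0<..}. diff_exp u x * exit_density_sq x) = hit_laplace (sqrt u) - hit_laplace (sqrt (u + 1))"
proof -
  define h where "h x r = indicator {0<..} x * (diff_exp u x * exp (- (r\<^sup>2 * x)))" for x r :: real
  define g where "g r = indicator {0<..} r * (2 * r * hit_im r)" for r :: real
  define f where "f r x = g r * h x r" for r x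
  have [measurable]: "(\<lambda>(x, r). h x r) \<in> borel_measurable (lborel \<Otimes>\<^sub>M lborel)" "g \<in> borel_measurable borel"
    unfolding h_def g_def [abs_def] by measurable
  have hm [measurable]: "(\<lambda>x. h x r) \<in> borel_measurable borel" for r
    unfolding h_def by measurable
  have fm [measurable]: "(\<lambda>(r, x). f r x) \<in> borel_measurable (lborel \<Otimes>\<^sub>M lborel)"
    unfolding f_def h_def by measurable
  have h0: "0 \<le> h x r" for x r by (auto simp: h_def diff_exp_eq split: split_indicator)
  have inner: "(LBINT x. h x r) = diff_kernel u r" "integrable lborel (\<lambda>x. h x r)" for r
  proof -
    have e: "(\<integral>\<^sup>+x. ennreal (h x r) \<partial>lborel) = ennreal (diff_kernel u r)"
      unfolding nn_integral_diff_exp[OF u, symmetric] h_def by (intro nn_integral_cong) (auto split: split_indicator)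
    show "(LBINT x. h x r) = diff_kernel u r"
      by (subst integral_eq_nn_integral) (use h0 e diff_kernel_nonneg[OF u] in auto)
    show "integrable lborel (\<lambda>x. h x r)"
      by (rule integrableI_nn_integral_finite[OF _ _ e]) (use h0 in auto)
  qed
  have gk: "g r * diff_kernel u r = indicator {0<..} r *\<^sub>R (2 * r * diff_kernel u r * hit_im r)" for r
    by (simp add: g_def)
  have gk_int: "integrable lborel (\<lambda>r. g r * diff_kernel u r)"
    unfolding gk by (rule integrable_mult_indicator[OF _ kernel_hit_im_integrable[OF u]]) simp
  have f_int: "integrable (lborel \<Otimes>\<^sub>M lborel) (\<lambda>(r, x). f r x)"
  proof (rule lborel_pair.Fubini_integrable)
    have "(LBINT x. norm (f r x)) = \<bar>g r * diff_kernel u r\<bar>" for r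
    proof -
      have "(LBINT x. norm (f r x)) = (LBINT x. \<bar>g r\<bar> * h x r)"
        using h0 by (simp add: f_def abs_mult)
      also have "\<dots> = \<bar>g r\<bar> * diff_kernel u r" by (simp add: inner(1))
      finally show ?thesis using diff_kernel_nonneg[OF u] by (simp add: abs_mult)
    qed
    then show "integrable lborel (\<lambda>r. LBINT x. norm (case (r, x) of (r, x) \<Rightarrow> f r x))"
      using gk_int by simp
    show "AE r in lborel. integrable lborel (\<lambda>x. case (r, x) of (r, x) \<Rightarrow> f r x)"
      unfolding f_def using inner(2) by simp
  qed (rule fm)
  have r_int: "(LBINT r. f r x) = indicator {0<..} x *\<^sub>R (pi * (diff_exp u x * exit_density_sq x))" for x
  proof -
    have "(LBINT r. f r x) = (LBINT r. indicator {0<..} x * diff_exp u x * (indicator {0<..} r *\<^sub>R (2 * r * exp (- (r\<^sup>2 * x)) * hit_im r)))"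
      by (simp add: f_def g_def h_def mult_ac)
    also have "\<dots> = indicator {0<..} x * diff_exp u x * (pi * exit_density_sq x)"
      by (simp add: exit_density_sq_def set_lebesgue_integral_def)
    finally show ?thesis by simp
  qed
  have "integrable lborel (\<lambda>x. LBINT r. f r x)" by (rule lborel_pair.integrable_snd[OF f_int])
  then have "integrable lborel (\<lambda>x. 1 / pi * (indicator {0<..} x *\<^sub>R (pi * (diff_exp u x * exit_density_sq x))))"
    unfolding r_int by (rule integrable_mult_right)
  then show "set_integrable lborel {0<..} (\<lambda>x. diff_exp u x * exit_density_sq x)"
    unfolding set_integrable_def by (simp add: mult_ac)
  have "(LBINT x. LBINT r. f r x) = (LBINT r. LBINT x. f r x)"
    using lborel_pair.integral_fst[OF f_int] lborel_pair.integral_snd[OF f_int] by simp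
  also have "\<dots> = (LBINT r. g r * diff_kernel u r)"
    unfolding f_def by (simp add: inner(1))
  also have "\<dots> = (LBINT r:{0<..}. 2 * r * diff_kernel u r * hit_im r)"
    unfolding gk set_lebesgue_integral_def ..
  also have "\<dots> = (LBINT r. 2 * r * diff_kernel u r * hit_im r) / 2"
  proof -
    have "diff_kernel u (- r) = diff_kernel u r" for r by (simp add: diff_kernel_def)
    then show ?thesis
      by (subst integral_even) (simp_all add: kernel_hit_im_integrable[OF u] hit_im_odd)
  qed
  also have "\<dots> = pi * (hit_laplace (sqrt u) - hit_laplace (sqrt (u + 1)))"
    unfolding kernel_identity[OF u] by simp
  finally have "pi * (LBINT x:{0<..}. diff_exp u x * exit_density_sq x) = pi * (hit_laplace (sqrt u) - hit_laplace (sqrt (u + 1)))"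
    unfolding r_int set_lebesgue_integral_def by (simp add: mult_ac)
  then show "(LBINT x:{0<..}. diff_exp u x * exit_density_sq x) = hit_laplace (sqrt u) - hit_laplace (sqrt (u + 1))" by simp
qed

text \<open>The previous identity with the negative part moved to the other side, because
  subtraction in \<open>ennreal\<close> is truncated.\<close>

lemma exit_density_sq_pos_part:
  assumes u: "u > 0" and d: "hit_laplace (sqrt (u + 1)) \<le> hit_laplace (sqrt u)"
  shows "ennreal (hit_laplace (sqrt u) - hit_laplace (sqrt (u + 1)))
      + (\<integral>\<^sup>+x. ennreal (diff_exp u x * max 0 (- exit_density_sq x)) * indicator {0<..} x \<partial>lborel)
    = (\<integral>\<^sup>+x. ennreal (diff_exp u x * max 0 (exit_density_sq x)) * indicator {0<..} x \<partial>lborel)"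
    and "(\<integral>\<^sup>+x. ennreal (diff_exp u x * max 0 (exit_density_sq x)) * indicator {0<..} x \<partial>lborel) < \<infinity>"
proof -
  let ?P = "\<integral>\<^sup>+x. ennreal (diff_exp u x * max 0 (exit_density_sq x)) * indicator {0<..} x \<partial>lborel"
  let ?N = "\<integral>\<^sup>+x. ennreal (diff_exp u x * max 0 (- exit_density_sq x)) * indicator {0<..} x \<partial>lborel"
  let ?d = "hit_laplace (sqrt u) - hit_laplace (sqrt (u + 1))"
  let ?p = "\<lambda>x. indicator {0<..} x * (diff_exp u x * max 0 (exit_density_sq x))"
  let ?m = "\<lambda>x. indicator {0<..} x * (diff_exp u x * max 0 (- exit_density_sq x))"
  have i: "integrable lborel (\<lambda>x. indicator {0<..} x * (diff_exp u x * exit_density_sq x))"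
    using exit_density_sq_transform(1)[OF u] by (simp add: set_integrable_def)
  have ip: "integrable lborel ?p" "integrable lborel ?m"
    by (rule Bochner_Integration.integrable_bound[OF i]; auto split: split_indicator simp: abs_mult intro!: AE_I2 mult_left_mono)+
  have "?d = (LBINT x. indicator {0<..} x * (diff_exp u x * exit_density_sq x))"
    using exit_density_sq_transform(2)[OF u] by (simp add: set_lebesgue_integral_def)
  also have "\<dots> = (LBINT x. ?p x - ?m x)"
    by (intro Bochner_Integration.integral_cong) (auto split: split_indicator simp: max_def)
  also have "\<dots> = (LBINT x. ?p x) - (LBINT x. ?m x)"
    by (rule Bochner_Integration.integral_diff[OF ip])
  finally have e: "?d = (LBINT x. ?p x) - (LBINT x. ?m x)" .
  have nonneg: "0 \<le> ?p x" "0 \<le> ?m x" for x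
    using diff_exp_pos[of x u] by (auto split: split_indicator)
  have "?P = (\<integral>\<^sup>+x. ennreal (?p x) \<partial>lborel)"
    by (intro nn_integral_cong) (auto split: split_indicator)
  also have "\<dots> = ennreal (LBINT x. ?p x)" using nonneg(1) by (intro nn_integral_eq_integral ip AE_I2)
  finally have np: "?P = ennreal (LBINT x. ?p x)" .
  have "?N = (\<integral>\<^sup>+x. ennreal (?m x) \<partial>lborel)"
    by (intro nn_integral_cong) (auto split: split_indicator)
  also have "\<dots> = ennreal (LBINT x. ?m x)" using nonneg(2) by (intro nn_integral_eq_integral ip AE_I2)
  finally have nm: "?N = ennreal (LBINT x. ?m x)" .
  show "?P < \<infinity>"
    unfolding np by simp
  have "ennreal (?d) + ennreal (LBINT x. ?m x) = ennreal (?d + (LBINT x. ?m x))"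
    using d nonneg(2) by (intro ennreal_plus[symmetric] Bochner_Integration.integral_nonneg) auto
  then show "ennreal (?d)
      + ?N
    = ?P"
    unfolding np nm e by simp
qed

text \<open>The sign of \<open>exit_density_sq\<close> is not known beforehand, so its negative part is added to \<open>\<nu>\<close> before
  Laplace transforms of positive measures are compared. The weight \<open>diff_exp 1\<close> makes them finite.\<close>

lemma exit_law:
  fixes \<nu> :: "real measure"
  assumes fin: "finite_measure \<nu>" and sets: "sets \<nu> = sets borel" and nn: "AE x in \<nu>. x \<ge> 0"
    and lap: "\<And>u. u > 0 \<Longrightarrow> (\<integral>\<^sup>+x. ennreal (exp (- (u * x))) \<partial>\<nu>) = ennreal (hit_laplace (sqrt u))"
    and tends_0: "(\<lambda>n. hit_laplace (sqrt (real n))) \<longlonglongrightarrow> 0" and hit_laplace_nn: "\<And>a. a \<ge> 0 \<Longrightarrow> hit_laplace a \<ge> 0"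
  shows "\<forall>x>0. 0 \<le> exit_density_sq x"
    and "\<nu> = density lborel (\<lambda>x. ennreal (exit_density_sq x) * indicator {0<..} x)"
proof -
  let ?L = "\<lambda>\<mu> n. \<integral>\<^sup>+x. ennreal (exp (- (real n * x))) \<partial>\<mu>"
  let ?w = "diff_exp 1"
  let ?p = exit_density_sq
  let ?\<delta> = "\<lambda>x. ennreal (exit_density_sq x) * indicator {0<..} x"
  interpret finite_measure \<nu> by fact
  note [measurable_cong] = sets
  have sp: "space \<nu> = UNIV" using sets_eq_imp_space_eq[OF sets] by simp
  have diff_nu: "(\<integral>\<^sup>+x. ennreal (diff_exp u x) * indicator {0<..} x \<partial>\<nu>) = ennreal (hit_laplace (sqrt u) - hit_laplace (sqrt (u + 1)))"
    and mono: "hit_laplace (sqrt (u + 1)) \<le> hit_laplace (sqrt u)" if u: "u > 0" for u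
  proof -
    have "(\<integral>\<^sup>+x. ennreal (exp (- ((u + 1) * x))) \<partial>\<nu>) \<le> (\<integral>\<^sup>+x. ennreal (exp (- (u * x))) \<partial>\<nu>)"
      using nn by (intro nn_integral_mono_AE) (auto elim!: eventually_mono intro!: ennreal_leI simp: algebra_simps)
    then show "hit_laplace (sqrt (u + 1)) \<le> hit_laplace (sqrt u)"
      using u hit_laplace_nn[of "sqrt u"] by (simp add: lap)
    have "(\<integral>\<^sup>+x. ennreal (diff_exp u x) * indicator {0<..} x \<partial>\<nu>) = (\<integral>\<^sup>+x. ennreal (exp (- (u * x))) - ennreal (exp (- ((u + 1) * x))) \<partial>\<nu>)"
      using nn
    proof (intro nn_integral_cong_AE, eventually_elim)
      case (elim x)
      then show ?case by (cases "x = 0") (auto simp: diff_exp_def ennreal_minus)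
    qed
    also have "\<dots> = ennreal (hit_laplace (sqrt u)) - ennreal (hit_laplace (sqrt (u + 1)))"
    proof -
      have l: "(\<integral>\<^sup>+x. ennreal (exp (- (u * x))) \<partial>\<nu>) = ennreal (hit_laplace (sqrt u))"
        "(\<integral>\<^sup>+x. ennreal (exp (- ((u + 1) * x))) \<partial>\<nu>) = ennreal (hit_laplace (sqrt (u + 1)))"
        using u by (intro lap; simp)+
      have "AE x in \<nu>. ennreal (exp (- ((u + 1) * x))) \<le> ennreal (exp (- (u * x)))"
        using nn by eventually_elim (auto intro!: ennreal_leI simp: algebra_simps)
      then show ?thesis unfolding l[symmetric] by (intro nn_integral_diff) (auto simp: l)
    qed
    also have "\<dots> = ennreal (hit_laplace (sqrt u) - hit_laplace (sqrt (u + 1)))"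
      using u hit_laplace_nn by (intro ennreal_minus) auto
    finally show "(\<integral>\<^sup>+x. ennreal (diff_exp u x) * indicator {0<..} x \<partial>\<nu>) = ennreal (hit_laplace (sqrt u) - hit_laplace (sqrt (u + 1)))" .
  qed
  define A1 where "A1 = density \<nu> (\<lambda>x. ennreal (?w x) * indicator {0<..} x)"
  define A2 where "A2 = density lborel (\<lambda>x. ennreal (?w x * max 0 (- ?p x)) * indicator {0<..} x)"
  define B where "B = density lborel (\<lambda>x. ennreal (?w x * max 0 (?p x)) * indicator {0<..} x)"
  have sets12 [simp, measurable_cong]: "sets A1 = sets borel" "sets A2 = sets borel" "sets B = sets borel"
    by (simp_all add: A1_def A2_def B_def sets)
  have s21: "sets A2 = sets A1" by simp
  define A where "A = add_measure A1 A2"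
  have setsA [simp, measurable_cong]: "sets A = sets borel" by (simp add: A_def)
  have spA: "space A = UNIV" "space B = UNIV" using sets_eq_imp_space_eq[OF setsA] sets_eq_imp_space_eq[OF sets12(3)] by auto
  have shift: "exp (- (real n * x)) * ?w x = diff_exp (real n + 1) x" for n x
    by (simp add: diff_exp_def right_diff_distrib exp_add[symmetric] algebra_simps)
  \<comment> \<open>Multiplication by exp (- n x) changes the weight \<open>diff_exp 1\<close> into
    \<open>diff_exp (n + 1)\<close>, so the transforms of the weighted measures at natural numbers
    are the differences already computed.\<close>
  have shift': "ennreal (?w x * c) * indicator {0<..} x * ennreal (exp (- (real n * x)))
     = ennreal (diff_exp (real n + 1) x * c) * indicator {0<..} x" if "c \<ge> 0" for n c x
  proof (cases "x > 0")
    case True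
    have "ennreal (?w x * c) * ennreal (exp (- (real n * x))) = ennreal (?w x * c * exp (- (real n * x)))"
      using diff_exp_pos[OF True, of 1] that by (intro ennreal_mult[symmetric]) auto
    also have "?w x * c * exp (- (real n * x)) = diff_exp (real n + 1) x * c"
      unfolding shift[symmetric] by (simp add: mult_ac)
    finally show ?thesis using True by simp
  qed simp
  have tA: "?L A n = ?L B n"
    and tB: "?L B n < \<infinity>" for n
  proof -
    let ?u = "real n + 1"
    have u: "?u > 0" by simp
    have "?L A n = ?L A1 n + ?L A2 n"
      unfolding A_def by (rule nn_integral_add_measure[OF s21]) measurable
    also have "?L A1 n = (\<integral>\<^sup>+x. ennreal (diff_exp ?u x) * indicator {0<..} x \<partial>\<nu>)"
      unfolding A1_def by (subst nn_integral_density) (use shift'[of 1 _ n] in simp_all)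
    also have "?L A2 n = (\<integral>\<^sup>+x. ennreal (diff_exp ?u x * max 0 (- ?p x)) * indicator {0<..} x \<partial>lborel)"
      unfolding A2_def by (subst nn_integral_density) (simp_all add: shift')
    also have "(\<integral>\<^sup>+x. ennreal (diff_exp ?u x) * indicator {0<..} x \<partial>\<nu>) + \<dots> = (\<integral>\<^sup>+x. ennreal (diff_exp ?u x * max 0 (?p x)) * indicator {0<..} x \<partial>lborel)"
      unfolding diff_nu[OF u] by (rule exit_density_sq_pos_part(1)[OF u mono[OF u]])
    also have B: "\<dots> = ?L B n"
      unfolding B_def by (subst nn_integral_density) (simp_all add: shift')
    finally show "?L A n = ?L B n" .
    show "?L B n < \<infinity>"
      unfolding B[symmetric] by (rule exit_density_sq_pos_part(2)[OF u mono[OF u]])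
  qed
  have AB: "A = B"
  proof (rule laplace_uniqueness_finite)
    show "finite_measure B" using tB[of 0] by (intro finite_measureI) (simp add: spA)
    show "finite_measure A" using tA[of 0] tB[of 0] by (intro finite_measureI) (simp add: spA)
    have "emeasure A {..<0} = 0"
      unfolding A_def by (subst emeasure_add_measure[OF s21])
        (auto simp: A1_def A2_def emeasure_density sets intro!: nn_integral_zero' AE_I2 split: split_indicator)
    then show "AE x in A. x \<ge> 0" by (intro AE_I[of _ _ "{..<0}"]) (auto simp: spA)
    show "AE x in B. x \<ge> 0" unfolding B_def by (auto simp: AE_density split: split_indicator)
    show "(\<integral>x. exp (- real n * x) \<partial>A) = (\<integral>x. exp (- real n * x) \<partial>B)" for n
      using tA[of n] by (simp add: integral_eq_nn_integral)
  qed simp_all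
  \<comment> \<open>\<open>B\<close> gives no mass to the set where the candidate is negative. Hence
    neither does \<open>A2\<close>, although its density is positive there, and the set is
    null.\<close>
  have "AE x in lborel. x > 0 \<longrightarrow> ?p x \<ge> 0"
  proof -
    let ?N = "{x. x > 0 \<and> ?p x < 0}"
    have [measurable]: "?N \<in> sets borel" by measurable
    have "emeasure B ?N = 0"
      unfolding B_def by (auto simp: emeasure_density intro!: nn_integral_zero' AE_I2 split: split_indicator)
    then have "emeasure A ?N = 0" unfolding AB .
    then have "emeasure A2 ?N = 0" unfolding A_def by (subst (asm) emeasure_add_measure[OF s21]) auto
    then have "(\<integral>\<^sup>+x. ennreal (?w x * max 0 (- ?p x)) * indicator {0<..} x * indicator ?N x \<partial>lborel) = 0"
      unfolding A2_def by (simp add: emeasure_density)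
    then have "AE x in lborel. ennreal (?w x * max 0 (- ?p x)) * indicator {0<..} x * indicator ?N x = 0"
      by (subst (asm) nn_integral_0_iff_AE) auto
    then show ?thesis
    proof eventually_elim
      case (elim x)
      show ?case
      proof (intro impI leI notI)
        assume x: "x > 0" and n: "?p x < 0"
        then have "?w x * max 0 (- ?p x) > 0" by (intro mult_pos_pos diff_exp_pos) auto
        then show False using elim x n by simp
      qed
    qed
  qed
  note AE_nonneg = this
  show pos: "\<forall>x>0. 0 \<le> ?p x"
  proof (intro allI impI leI notI)
    fix x :: real assume x: "x > 0" and n: "?p x < 0"
    \<comment> \<open>By continuity, one negative value would produce an interval of negative
      values, which has positive length.\<close>
    have "open {y \<in> {0<..}. exit_density_sq y \<in> {..<0}}"
      by (rule continuous_open_preimage[OF exit_density_sq_continuous, unfolded vimage_def Int_def mem_Collect_eq]) auto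
    moreover have "x \<in> {y \<in> {0<..}. exit_density_sq y \<in> {..<0}}" using x n by simp
    ultimately obtain e where e: "e > 0" "ball x e \<subseteq> {y \<in> {0<..}. exit_density_sq y \<in> {..<0}}"
      by (metis openE)
    have "AE y in lborel. y \<notin> {x - e <..< x + e}"
      using AE_nonneg
    proof eventually_elim
      case (elim y)
      show ?case
      proof
        assume "y \<in> {x - e <..< x + e}"
        then have "y \<in> ball x e" by (simp add: dist_real_def abs_less_iff)
        then show False using e(2) elim by auto
      qed
    qed
    then have "emeasure lborel {x - e <..< x + e} = 0"
      by (subst (asm) AE_iff_measurable[of "{x - e <..< x + e}"]) auto
    then show False using e(1) by simp
  qed
  \<comment> \<open>The weight vanishes at 0, so the equality of \<open>A\<close> and
    \<open>B\<close> says nothing about an atom of \<nu> there. Such an atom would bound the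
    transform from below, whereas the transform tends to 0.\<close>
  have nu_pos: "AE x in \<nu>. x > 0"
  proof -
    have "ennreal (measure \<nu> {0}) \<le> ennreal (hit_laplace (sqrt (real n)))" if "n > 0" for n
    proof -
      have "ennreal (measure \<nu> {0}) = (\<integral>\<^sup>+x. indicator {0} x \<partial>\<nu>)" by (simp add: emeasure_eq_measure sets)
      also have "\<dots> \<le> ?L \<nu> n"
        by (intro nn_integral_mono) (auto split: split_indicator)
      finally show ?thesis using that by (simp add: lap)
    qed
    then have "measure \<nu> {0} \<le> hit_laplace (sqrt (real n))" if "n > 0" for n
      using that hit_laplace_nn by (simp add: ennreal_le_iff)
    then have "measure \<nu> {0} \<le> 0"
      by (intro LIMSEQ_le_const[OF tends_0] exI[of _ 1]) auto
    then have "emeasure \<nu> {0} = 0" by (simp add: emeasure_eq_measure measure_le_0_iff)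
    then have "AE x in \<nu>. x \<noteq> 0" by (intro AE_I[of _ _ "{0}"]) (auto simp: sets)
    with nn show ?thesis by eventually_elim auto
  qed
  show "\<nu> = density lborel ?\<delta>"
  proof (rule measure_eqI)
    fix S assume "S \<in> sets \<nu>"
    then have [measurable]: "S \<in> sets borel" by (simp add: sets)
    \<comment> \<open>The weight is positive on the open half-line; dividing by it recovers \<nu>
      from \<open>A1\<close> and the candidate density from \<open>B\<close>.\<close>
    let ?h = "\<lambda>x. ennreal (1 / ?w x) * indicator S x"
    have w: "ennreal (?w x) * ennreal (1 / ?w x) = 1" if "x > 0" for x
      using diff_exp_pos[OF that, of 1] by (simp add: ennreal_mult'[symmetric])
    have "A2 = null_measure lborel"
    proof (rule measure_eqI)
      fix T assume T: "T \<in> sets A2"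
      then have [measurable]: "T \<in> sets borel" by simp
      have "(\<integral>\<^sup>+x. ennreal (?w x * max 0 (- ?p x)) * indicator {0<..} x * indicator T x \<partial>lborel) = 0"
        using pos by (intro nn_integral_zero' AE_I2) (auto split: split_indicator simp: max_def)
      then show "emeasure A2 T = emeasure (null_measure lborel) T" unfolding A2_def by (simp add: emeasure_density)
    qed simp
    then have A2z: "(\<integral>\<^sup>+x. ?h x \<partial>A2) = 0" by simp
    have "emeasure \<nu> S = (\<integral>\<^sup>+x. indicator S x \<partial>\<nu>)" by (simp add: sets)
    also have "\<dots> = (\<integral>\<^sup>+x. ennreal (?w x) * indicator {0<..} x * ?h x \<partial>\<nu>)"
      using nu_pos
    proof (intro nn_integral_cong_AE, eventually_elim)
      case (elim x)
      then show ?case using w[of x] by (simp add: mult.assoc[symmetric])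
    qed
    also have "\<dots> = (\<integral>\<^sup>+x. ?h x \<partial>A1)"
      unfolding A1_def by (rule nn_integral_density[symmetric]) measurable
    also have "\<dots> = (\<integral>\<^sup>+x. ?h x \<partial>A)"
      unfolding A_def by (subst nn_integral_add_measure[OF s21]) (auto simp: A2z)
    also have "\<dots> = (\<integral>\<^sup>+x. ennreal (?w x * max 0 (?p x)) * indicator {0<..} x * ?h x \<partial>lborel)"
      unfolding AB B_def by (rule nn_integral_density) measurable
    also have "\<dots> = (\<integral>\<^sup>+x. ennreal (?p x) * indicator {0<..} x * indicator S x \<partial>lborel)"
    proof (rule nn_integral_cong)
      fix x :: real
      show "ennreal (?w x * max 0 (?p x)) * indicator {0<..} x * ?h x = ennreal (?p x) * indicator {0<..} x * indicator S x"
      proof (cases "x > 0")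
        case True
        have "ennreal (?w x * max 0 (?p x)) * ennreal (1 / ?w x) = ennreal (?w x * max 0 (?p x) * (1 / ?w x))"
          using diff_exp_pos[OF True, of 1] by (intro ennreal_mult'[symmetric]) auto
        also have "?w x * max 0 (?p x) * (1 / ?w x) = ?p x"
          using diff_exp_pos[OF True, of 1] pos True by simp
        finally show ?thesis using True by (simp add: mult.assoc[symmetric])
      qed simp
    qed
    also have "\<dots> = emeasure (density lborel ?\<delta>) S"
      by (simp add: emeasure_density)
    finally show "emeasure \<nu> S = emeasure (density lborel ?\<delta>) S" .
  qed (simp add: sets)
qed

section \<open>First passage of the stable process\<close>

locale stable_process = prob_space M for M :: "'a measure" +
  fixes X :: "real \<Rightarrow> 'a \<Rightarrow> real" and x0 :: real
  assumes stable: "symmetric_stable_process_from (2 / 3) M X x0"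
begin

lemma X_measurable [measurable]: "t \<ge> 0 \<Longrightarrow> X t \<in> borel_measurable M"
  using stable by (simp add: symmetric_stable_process_from_def levy_process_from_def)

lemma X_start: "AE \<omega> in M. X 0 \<omega> = x0"
  using stable by (simp add: symmetric_stable_process_from_def levy_process_from_def)

lemma X_indep: "0 \<le> s 0 \<Longrightarrow> strict_mono_on {..n} s \<Longrightarrow>
    indep_vars (\<lambda>_. borel) (\<lambda>i \<omega>. X (s (Suc i)) \<omega> - X (s i) \<omega>) {..<n}"
  using stable by (simp add: symmetric_stable_process_from_def levy_process_from_def)

lemma X_stationary: "s \<ge> 0 \<Longrightarrow> h \<ge> 0 \<Longrightarrow>
    distr M borel (\<lambda>\<omega>. X (s + h) \<omega> - X s \<omega>) = distr M borel (\<lambda>\<omega>. X h \<omega> - X 0 \<omega>)"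
  using stable by (simp add: symmetric_stable_process_from_def levy_process_from_def)

lemma X_cadlag: "AE \<omega> in M. cadlag_path (\<lambda>t. X t \<omega>)"
  using stable by (simp add: symmetric_stable_process_from_def levy_process_from_def)

lemma X_char: "t \<ge> 0 \<Longrightarrow> char (distr M borel (\<lambda>\<omega>. X t \<omega> - X 0 \<omega>)) z = of_real (exp (- t * \<bar>z\<bar> powr (2 / 3)))"
  using stable by (simp add: symmetric_stable_process_from_def)

text \<open>The summand 1 keeps the grid point strictly to the right of s even when s is itself a
  grid point, so that right-continuity applies along the sequence.\<close>

definition grid :: "nat \<Rightarrow> real \<Rightarrow> real" where
  "grid n s = (real (nat \<lfloor>s * 2 ^ n\<rfloor>) + 1) / 2 ^ n"

lemma grid_gt: "s \<ge> 0 \<Longrightarrow> s < grid n s" and grid_le: "s \<ge> 0 \<Longrightarrow> grid n s \<le> s + 1 / 2 ^ n"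
proof -
  assume s: "s \<ge> 0"
  then have f: "real (nat \<lfloor>s * 2 ^ n\<rfloor>) = of_int \<lfloor>s * 2 ^ n\<rfloor>" by simp
  have "s * 2 ^ n < real (nat \<lfloor>s * 2 ^ n\<rfloor>) + 1" unfolding f by linarith
  then show "s < grid n s" by (simp add: grid_def field_simps)
  have "real (nat \<lfloor>s * 2 ^ n\<rfloor>) + 1 \<le> s * 2 ^ n + 1" unfolding f by linarith
  then show "grid n s \<le> s + 1 / 2 ^ n" by (simp add: grid_def field_simps)
qed

lemma grid_at_right: "s \<ge> 0 \<Longrightarrow> filterlim (\<lambda>n. grid n s) (at_right s) sequentially"
proof -
  assume s: "s \<ge> 0"
  have "(\<lambda>n. grid n s) \<longlonglongrightarrow> s"
  proof (rule tendsto_sandwich)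
    show "(\<lambda>n. s) \<longlonglongrightarrow> s" by simp
    have "(\<lambda>n. s + (1 / 2) ^ n) \<longlonglongrightarrow> s + 0" by (intro tendsto_intros LIMSEQ_realpow_zero) auto
    then show "(\<lambda>n. s + 1 / 2 ^ n) \<longlonglongrightarrow> s" by (simp add: power_one_over)
  qed (use grid_gt[OF s] grid_le[OF s] in \<open>auto intro!: always_eventually less_imp_le\<close>)
  moreover have "grid n s \<in> {s<..} \<and> grid n s \<noteq> s" for n using grid_gt[OF s, of n] by auto
  ultimately show ?thesis by (simp add: filterlim_at)
qed

text \<open>Unlike \<open>X\<close>, this version is jointly measurable in time and \<open>\<omega>\<close>.\<close>

definition Xv :: "real \<Rightarrow> 'a \<Rightarrow> real" where "Xv s \<omega> = lim (\<lambda>n. X (grid n s) \<omega>)"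

text \<open>For fixed n the grid time takes countably many values, so only the measurability of
  \<open>X\<close> at fixed times enters.\<close>

lemma Xv_measurable: "(\<lambda>(s, \<omega>). Xv s \<omega>) \<in> borel_measurable (borel \<Otimes>\<^sub>M M)"
proof -
  have "(\<lambda>p. X (grid n (fst p)) (snd p)) \<in> borel_measurable (borel \<Otimes>\<^sub>M M)" for n
    unfolding grid_def
  proof (rule measurable_compose_countable[where g = "\<lambda>p::real \<times> 'a. nat \<lfloor>fst p * 2 ^ n\<rfloor>"
        and f = "\<lambda>k p. X ((real k + 1) / 2 ^ n) (snd p)"])
    show "(\<lambda>p. X ((real k + 1) / 2 ^ n) (snd p)) \<in> borel_measurable (borel \<Otimes>\<^sub>M M)" for k
      by measurable
    show "(\<lambda>p::real \<times> 'a. nat \<lfloor>fst p * 2 ^ n\<rfloor>) \<in> measurable (borel \<Otimes>\<^sub>M M) (count_space UNIV)"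
      by measurable
  qed
  then have "(\<lambda>p. lim (\<lambda>n. X (grid n (fst p)) (snd p))) \<in> borel_measurable (borel \<Otimes>\<^sub>M M)"
    by (rule borel_measurable_lim_metric)
  then show ?thesis by (simp add: Xv_def case_prod_unfold)
qed

lemma Xv_measurable' [measurable (raw)]:
  "f \<in> borel_measurable N \<Longrightarrow> g \<in> measurable N M \<Longrightarrow> (\<lambda>x. Xv (f x) (g x)) \<in> borel_measurable N"
  using measurable_compose[OF measurable_Pair[of f N borel g M] Xv_measurable] by simp

definition good_path :: "'a \<Rightarrow> bool" where
  "good_path \<omega> \<longleftrightarrow> X 0 \<omega> = x0 \<and> (\<forall>t\<ge>0. continuous (at_right t) (\<lambda>t. X t \<omega>))"

lemma AE_good_path: "AE \<omega> in M. good_path \<omega>"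
  using X_start X_cadlag by eventually_elim (auto simp: good_path_def cadlag_path_def)

lemma good_path_right: "good_path \<omega> \<Longrightarrow> s \<ge> 0 \<Longrightarrow> ((\<lambda>t. X t \<omega>) \<longlongrightarrow> X s \<omega>) (at_right s)"
  by (auto simp: good_path_def continuous_within)

lemma good_path_Xv: "good_path \<omega> \<Longrightarrow> s \<ge> 0 \<Longrightarrow> Xv s \<omega> = X s \<omega>"
  unfolding Xv_def by (intro limI filterlim_compose[OF good_path_right grid_at_right])

lemma char_resolvent:
  assumes q: "q > 0"
  shows "(CLINT p|density lborel (exponential_density q) \<Otimes>\<^sub>M M. iexp (z * (Xv (fst p) (snd p) - x0)))
    = of_real (q / (q + \<bar>z\<bar> powr (2 / 3)))"
proof -
  define E where "E = density lborel (exponential_density q)"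
  interpret E: prob_space E unfolding E_def by (rule prob_space_exponential_density[OF q])
  interpret P: pair_prob_space E M ..
  have [measurable_cong]: "sets E = sets borel" by (simp add: E_def)
  let ?c = "\<bar>z\<bar> powr (2 / 3)"
  have int: "integrable (E \<Otimes>\<^sub>M M) (\<lambda>p. iexp (z * (Xv (fst p) (snd p) - x0)))"
    by (rule P.integrable_const_bound[of _ 1]) (auto simp del: of_real_mult of_real_diff)
  have "(CLINT p|E \<Otimes>\<^sub>M M. iexp (z * (Xv (fst p) (snd p) - x0))) = (CLINT s|E. CLINT \<omega>|M. iexp (z * (Xv s \<omega> - x0)))"
    using P.integral_fst'[OF int] by simp
  also have "\<dots> = (CLINT s|E. of_real (exp (- s * ?c)))"
  proof (rule integral_cong_AE)
    have "AE s in E. s \<ge> 0" unfolding E_def by (auto simp: AE_density exponential_density_def)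
    then show "AE s in E. (CLINT \<omega>|M. iexp (z * (Xv s \<omega> - x0))) = of_real (exp (- s * ?c))"
    proof eventually_elim
      case (elim s)
      have "(CLINT \<omega>|M. iexp (z * (Xv s \<omega> - x0))) = (CLINT \<omega>|M. iexp (z * (X s \<omega> - X 0 \<omega>)))"
      proof (rule integral_cong_AE)
        show "AE \<omega> in M. iexp (z * (Xv s \<omega> - x0)) = iexp (z * (X s \<omega> - X 0 \<omega>))"
          using AE_good_path
        proof eventually_elim
          case g: (elim \<omega>)
          then have "X 0 \<omega> = x0" by (simp add: good_path_def)
          then show ?case by (simp only: good_path_Xv[OF g elim])
        qed
      qed (use elim in measurable)
      also have "\<dots> = char (distr M borel (\<lambda>\<omega>. X s \<omega> - X 0 \<omega>)) z"
        unfolding char_def using elim by (subst integral_distr) auto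
      also have "\<dots> = of_real (exp (- s * ?c))" by (rule X_char[OF elim])
      finally show ?case .
    qed
  qed measurable
  also have "\<dots> = of_real (LINT s|E. exp (- s * ?c))" by (rule integral_complex_of_real)
  also have "(LINT s|E. exp (- s * ?c)) = q / (q + ?c)"
  proof -
    have c: "q + ?c > 0" using q by (intro add_pos_nonneg) auto
    have "(\<integral>\<^sup>+s. ennreal (exp (- s * ?c)) \<partial>E) = (\<integral>\<^sup>+s. ennreal q * (ennreal (exp (- ((q + ?c) * s))) * indicator {0<..} s) \<partial>lborel)"
      unfolding E_def
    proof (subst nn_integral_density)
      show "(\<integral>\<^sup>+s. ennreal (exponential_density q s) * ennreal (exp (- s * ?c)) \<partial>lborel)
        = (\<integral>\<^sup>+s. ennreal q * (ennreal (exp (- ((q + ?c) * s))) * indicator {0<..} s) \<partial>lborel)"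
      proof (rule nn_integral_cong_AE, use AE_lborel_neq[of 0] in eventually_elim)
        case (elim s)
        have "q * exp (- s * q) * exp (- s * ?c) = q * exp (- ((q + ?c) * s))"
          by (simp add: mult.assoc exp_add[symmetric] algebra_simps)
        then show ?case using q elim
          by (auto simp: exponential_density_def ennreal_mult'[symmetric] mult_ac split: split_indicator)
      qed
    qed auto
    also have "\<dots> = ennreal q * ennreal (exp (- ((q + ?c) * 0)) / (q + ?c))"
      by (subst nn_integral_cmult) (auto simp: nn_integral_exp_Ioi[OF c])
    also have "\<dots> = ennreal (q / (q + ?c))" using q c by (subst ennreal_mult'[symmetric]) auto
    finally show ?thesis using q c by (subst integral_eq_nn_integral) auto
  qed
  finally show ?thesis by (simp add: E_def)
qed

text \<open>Comparison of characteristic functions. The scale q powr (- 3 / 2) is forced by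
  |z|^(2/3) / q = |z q powr (- 3 / 2)|^(2/3).\<close>

lemma resolvent_law:
  assumes q: "q > 0"
  shows "distr (density lborel (exponential_density q) \<Otimes>\<^sub>M M) borel (\<lambda>p. Xv (fst p) (snd p) - x0)
    = distr (density lborel resolvent_density) borel (\<lambda>y. q powr (- 3 / 2) * y)"
proof -
  let ?\<rho> = "distr (density lborel resolvent_density) borel (\<lambda>y. q powr (- 3 / 2) * y)"
  define E where "E = density lborel (exponential_density q)"
  interpret E: prob_space E unfolding E_def by (rule prob_space_exponential_density[OF q])
  interpret P: pair_prob_space E M ..
  interpret R: real_distribution "density lborel resolvent_density" by (rule real_distribution_resolvent_density)
  have [measurable_cong]: "sets E = sets borel" by (simp add: E_def)
  show ?thesis unfolding E_def[symmetric]
  proof (rule Levy_uniqueness)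
    show "real_distribution (distr (E \<Otimes>\<^sub>M M) borel (\<lambda>p. Xv (fst p) (snd p) - x0))"
      by (rule P.real_distribution_distr) measurable
    show "real_distribution (?\<rho>)"
      by (rule R.real_distribution_distr) measurable
    show "char (distr (E \<Otimes>\<^sub>M M) borel (\<lambda>p. Xv (fst p) (snd p) - x0)) = char (?\<rho>)"
    proof
      fix z
      have "char (distr (E \<Otimes>\<^sub>M M) borel (\<lambda>p. Xv (fst p) (snd p) - x0)) z = of_real (q / (q + \<bar>z\<bar> powr (2 / 3)))"
        unfolding char_def by (subst integral_distr) (auto simp: char_resolvent[OF q, folded E_def] simp del: of_real_mult of_real_diff)
      also have "q / (q + \<bar>z\<bar> powr (2 / 3)) = 1 / (1 + \<bar>z * q powr (- 3 / 2)\<bar> powr (2 / 3))"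
      proof -
        have "\<bar>z * q powr (- 3 / 2)\<bar> powr (2 / 3) = \<bar>z\<bar> powr (2 / 3) * (q powr (- 3 / 2)) powr (2 / 3)"
          by (simp add: abs_mult powr_mult)
        also have "(q powr (- 3 / 2)) powr (2 / 3) = 1 / q"
          using q by (subst powr_powr) (simp add: powr_minus_divide)
        finally have e: "\<bar>z * q powr (- 3 / 2)\<bar> powr (2 / 3) = \<bar>z\<bar> powr (2 / 3) / q" by simp
        have "q / (q + c) = 1 / (1 + c / q)" if "c \<ge> 0" for c using q that by (simp add: field_simps)
        then show ?thesis unfolding e by simp
      qed
      also have "of_real (1 / (1 + \<bar>z * q powr (- 3 / 2)\<bar> powr (2 / 3))) = char (density lborel resolvent_density) (z * q powr (- 3 / 2))"
        by (rule char_resolvent_density[symmetric])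
      also have "\<dots> = char (?\<rho>) z"
        unfolding char_def by (subst integral_distr) (auto simp: mult.assoc simp del: of_real_mult)
      finally show "char (distr (E \<Otimes>\<^sub>M M) borel (\<lambda>p. Xv (fst p) (snd p) - x0)) z = char (?\<rho>) z" .
    qed
  qed
qed

text \<open>Here y is the position relative to the level. For y at most 0 the value is 1, which is
  applied from the moment of passage on; for the starting point it gives the final answer.\<close>

lemma resolvent_hit:
  assumes q: "q > 0"
  shows "(\<integral>\<^sup>+s. ennreal (q * exp (- (q * s))) * indicator {0<..} s * (\<integral>\<^sup>+\<omega>. renewal_kernel (- (q powr (3 / 2) * (y + (Xv s \<omega> - x0)))) \<partial>M) \<partial>lborel)
    = hit_transform (q powr (3 / 2) * y)"
proof -
  define E where "E = density lborel (exponential_density q)"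
  interpret E: prob_space E unfolding E_def by (rule prob_space_exponential_density[OF q])
  interpret P: pair_prob_space E M ..
  have [measurable_cong]: "sets E = sets borel" by (simp add: E_def)
  define k where "k w = renewal_kernel (- (q powr (3 / 2) * (y + w)))" for w
  have [measurable]: "k \<in> borel_measurable borel" unfolding k_def [abs_def] by measurable
  have "(\<integral>\<^sup>+s. ennreal (q * exp (- (q * s))) * indicator {0<..} s * (\<integral>\<^sup>+\<omega>. k (Xv s \<omega> - x0) \<partial>M) \<partial>lborel)
    = (\<integral>\<^sup>+s. ennreal (exponential_density q s) * (\<integral>\<^sup>+\<omega>. k (Xv s \<omega> - x0) \<partial>M) \<partial>lborel)"
    using AE_lborel_neq[of 0]
  proof (intro nn_integral_cong_AE, eventually_elim)
    case (elim s)
    then show ?case by (auto simp: exponential_density_def mult_ac split: split_indicator)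
  qed
  also have "\<dots> = (\<integral>\<^sup>+s. (\<integral>\<^sup>+\<omega>. k (Xv s \<omega> - x0) \<partial>M) \<partial>E)"
    unfolding E_def by (rule nn_integral_density[symmetric]) measurable
  also have "\<dots> = (\<integral>\<^sup>+p. k (Xv (fst p) (snd p) - x0) \<partial>(E \<Otimes>\<^sub>M M))"
    using nn_integral_fst[of "\<lambda>p. k (Xv (fst p) (snd p) - x0)" E] by simp
  also have "\<dots> = (\<integral>\<^sup>+w. k w \<partial>distr (E \<Otimes>\<^sub>M M) borel (\<lambda>p. Xv (fst p) (snd p) - x0))"
    by (subst nn_integral_distr) auto
  also have "\<dots> = (\<integral>\<^sup>+w. k w \<partial>distr (density lborel resolvent_density) borel (\<lambda>y. q powr (- 3 / 2) * y))"
    unfolding E_def resolvent_law[OF q] ..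
  also have "\<dots> = (\<integral>\<^sup>+w. k (q powr (- 3 / 2) * w) * resolvent_density w \<partial>lborel)"
    by (subst nn_integral_distr) (auto simp: nn_integral_density mult.commute)
  also have "\<dots> = (\<integral>\<^sup>+w. renewal_kernel (- (q powr (3 / 2) * y + w)) * resolvent_density w \<partial>lborel)"
  proof -
    have e: "q powr (3 / 2) * (q powr (- 3 / 2) * w) = w" for w
      using q by (simp add: mult.assoc[symmetric] powr_add[symmetric])
    show ?thesis unfolding k_def distrib_left e ..
  qed
  also have "\<dots> = hit_transform (q powr (3 / 2) * y)" by (rule renewal_kernel_resolvent_density)
  finally show ?thesis unfolding k_def .
qed

end

section \<open>The Markov property at the first grid time below a level\<close>

text \<open>As \<open>c\<close> decreases, the first index with \<open>b\<close> carries the largest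
  value. The supremum no longer mentions which index is first, and this form is monotone under
  refinement of the grid.\<close>

lemma suminf_first_hit:
  fixes c :: "nat \<Rightarrow> ennreal"
  assumes "decseq c"
  shows "(\<Sum>k. if b k \<and> (\<forall>j<k. \<not> b j) then c k else 0) = (SUP j. if b j then c j else 0)"
proof (cases "\<exists>k. b k")
  case True
  define m where "m = (LEAST k. b k)"
  have m: "b m" unfolding m_def using True by (rule LeastI_ex)
  have least: "m \<le> k" if "b k" for k unfolding m_def using that by (rule Least_le)
  have first: "b k \<and> (\<forall>j<k. \<not> b j) \<longleftrightarrow> k = m" for k
    using m least by (metis leD le_neq_implies_less)
  have "(\<Sum>k. if b k \<and> (\<forall>j<k. \<not> b j) then c k else 0) = (\<Sum>k\<in>{m}. if b k \<and> (\<forall>j<k. \<not> b j) then c k else 0)"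
    by (rule suminf_finite) (auto simp: first)
  also have "\<dots> = c m" by (simp add: first)
  also have "c m = (SUP j. if b j then c j else 0)"
  proof (rule antisym)
    show "c m \<le> (SUP j. if b j then c j else 0)" using m by (intro SUP_upper2[of m]) auto
    show "(SUP j. if b j then c j else 0) \<le> c m"
      using least assms by (intro SUP_least) (auto simp: decseq_def)
  qed
  finally show ?thesis .
qed simp

context stable_process
begin

definition first_below :: "real \<Rightarrow> real \<Rightarrow> nat \<Rightarrow> 'a \<Rightarrow> bool" where
  "first_below \<epsilon> h k \<omega> \<longleftrightarrow> X (real k * h) \<omega> < \<epsilon> \<and> (\<forall>j<k. \<not> X (real j * h) \<omega> < \<epsilon>)"

lemma first_below_measurable [measurable]:
  assumes "h > 0"
  shows "Measurable.pred M (first_below \<epsilon> h k)"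
proof -
  have [measurable]: "X (real j * h) \<in> borel_measurable M" for j using assms by (intro X_measurable) simp
  show ?thesis unfolding first_below_def [abs_def] by measurable
qed

text \<open>The event and the value X (k h) are functions of the first k grid increments, and the
  increment over the remaining time s is independent of them.\<close>

lemma markov:
  assumes h: "h > 0" and s: "s > 0" and [measurable]: "G \<in> borel_measurable borel"
  shows "(\<integral>\<^sup>+\<omega>. (if first_below \<epsilon> h k \<omega> then G (X (real k * h + s) \<omega>) else 0) \<partial>M)
    = (\<integral>\<^sup>+\<omega>. (if first_below \<epsilon> h k \<omega> then (\<integral>\<^sup>+\<omega>'. G (X (real k * h) \<omega> + (X s \<omega>' - X 0 \<omega>')) \<partial>M) else 0) \<partial>M)"
proof -
  \<comment> \<open>The grid up to index k, followed by one last step of length s instead of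
    h.\<close>
  define S where "S i = (if i \<le> k then real i * h else real k * h + s)" for i
  have S0: "S i \<ge> 0" for i using h s by (auto simp: S_def)
  have [measurable]: "X (S i) \<in> borel_measurable M" for i by (rule X_measurable[OF S0])
  have [measurable]: "X (real j * h) \<in> borel_measurable M" "X (real j * h + s) \<in> borel_measurable M" "X s \<in> borel_measurable M" "X 0 \<in> borel_measurable M" for j
    using h s by (auto intro!: X_measurable)
  define Z where "Z i \<omega> = X (S (Suc i)) \<omega> - X (S i) \<omega>" for i \<omega>
  have Zm [measurable]: "Z i \<in> borel_measurable M" for i unfolding Z_def [abs_def] by measurable
  have mono: "strict_mono_on {..Suc k} S"
  proof (rule strict_mono_onI)
    fix i j assume ij: "i \<in> {..Suc k}" "j \<in> {..Suc k}" "i < j"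
    have "real i * h < real j * h" using ij h by simp
    moreover have "real i * h \<le> real k * h" using ij h by (intro mult_right_mono) auto
    ultimately show "S i < S j" using ij s by (auto simp: S_def)
  qed
  have ind: "indep_vars (\<lambda>_. borel) Z {..<Suc k}"
    using X_indep[OF S0 mono] by (simp add: Z_def [abs_def])
  let ?P = "PiM {..<k} (\<lambda>_. borel :: real measure)"
  define D where "D \<omega> = restrict (\<lambda>i. Z i \<omega>) {..<k}" for \<omega>
  let ?Q = "PiM {k} (\<lambda>_. borel :: real measure)"
  define W where "W \<omega> = restrict (\<lambda>i. Z i \<omega>) {k}" for \<omega>
  have indD: "indep_var ?P D ?Q W"
    unfolding D_def [abs_def] W_def [abs_def] by (rule indep_var_restrict[OF ind]) auto
  have Dm [measurable]: "D \<in> measurable M ?P" and Wm [measurable]: "W \<in> measurable M ?Q"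
    using indD by (rule indep_var_rv1, rule indep_var_rv2)
  have Wk: "W \<omega> k = Z k \<omega>" for \<omega> by (simp add: W_def)
  \<comment> \<open>This rebuilds X (j h) from the increments. Writing \<open>min j k\<close> keeps
    all indices within the k coordinates of the product space, so that measurability holds for every
    j.\<close>
  define pos where "pos d j = x0 + (\<Sum>i<min j k. d i)" for d :: "nat \<Rightarrow> real" and j
  have pm [measurable]: "(\<lambda>d. pos d j) \<in> borel_measurable ?P" for j
    unfolding pos_def by (intro borel_measurable_add borel_measurable_const borel_measurable_sum) (auto intro!: measurable_component_singleton)
  define ev where "ev d \<longleftrightarrow> pos d k < \<epsilon> \<and> (\<forall>j<k. \<not> pos d j < \<epsilon>)" for d
  have [measurable]: "Measurable.pred ?P ev" unfolding ev_def [abs_def] by measurable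
  have pos_eq: "X (real j * h) \<omega> = pos (D \<omega>) j" if "good_path \<omega>" "j \<le> k" for \<omega> j
  proof -
    have "pos (D \<omega>) j = x0 + (\<Sum>i<j. X (S (Suc i)) \<omega> - X (S i) \<omega>)"
      using that by (simp add: pos_def D_def Z_def min_def)
    also have "\<dots> = x0 + (X (S j) \<omega> - X (S 0) \<omega>)" using sum_lessThan_telescope[of "\<lambda>i. X (S i) \<omega>" j] by (simp only:)
    also have "\<dots> = X (real j * h) \<omega>" using that by (simp add: S_def good_path_def)
    finally show ?thesis ..
  qed
  have hit_eq: "first_below \<epsilon> h k \<omega> \<longleftrightarrow> ev (D \<omega>)" if "good_path \<omega>" for \<omega>
    using pos_eq[OF that] by (auto simp: first_below_def ev_def)
  have end_eq: "X (real k * h + s) \<omega> = pos (D \<omega>) k + Z k \<omega>" if "good_path \<omega>" for \<omega>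
    using pos_eq[OF that, of k] by (simp add: Z_def S_def)
  \<comment> \<open>By stationarity the last increment may be replaced by an increment from time
    0.\<close>
  have stat: "distr M borel (Z k) = distr M borel (\<lambda>\<omega>. X s \<omega> - X 0 \<omega>)"
    using X_stationary[of "real k * h" s] h s by (simp add: Z_def [abs_def] S_def)
  define F where "F p = (if ev (fst p) then G (pos (fst p) k + snd p k) else 0)" for p :: "(nat \<Rightarrow> real) \<times> (nat \<Rightarrow> real)"
  have [measurable]: "(\<lambda>w. w k) \<in> borel_measurable ?Q" by (intro measurable_component_singleton) simp
  have [measurable]: "F \<in> borel_measurable (?P \<Otimes>\<^sub>M ?Q)" unfolding F_def [abs_def] by measurable
  interpret W: prob_space "distr M ?Q W" by (rule prob_space_distr) measurable
  have "(\<integral>\<^sup>+\<omega>. (if first_below \<epsilon> h k \<omega> then G (X (real k * h + s) \<omega>) else 0) \<partial>M) = (\<integral>\<^sup>+\<omega>. F (D \<omega>, W \<omega>) \<partial>M)"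
    using AE_good_path by (intro nn_integral_cong_AE) (auto elim!: eventually_mono simp: F_def hit_eq end_eq Wk)
  also have "\<dots> = (\<integral>\<^sup>+p. F p \<partial>distr M (?P \<Otimes>\<^sub>M ?Q) (\<lambda>\<omega>. (D \<omega>, W \<omega>)))"
    by (subst nn_integral_distr) auto
  also have "\<dots> = (\<integral>\<^sup>+p. F p \<partial>(distr M ?P D \<Otimes>\<^sub>M distr M ?Q W))"
    using indD unfolding indep_var_distribution_eq by simp
  also have "\<dots> = (\<integral>\<^sup>+d. \<integral>\<^sup>+w. F (d, w) \<partial>distr M ?Q W \<partial>distr M ?P D)"
    by (rule W.nn_integral_fst[symmetric]) (simp cong: measurable_cong_sets)
  also have "\<dots> = (\<integral>\<^sup>+d. \<integral>\<^sup>+\<omega>'. F (d, W \<omega>') \<partial>M \<partial>distr M ?P D)"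
    by (rule nn_integral_cong) (subst nn_integral_distr, auto)
  also have "\<dots> = (\<integral>\<^sup>+\<omega>. \<integral>\<^sup>+\<omega>'. F (D \<omega>, W \<omega>') \<partial>M \<partial>M)"
    by (subst nn_integral_distr) auto
  also have "\<dots> = (\<integral>\<^sup>+\<omega>. (if first_below \<epsilon> h k \<omega> then (\<integral>\<^sup>+\<omega>'. G (X (real k * h) \<omega> + (X s \<omega>' - X 0 \<omega>')) \<partial>M) else 0) \<partial>M)"
  proof (rule nn_integral_cong_AE, use AE_good_path in eventually_elim)
    case (elim \<omega>)
    have "(\<integral>\<^sup>+\<omega>'. G (pos (D \<omega>) k + Z k \<omega>') \<partial>M) = (\<integral>\<^sup>+y. G (pos (D \<omega>) k + y) \<partial>distr M borel (Z k))"
      by (subst nn_integral_distr) auto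
    also have "\<dots> = (\<integral>\<^sup>+\<omega>'. G (pos (D \<omega>) k + (X s \<omega>' - X 0 \<omega>')) \<partial>M)"
      unfolding stat by (subst nn_integral_distr) auto
    finally show ?case by (simp add: F_def hit_eq[OF elim] pos_eq[OF elim] Wk)
  qed
  finally show ?thesis .
qed

text \<open>Here y is the position relative to the level, scaled as in \<open>resolvent_law\<close>.
  Only times at which the path is strictly below the level contribute, as
  \<open>renewal_kernel\<close> vanishes on the nonpositive half-line.\<close>

definition potential_rate :: "real \<Rightarrow> real \<Rightarrow> ennreal" where
  "potential_rate q y = renewal_kernel (- (q powr (3 / 2) * y))"

lemma potential_rate_measurable [measurable]: "potential_rate q \<in> borel_measurable borel"
  unfolding potential_rate_def [abs_def] by measurable

text \<open>On this event the process sits strictly below \<epsilon> at time k h. Whatever the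
  overshoot, the expected discounted integral from there on is 1 by \<open>resolvent_hit\<close>, up
  to the discount already accumulated.\<close>

lemma expected_discount_step:
  assumes q: "q > 0" and h: "h > 0"
  shows "(\<integral>\<^sup>+\<omega>. (if first_below \<epsilon> h k \<omega> then ennreal (exp (- (q * (real k * h)))) else 0) \<partial>M)
   = (\<integral>\<^sup>+\<omega>. \<integral>\<^sup>+r. (if first_below \<epsilon> h k \<omega> then ennreal (q * exp (- (q * r))) * indicator {real k * h<..} r * potential_rate q (Xv r \<omega> - \<epsilon>) else 0) \<partial>lborel \<partial>M)"
proof -
  let ?t = "real k * h" and ?b = "first_below \<epsilon> h k"
  let ?g = "potential_rate q"
  let ?J = "\<lambda>s \<omega>. \<integral>\<^sup>+\<omega>'. ?g ((X ?t \<omega> - \<epsilon>) + (Xv s \<omega>' - x0)) \<partial>M"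
  let ?K = "\<lambda>s \<omega>. if ?b \<omega> then ?J s \<omega> else 0"
  let ?H = "\<lambda>s \<omega>. if ?b \<omega> then ?g (Xv (?t + s) \<omega> - \<epsilon>) else 0"
  let ?F = "\<lambda>\<omega> r. if ?b \<omega> then ennreal (q * exp (- (q * r))) * indicator {?t<..} r * ?g (Xv r \<omega> - \<epsilon>) else 0"
  interpret P: pair_sigma_finite lborel M ..
  let ?e = "ennreal (exp (- (q * (?t))))"
  let ?\<kappa> = "\<lambda>s. ennreal (q * exp (- (q * s))) * indicator {0<..} s"
  note [measurable] = first_below_measurable[OF h]
  have [measurable]: "X (real j * h) \<in> borel_measurable M" for j using h by (intro X_measurable) simp
  have "(\<integral>\<^sup>+\<omega>. \<integral>\<^sup>+r. ?F \<omega> r \<partial>lborel \<partial>M)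
    = (\<integral>\<^sup>+\<omega>. \<integral>\<^sup>+s. ?e * ?\<kappa> s * ?H s \<omega> \<partial>lborel \<partial>M)"
  proof (rule nn_integral_cong)
    fix \<omega> assume "\<omega> \<in> space M"
    then have [measurable]: "(\<lambda>r. Xv r \<omega>) \<in> borel_measurable borel" by measurable
    have "(\<integral>\<^sup>+r. ?F \<omega> r \<partial>lborel)
      = (\<integral>\<^sup>+s. (if ?b \<omega> then ennreal (q * exp (- (q * (s + ?t)))) * indicator {?t<..} (s + ?t) * ?g (Xv (s + ?t) \<omega> - \<epsilon>) else 0) \<partial>lborel)"
      by (rule nn_integral_shift) measurable
    also have "\<dots> = (\<integral>\<^sup>+s. ?e * ?\<kappa> s * ?H s \<omega> \<partial>lborel)"
    proof (rule nn_integral_cong)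
      fix s :: real
      have "q * exp (- (q * (s + ?t))) = exp (- (q * (?t))) * (q * exp (- (q * s)))"
        by (simp add: exp_add[symmetric] distrib_left mult.commute mult.left_commute)
      then have "ennreal (q * exp (- (q * (s + ?t)))) = ennreal (exp (- (q * (?t))) * (q * exp (- (q * s))))"
        by (simp only:)
      also have "\<dots> = ?e * ennreal (q * exp (- (q * s)))" by (rule ennreal_mult') simp
      finally have "ennreal (q * exp (- (q * (s + ?t)))) = ?e * ennreal (q * exp (- (q * s)))" .
      then show "(if ?b \<omega> then ennreal (q * exp (- (q * (s + ?t)))) * indicator {?t<..} (s + ?t) * ?g (Xv (s + ?t) \<omega> - \<epsilon>) else 0)
        = ?e * ?\<kappa> s * ?H s \<omega>"
        by (simp add: add.commute mult.assoc split: split_indicator)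
    qed
    finally show "(\<integral>\<^sup>+r. ?F \<omega> r \<partial>lborel) = \<dots>" .
  qed
  \<comment> \<open>\<open>markov\<close> speaks of a fixed elapsed time s, so the order of
    integration is exchanged here and restored after its use.\<close>
  also have "\<dots> = (\<integral>\<^sup>+s. \<integral>\<^sup>+\<omega>. ?e * ?\<kappa> s * ?H s \<omega> \<partial>M \<partial>lborel)"
    by (rule P.Fubini'[where f = "\<lambda>s \<omega>. ?e * ?\<kappa> s * ?H s \<omega>"]) measurable
  also have "\<dots> = (\<integral>\<^sup>+s. \<integral>\<^sup>+\<omega>. ?e * ?\<kappa> s * ?K s \<omega> \<partial>M \<partial>lborel)"
  proof (rule nn_integral_cong)
    fix s :: real
    show "(\<integral>\<^sup>+\<omega>. ?e * ?\<kappa> s * ?H s \<omega> \<partial>M)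
      = (\<integral>\<^sup>+\<omega>. ?e * ?\<kappa> s * ?K s \<omega> \<partial>M)"
    proof (cases "s > 0")
      case s: True
      have "(\<integral>\<^sup>+\<omega>. ?H s \<omega> \<partial>M)
        = (\<integral>\<^sup>+\<omega>. (if ?b \<omega> then ?g (X (?t + s) \<omega> - \<epsilon>) else 0) \<partial>M)"
        using AE_good_path s h by (intro nn_integral_cong_AE) (auto elim!: eventually_mono simp: good_path_Xv)
      also have "\<dots> = (\<integral>\<^sup>+\<omega>. (if ?b \<omega> then (\<integral>\<^sup>+\<omega>'. ?g (X (?t) \<omega> + (X s \<omega>' - X 0 \<omega>') - \<epsilon>) \<partial>M) else 0) \<partial>M)"
        by (rule markov[OF h s, of "\<lambda>x. ?g (x - \<epsilon>)"]) measurable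
      also have "\<dots> = (\<integral>\<^sup>+\<omega>. ?K s \<omega> \<partial>M)"
      proof (rule nn_integral_cong)
        fix \<omega>
        have e: "(\<integral>\<^sup>+\<omega>'. ?g (X (?t) \<omega> + (X s \<omega>' - X 0 \<omega>') - \<epsilon>) \<partial>M) = ?J s \<omega>"
        proof (rule nn_integral_cong_AE, use AE_good_path in eventually_elim)
          case (elim \<omega>')
          have "X 0 \<omega>' = x0" using elim by (simp add: good_path_def)
          then show ?case using s by (simp add: good_path_Xv[OF elim] algebra_simps)
        qed
        show "(if ?b \<omega> then (\<integral>\<^sup>+\<omega>'. ?g (X (?t) \<omega> + (X s \<omega>' - X 0 \<omega>') - \<epsilon>) \<partial>M) else 0)
          = ?K s \<omega>"
          by (simp only: e)
      qed
      finally show ?thesis by (simp add: nn_integral_cmult)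
    qed simp
  qed
  also have "\<dots> = (\<integral>\<^sup>+\<omega>. \<integral>\<^sup>+s. ?e * ?\<kappa> s * ?K s \<omega> \<partial>lborel \<partial>M)"
    by (rule P.Fubini'[where f = "\<lambda>s \<omega>. ?e * ?\<kappa> s * ?K s \<omega>", symmetric]) measurable
  also have "\<dots> = (\<integral>\<^sup>+\<omega>. (if ?b \<omega> then ?e else 0) \<partial>M)"
  proof (rule nn_integral_cong)
    fix \<omega>
    show "(\<integral>\<^sup>+s. ?e * ?\<kappa> s * ?K s \<omega> \<partial>lborel) = (if ?b \<omega> then ?e else 0)"
    proof (cases "?b \<omega>")
      case True
      then have "X (?t) \<omega> - \<epsilon> < 0" by (simp add: first_below_def)
      then have "q powr (3 / 2) * (X (?t) \<omega> - \<epsilon>) \<le> 0" using q by (intro mult_nonneg_nonpos) auto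
      then have 1: "hit_transform (q powr (3 / 2) * (X (?t) \<omega> - \<epsilon>)) = 1" by (simp add: hit_transform_def)
      have "(\<integral>\<^sup>+s. ?e * ?\<kappa> s * ?J s \<omega> \<partial>lborel)
        = ?e * (\<integral>\<^sup>+s. ?\<kappa> s * ?J s \<omega> \<partial>lborel)"
        unfolding mult.assoc by (rule nn_integral_cmult) measurable
      also have "\<dots> = ?e" unfolding potential_rate_def resolvent_hit[OF q] 1 by simp
      finally show ?thesis using True by simp
    qed simp
  qed
  finally show ?thesis ..
qed

section \<open>Refinement of the grid\<close>

text \<open>By \<open>suminf_first_hit\<close> this is the discount at the first time of the n-th
  dyadic grid at which the path is below \<epsilon>, and 0 if there is no such time.\<close>

definition hit_discount :: "real \<Rightarrow> real \<Rightarrow> nat \<Rightarrow> 'a \<Rightarrow> ennreal" where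
  "hit_discount q \<epsilon> n \<omega> = (SUP j. if X (real j * (1 / 2 ^ n)) \<omega> < \<epsilon> then ennreal (exp (- (q * (real j * (1 / 2 ^ n))))) else 0)"

text \<open>In the same way, the indicator that the first such grid time lies strictly before
  r.\<close>

definition hit_before :: "real \<Rightarrow> nat \<Rightarrow> real \<Rightarrow> 'a \<Rightarrow> ennreal" where
  "hit_before \<epsilon> n r \<omega> = (SUP j. if X (real j * (1 / 2 ^ n)) \<omega> < \<epsilon> then indicator {real j * (1 / 2 ^ n)<..} r else 0)"

lemma dyadic_refine: "real j * (1 / 2 ^ n) = real (2 * j) * (1 / 2 ^ Suc n)"
  by simp

lemma hit_discount_incseq: "incseq (\<lambda>n. hit_discount q \<epsilon> n \<omega>)"
proof (rule incseq_SucI)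
  fix n
  show "hit_discount q \<epsilon> n \<omega> \<le> hit_discount q \<epsilon> (Suc n) \<omega>"
    unfolding hit_discount_def
  proof (rule SUP_mono)
    fix j
    show "\<exists>i\<in>UNIV. (if X (real j * (1 / 2 ^ n)) \<omega> < \<epsilon> then ennreal (exp (- (q * (real j * (1 / 2 ^ n))))) else 0)
      \<le> (if X (real i * (1 / 2 ^ Suc n)) \<omega> < \<epsilon> then ennreal (exp (- (q * (real i * (1 / 2 ^ Suc n))))) else 0)"
      by (rule bexI[of _ "2 * j"]) (simp_all only: dyadic_refine[symmetric] UNIV_I order.refl)
  qed
qed

lemma hit_before_incseq: "incseq (\<lambda>n. hit_before \<epsilon> n r \<omega>)"
proof (rule incseq_SucI)
  fix n
  show "hit_before \<epsilon> n r \<omega> \<le> hit_before \<epsilon> (Suc n) r \<omega>"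
    unfolding hit_before_def
  proof (rule SUP_mono)
    fix j
    show "\<exists>i\<in>UNIV. (if X (real j * (1 / 2 ^ n)) \<omega> < \<epsilon> then indicator {real j * (1 / 2 ^ n)<..} r else (0 :: ennreal))
      \<le> (if X (real i * (1 / 2 ^ Suc n)) \<omega> < \<epsilon> then indicator {real i * (1 / 2 ^ Suc n)<..} r else 0)"
      by (rule bexI[of _ "2 * j"]) (simp_all only: dyadic_refine[symmetric] UNIV_I order.refl)
  qed
qed

lemma X_dyadic_measurable [measurable]: "X (real j * (1 / 2 ^ n)) \<in> borel_measurable M"
  by (rule X_measurable) simp

lemma hit_discount_measurable [measurable]: "hit_discount q \<epsilon> n \<in> borel_measurable M"
  unfolding hit_discount_def [abs_def] by (intro borel_measurable_SUP) measurable

lemma hit_before_measurable [measurable]: "(\<lambda>(r, \<omega>). hit_before \<epsilon> n r \<omega>) \<in> borel_measurable (lborel \<Otimes>\<^sub>M M)"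
proof -
  have "(\<lambda>(r, \<omega>). if X (real j * (1 / 2 ^ n)) \<omega> < \<epsilon> then indicator {real j * (1 / 2 ^ n)<..} r else (0 :: ennreal)) \<in> borel_measurable (lborel \<Otimes>\<^sub>M M)" for j
  proof -
    define d :: real where "d = real j * (1 / 2 ^ n)"
    have [measurable]: "X d \<in> borel_measurable M" unfolding d_def by measurable
    show ?thesis unfolding d_def[symmetric] by measurable
  qed
  then show ?thesis unfolding hit_before_def case_prod_beta by (intro borel_measurable_SUP) auto
qed

text \<open>\<open>expected_discount_step\<close> summed over the index of first passage; the
  indicators of the disjoint events add up to \<open>hit_before\<close>.\<close>

lemma expected_hit_discount_grid:
  assumes q: "q > 0"
  shows "(\<integral>\<^sup>+\<omega>. hit_discount q \<epsilon> n \<omega> \<partial>M)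
   = (\<integral>\<^sup>+\<omega>. \<integral>\<^sup>+r. ennreal (q * exp (- (q * r))) * indicator {0<..} r * potential_rate q (Xv r \<omega> - \<epsilon>) * hit_before \<epsilon> n r \<omega> \<partial>lborel \<partial>M)"
proof -
  define h :: real where "h = 1 / 2 ^ n"
  have h: "h > 0" by (simp add: h_def)
  let ?F = "\<lambda>k r \<omega>. if first_below \<epsilon> h k \<omega> then ennreal (q * exp (- (q * r))) * indicator {real k * h<..} r * potential_rate q (Xv r \<omega> - \<epsilon>) else 0"
  let ?G = "\<lambda>r \<omega>. ennreal (q * exp (- (q * r))) * indicator {0<..} r * potential_rate q (Xv r \<omega> - \<epsilon>)"
  note [measurable] = first_below_measurable[OF h]
  have dec1: "decseq (\<lambda>k. ennreal (exp (- (q * (real k * h)))))"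
    using q h by (auto simp: decseq_def intro!: ennreal_leI mult_left_mono mult_right_mono)
  have dec2: "decseq (\<lambda>k. indicator {real k * h<..} r :: ennreal)" for r
  proof (rule decseq_SucI)
    fix k
    have "real k * h \<le> real (Suc k) * h" using h by (intro mult_right_mono) auto
    then show "indicator {real (Suc k) * h<..} r \<le> (indicator {real k * h<..} r :: ennreal)"
      by (auto split: split_indicator)
  qed
  have "(\<integral>\<^sup>+\<omega>. hit_discount q \<epsilon> n \<omega> \<partial>M) = (\<integral>\<^sup>+\<omega>. (\<Sum>k. if first_below \<epsilon> h k \<omega> then ennreal (exp (- (q * (real k * h)))) else 0) \<partial>M)"
    unfolding hit_discount_def h_def[symmetric] suminf_first_hit[OF dec1, symmetric] first_below_def ..
  also have "\<dots> = (\<Sum>k. \<integral>\<^sup>+\<omega>. (if first_below \<epsilon> h k \<omega> then ennreal (exp (- (q * (real k * h)))) else 0) \<partial>M)"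
    by (rule nn_integral_suminf) measurable
  also have "\<dots> = (\<Sum>k. \<integral>\<^sup>+\<omega>. \<integral>\<^sup>+r. ?F k r \<omega> \<partial>lborel \<partial>M)"
    unfolding expected_discount_step[OF q h] ..
  also have "\<dots> = (\<integral>\<^sup>+\<omega>. (\<Sum>k. \<integral>\<^sup>+r. ?F k r \<omega> \<partial>lborel) \<partial>M)"
    by (rule nn_integral_suminf[symmetric]) measurable
  also have "\<dots> = (\<integral>\<^sup>+\<omega>. \<integral>\<^sup>+r. (\<Sum>k. ?F k r \<omega>) \<partial>lborel \<partial>M)"
  proof (rule nn_integral_cong)
    fix \<omega> assume "\<omega> \<in> space M"
    then have [measurable]: "(\<lambda>r. Xv r \<omega>) \<in> borel_measurable borel" by measurable
    show "(\<Sum>k. \<integral>\<^sup>+r. ?F k r \<omega> \<partial>lborel)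
      = (\<integral>\<^sup>+r. (\<Sum>k. ?F k r \<omega>) \<partial>lborel)"
      by (rule nn_integral_suminf[symmetric]) measurable
  qed
  also have "\<dots> = (\<integral>\<^sup>+\<omega>. \<integral>\<^sup>+r. ?G r \<omega> * hit_before \<epsilon> n r \<omega> \<partial>lborel \<partial>M)"
  proof (intro nn_integral_cong)
    fix \<omega> r
    have "(\<Sum>k. ?F k r \<omega>)
      = (\<Sum>k. ?G r \<omega> * (if first_below \<epsilon> h k \<omega> then indicator {real k * h<..} r else 0))"
    proof (rule suminf_cong)
      fix k
      show "?F k r \<omega>
        = ?G r \<omega> * (if first_below \<epsilon> h k \<omega> then indicator {real k * h<..} r else 0)"
      proof (cases "real k * h < r")
        case True
        moreover have "0 \<le> real k * h" using h by simp
        ultimately have "0 < r" by linarith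
        with True show ?thesis by simp
      qed simp
    qed
    also have "\<dots> = ?G r \<omega> * (\<Sum>k. if first_below \<epsilon> h k \<omega> then indicator {real k * h<..} r else 0)"
      by (rule ennreal_suminf_cmult)
    also have "(\<Sum>k. if first_below \<epsilon> h k \<omega> then indicator {real k * h<..} r else 0) = hit_before \<epsilon> n r \<omega>"
      unfolding hit_before_def h_def[symmetric] suminf_first_hit[OF dec2, symmetric] first_below_def ..
    finally show "(\<Sum>k. ?F k r \<omega>)
      = ?G r \<omega> * hit_before \<epsilon> n r \<omega>" .
  qed
  finally show ?thesis .
qed

lemma good_path_grid_below:
  assumes "good_path \<omega>" "s \<ge> 0" "X s \<omega> < \<epsilon>"
  shows "\<forall>\<^sub>F n in sequentially. X (grid n s) \<omega> < \<epsilon>"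
  using filterlim_compose[OF good_path_right[OF assms(1,2)] grid_at_right[OF assms(2)]] assms(3) by (rule order_tendstoD(2))

lemma grid_tendsto: "s \<ge> 0 \<Longrightarrow> (\<lambda>n. grid n s) \<longlonglongrightarrow> s"
  using grid_at_right[of s] by (simp add: filterlim_at)

lemma grid_dyadic: "grid n s = real (nat \<lfloor>s * 2 ^ n\<rfloor> + 1) * (1 / 2 ^ n)"
  by (simp add: grid_def)

text \<open>A right-continuous path below \<open>\<epsilon>\<close> at two times \<open>r' < r\<close> is below \<open>\<epsilon>\<close> at a dyadic time
  before \<open>r\<close>, so at most one \<open>r\<close> is exceptional.\<close>

lemma AE_hit_before:
  assumes g: "good_path \<omega>"
  shows "AE r in lborel. r > 0 \<longrightarrow> X r \<omega> < \<epsilon> \<longrightarrow> (SUP n. hit_before \<epsilon> n r \<omega>) = 1"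
proof -
  let ?B = "{r. r > 0 \<and> X r \<omega> < \<epsilon> \<and> (SUP n. hit_before \<epsilon> n r \<omega>) \<noteq> 1}"
  have le1: "(SUP n. hit_before \<epsilon> n r \<omega>) \<le> 1" for r
    unfolding hit_before_def by (intro SUP_least) (auto split: split_indicator)
  have *: "(SUP n. hit_before \<epsilon> n r \<omega>) = 1" if r: "0 < r'" "r' < r" "X r' \<omega> < \<epsilon>" for r r'
  proof -
    have "\<forall>\<^sub>F n in sequentially. grid n r' < r"
      using grid_tendsto[of r'] r by (intro order_tendstoD(2)) auto
    then have "\<forall>\<^sub>F n in sequentially. grid n r' < r \<and> X (grid n r') \<omega> < \<epsilon>"
      using good_path_grid_below[OF g less_imp_le[OF r(1)] r(3)] by (rule eventually_conj)
    then obtain n where n: "grid n r' < r" "X (grid n r') \<omega> < \<epsilon>"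
      using eventually_happens'[OF sequentially_bot] by blast
    define j where "j = nat \<lfloor>r' * 2 ^ n\<rfloor> + 1"
    have j: "grid n r' = real j * (1 / 2 ^ n)" unfolding j_def by (rule grid_dyadic)
    have "1 \<le> hit_before \<epsilon> n r \<omega>"
      unfolding hit_before_def by (rule SUP_upper2[of j]) (use n j in auto)
    also have "\<dots> \<le> (SUP n. hit_before \<epsilon> n r \<omega>)" by (rule SUP_upper) simp
    finally show ?thesis using le1[of r] by (rule antisym[rotated])
  qed
  have "?B \<subseteq> {r} " if "r \<in> ?B" for r
  proof
    fix r' assume r': "r' \<in> ?B"
    show "r' \<in> {r}"
      using *[of r r'] *[of r' r] that r' by (cases r r' rule: linorder_cases) auto
  qed
  then obtain c where "?B \<subseteq> {c}" by (cases "?B = {}") auto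
  then show ?thesis
    using AE_lborel_neq[of c] by (auto elim!: eventually_mono)
qed

lemma expected_hit_discount:
  assumes q: "q > 0"
  shows "(\<integral>\<^sup>+\<omega>. (SUP n. hit_discount q \<epsilon> n \<omega>) \<partial>M) = hit_transform (q powr (3 / 2) * (x0 - \<epsilon>))"
proof -
  interpret P: pair_sigma_finite lborel M ..
  let ?g = "\<lambda>r \<omega>. ennreal (q * exp (- (q * r))) * indicator {0<..} r * potential_rate q (Xv r \<omega> - \<epsilon>)"
  have "(\<integral>\<^sup>+\<omega>. (SUP n. hit_discount q \<epsilon> n \<omega>) \<partial>M) = (SUP n. \<integral>\<^sup>+\<omega>. hit_discount q \<epsilon> n \<omega> \<partial>M)"
    using hit_discount_incseq by (intro nn_integral_monotone_convergence_SUP) (auto simp: incseq_def le_fun_def)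
  also have "\<dots> = (SUP n. \<integral>\<^sup>+\<omega>. \<integral>\<^sup>+r. ?g r \<omega> * hit_before \<epsilon> n r \<omega> \<partial>lborel \<partial>M)"
    unfolding expected_hit_discount_grid[OF q] ..
  also have "\<dots> = (\<integral>\<^sup>+\<omega>. (SUP n. \<integral>\<^sup>+r. ?g r \<omega> * hit_before \<epsilon> n r \<omega> \<partial>lborel) \<partial>M)"
    using hit_before_incseq
    by (intro nn_integral_monotone_convergence_SUP[symmetric])
       (auto simp: incseq_def le_fun_def intro!: nn_integral_mono mult_left_mono)
  also have "\<dots> = (\<integral>\<^sup>+\<omega>. \<integral>\<^sup>+r. (SUP n. ?g r \<omega> * hit_before \<epsilon> n r \<omega>) \<partial>lborel \<partial>M)"
  proof (rule nn_integral_cong)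
    fix \<omega> assume w: "\<omega> \<in> space M"
    then have [measurable]: "(\<lambda>r. Xv r \<omega>) \<in> borel_measurable borel" by measurable
    have [measurable]: "(\<lambda>r. hit_before \<epsilon> n r \<omega>) \<in> borel_measurable borel" for n
      unfolding hit_before_def by measurable
    show "(SUP n. \<integral>\<^sup>+r. ?g r \<omega> * hit_before \<epsilon> n r \<omega> \<partial>lborel) = (\<integral>\<^sup>+r. (SUP n. ?g r \<omega> * hit_before \<epsilon> n r \<omega>) \<partial>lborel)"
      using hit_before_incseq
      by (intro nn_integral_monotone_convergence_SUP[symmetric])
         (auto simp: incseq_def le_fun_def intro!: mult_left_mono)
  qed
  also have "\<dots> = (\<integral>\<^sup>+\<omega>. \<integral>\<^sup>+r. ?g r \<omega> \<partial>lborel \<partial>M)"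
  proof (rule nn_integral_cong_AE, use AE_good_path in eventually_elim)
    case g: (elim \<omega>)
    show ?case
    proof (rule nn_integral_cong_AE, use AE_hit_before[OF g, of \<epsilon>] in eventually_elim)
      case (elim r)
      have "(SUP n. ?g r \<omega> * hit_before \<epsilon> n r \<omega>) = ?g r \<omega> * (SUP n. hit_before \<epsilon> n r \<omega>)"
        by (rule SUP_mult_left_ennreal[symmetric])
      moreover have "?g r \<omega> * (SUP n. hit_before \<epsilon> n r \<omega>) = ?g r \<omega>"
      proof (cases "r > 0 \<and> X r \<omega> < \<epsilon>")
        case True
        then show ?thesis using elim by simp
      next
        case False
        have "?g r \<omega> = 0"
        proof (cases "r > 0")
          case r: True
          then have "Xv r \<omega> - \<epsilon> \<ge> 0" using False by (simp add: good_path_Xv[OF g])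
          then have "0 \<le> q powr (3 / 2) * (Xv r \<omega> - \<epsilon>)" by simp
          then show ?thesis by (simp add: potential_rate_def renewal_kernel_def)
        qed simp
        then show ?thesis by (simp only: mult_zero_left)
      qed
      ultimately show ?case by simp
    qed
  qed
  also have "\<dots> = (\<integral>\<^sup>+r. \<integral>\<^sup>+\<omega>. ?g r \<omega> \<partial>M \<partial>lborel)"
    by (rule P.Fubini') measurable
  also have "\<dots> = (\<integral>\<^sup>+r. ennreal (q * exp (- (q * r))) * indicator {0<..} r * (\<integral>\<^sup>+\<omega>. renewal_kernel (- (q powr (3 / 2) * ((x0 - \<epsilon>) + (Xv r \<omega> - x0)))) \<partial>M) \<partial>lborel)"
  proof (rule nn_integral_cong)
    fix r
    have "Xv r \<omega> - \<epsilon> = (x0 - \<epsilon>) + (Xv r \<omega> - x0)" for \<omega> by simp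
    then show "(\<integral>\<^sup>+\<omega>. ?g r \<omega> \<partial>M) = ennreal (q * exp (- (q * r))) * indicator {0<..} r * (\<integral>\<^sup>+\<omega>. renewal_kernel (- (q powr (3 / 2) * ((x0 - \<epsilon>) + (Xv r \<omega> - x0)))) \<partial>M)"
      unfolding potential_rate_def by (subst nn_integral_cmult[symmetric]) auto
  qed
  also have "\<dots> = hit_transform (q powr (3 / 2) * (x0 - \<epsilon>))" by (rule resolvent_hit[OF q])
  finally show ?thesis .
qed

end

section \<open>From passage below a level to the exit time\<close>

lemma exp_neg_antimono:
  assumes q: "q > 0" and le: "s \<le> s'"
  shows "exp_neg q s' \<le> exp_neg q s"
proof (cases "s' = \<infinity>")
  case False
  then have "s' < \<infinity>" by (simp add: top.not_eq_extremum)
  then have "enn2real s \<le> enn2real s'" "s \<noteq> \<infinity>" using le by (auto intro: enn2real_mono)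
  then show ?thesis using False q by (simp add: exp_neg_def)
qed (simp add: exp_neg_def)

text \<open>The infimum need not be attained, so a bound at its members has to be carried over by
  approximation. If there are no members, the infimum is infinite and \<open>exp_neg\<close> is
  0.\<close>

lemma exp_neg_Inf_le:
  assumes q: "q > 0" and le: "\<And>t. t \<ge> 0 \<Longrightarrow> P t \<Longrightarrow> ennreal (exp (- (q * t))) \<le> c"
  shows "ennreal (exp_neg q (Inf {ennreal t | t. 0 \<le> t \<and> P t})) \<le> c"
proof (cases "Inf {ennreal t | t. 0 \<le> t \<and> P t}")
  case (real i)
  show ?thesis
  proof (rule ccontr)
    assume "\<not> ?thesis"
    then have lt: "c < ennreal (exp (- (q * i)))" unfolding real(2) using real(1) by (simp add: exp_neg_def not_le)
    then have "c < \<top>" by (rule less_trans) simp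
    then obtain c' where c': "c = ennreal c'" "c' \<ge> 0" by (cases c) auto
    have lt': "c' < exp (- (q * i))" using lt c' by (simp add: ennreal_less_iff)
    \<comment> \<open>The time at which the discount has fallen to c'. If c' = 0 there is no such
      time, and any number beyond i will do.\<close>
    define T where "T = (if c' = 0 then i + 1 else - ln c' / q)"
    have "i < T"
    proof (cases "c' = 0")
      case False
      then have "ln c' < ln (exp (- (q * i)))" using lt' c'(2) by (subst ln_less_cancel_iff) auto
      then show ?thesis using False q by (simp add: T_def field_simps)
    qed (simp add: T_def)
    then have "Inf {ennreal t | t. 0 \<le> t \<and> P t} < ennreal T" unfolding real(2) using real(1) by (simp add: ennreal_less_iff)
    then obtain t where t: "0 \<le> t" "P t" "ennreal t < ennreal T" by (auto simp: Inf_less_iff)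
    then have "t < T" by (simp add: ennreal_less_iff)
    moreover have "T \<le> t"
    proof -
      have e: "exp (- (q * t)) \<le> c'" using le[OF t(1,2)] c' by simp
      then have "c' > 0" using exp_gt_zero[of "- (q * t)"] by linarith
      moreover from this e have "- (q * t) \<le> ln c'" by (simp add: ln_ge_iff)
      ultimately show ?thesis using q by (simp add: T_def field_simps)
    qed
    ultimately show False by simp
  qed
qed (simp add: exp_neg_def)

context stable_process
begin

definition hit_value :: "real \<Rightarrow> real \<Rightarrow> 'a \<Rightarrow> ennreal" where
  "hit_value q \<epsilon> \<omega> = (SUP n. hit_discount q \<epsilon> n \<omega>)"

lemma hit_value_measurable [measurable]: "hit_value q \<epsilon> \<in> borel_measurable M"
  unfolding hit_value_def [abs_def] by measurable

lemma expected_hit_value: "q > 0 \<Longrightarrow> (\<integral>\<^sup>+\<omega>. hit_value q \<epsilon> \<omega> \<partial>M) = hit_transform (q powr (3 / 2) * (x0 - \<epsilon>))"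
  unfolding hit_value_def by (rule expected_hit_discount)

text \<open>A negative value at a grid time is an exit. The inequality can be strict when the path
  reaches 0 without becoming negative there.\<close>

lemma hit_value_lower:
  assumes q: "q > 0"
  shows "hit_value q 0 \<omega> \<le> ennreal (exp_neg q (exit_time X {0<..} \<omega>))"
  unfolding hit_value_def hit_discount_def
proof (intro SUP_least)
  fix n j
  let ?t = "real j * (1 / 2 ^ n)"
  show "(if X ?t \<omega> < 0 then ennreal (exp (- (q * ?t))) else 0) \<le> ennreal (exp_neg q (exit_time X {0<..} \<omega>))"
  proof (cases "X ?t \<omega> < 0")
    case True
    have "exit_time X {0<..} \<omega> \<le> ennreal ?t"
      unfolding exit_time_def using True by (intro Inf_lower) auto
    from exp_neg_antimono[OF q this] have "exp (- (q * ?t)) \<le> exp_neg q (exit_time X {0<..} \<omega>)"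
      by (simp add: exp_neg_def)
    then show ?thesis using True by (simp add: ennreal_leI)
  qed simp
qed

text \<open>At an exit t the path is at most 0, hence below \<epsilon>; by right-continuity it is
  still below \<epsilon> at the grid times just after t, whose discounts tend to that of t.\<close>

lemma hit_value_upper:
  assumes q: "q > 0" and g: "good_path \<omega>" and e: "\<epsilon> > 0"
  shows "ennreal (exp_neg q (exit_time X {0<..} \<omega>)) \<le> hit_value q \<epsilon> \<omega>"
  unfolding exit_time_def
proof (rule exp_neg_Inf_le[OF q])
  fix t :: real assume t: "t \<ge> 0" "X t \<omega> \<notin> {0<..}"
  then have "X t \<omega> < \<epsilon>" using e by auto
  have "(\<lambda>n. ennreal (exp (- (q * grid n t)))) \<longlonglongrightarrow> ennreal (exp (- (q * t)))"
    by (intro tendsto_ennrealI tendsto_intros grid_tendsto t)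
  moreover have "\<forall>\<^sub>F n in sequentially. ennreal (exp (- (q * grid n t))) \<le> hit_value q \<epsilon> \<omega>"
    using good_path_grid_below[OF g t(1) \<open>X t \<omega> < \<epsilon>\<close>]
  proof eventually_elim
    case (elim n)
    define j where "j = nat \<lfloor>t * 2 ^ n\<rfloor> + 1"
    have j: "grid n t = real j * (1 / 2 ^ n)" unfolding j_def by (rule grid_dyadic)
    have "ennreal (exp (- (q * grid n t))) \<le> hit_discount q \<epsilon> n \<omega>"
      unfolding hit_discount_def by (rule SUP_upper2[of j]) (use elim j in auto)
    also have "\<dots> \<le> hit_value q \<epsilon> \<omega>" unfolding hit_value_def by (rule SUP_upper) simp
    finally show ?case .
  qed
  ultimately show "ennreal (exp (- (q * t))) \<le> hit_value q \<epsilon> \<omega>"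
    by (rule tendsto_upperbound) simp
qed

lemma hit_transform_tendsto:
  assumes "y \<longlonglongrightarrow> x"
  shows "(\<lambda>n. hit_transform (y n)) \<longlonglongrightarrow> hit_transform x"
proof -
  have "(\<lambda>n. root 3 (max 0 (y n))) \<longlonglongrightarrow> root 3 (max 0 x)"
    by (intro tendsto_intros assms)
  then have "(\<lambda>n. hit_laplace (root 3 (max 0 (y n)))) \<longlonglongrightarrow> hit_laplace (root 3 (max 0 x))"
    by (rule continuous_on_tendsto_compose[OF hit_laplace_continuous]) auto
  then show ?thesis unfolding hit_transform_eq_hit_laplace by (rule tendsto_ennrealI)
qed

text \<open>The first passage values below \<open>\<epsilon> > 0\<close> and below \<open>0\<close> bracket the exit time, and their
  expectations agree in the limit because the hitting function is continuous.\<close>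

lemma AE_exit_time_hit_value:
  assumes q: "q > 0"
  shows "AE \<omega> in M. ennreal (exp_neg q (exit_time X {0<..} \<omega>)) = hit_value q 0 \<omega>"
proof -
  \<comment> \<open>\<open>U\<close> bounds the discount of the exit time from above and
    \<open>hit_value q 0\<close> from below. The expectation of \<open>U\<close> does not exceed
    that of the lower bound, which is finite, so the two agree almost surely.\<close>
  define U where "U \<omega> = (INF m. hit_value q (1 / real (Suc m)) \<omega>)" for \<omega>
  have [measurable]: "U \<in> borel_measurable M" unfolding U_def [abs_def] by measurable
  let ?a = "q powr (3 / 2)"
  have L: "(\<integral>\<^sup>+\<omega>. hit_value q 0 \<omega> \<partial>M) = hit_transform (?a * x0)" using expected_hit_value[OF q, of 0] by simp
  have fin: "hit_transform x < \<infinity>" for x unfolding hit_transform_eq_hit_laplace by simp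
  have up: "AE \<omega> in M. ennreal (exp_neg q (exit_time X {0<..} \<omega>)) \<le> U \<omega>"
    using AE_good_path by eventually_elim (auto simp: U_def intro!: INF_greatest hit_value_upper q)
  have le: "AE \<omega> in M. hit_value q 0 \<omega> \<le> U \<omega>"
    using up by eventually_elim (rule order_trans[OF hit_value_lower[OF q]])
  have "(\<integral>\<^sup>+\<omega>. U \<omega> \<partial>M) \<le> hit_transform (?a * (x0 - 1 / real (Suc m)))" for m
    unfolding expected_hit_value[OF q, symmetric] U_def by (intro nn_integral_mono INF_lower) auto
  moreover have "(\<lambda>m. hit_transform (?a * (x0 - 1 / real (Suc m)))) \<longlonglongrightarrow> hit_transform (?a * (x0 - 0))"
    by (intro hit_transform_tendsto tendsto_mult tendsto_const tendsto_diff LIMSEQ_Suc[OF lim_1_over_n])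
  ultimately have "(\<integral>\<^sup>+\<omega>. U \<omega> \<partial>M) \<le> hit_transform (?a * (x0 - 0))"
    by (intro LIMSEQ_le_const) auto
  then have U: "(\<integral>\<^sup>+\<omega>. U \<omega> \<partial>M) \<le> hit_transform (?a * x0)" by simp
  have "(\<integral>\<^sup>+\<omega>. U \<omega> - hit_value q 0 \<omega> \<partial>M) = (\<integral>\<^sup>+\<omega>. U \<omega> \<partial>M) - (\<integral>\<^sup>+\<omega>. hit_value q 0 \<omega> \<partial>M)"
    using le fin[of "?a * x0"] by (intro nn_integral_diff) (auto simp: L)
  also have "\<dots> = 0" unfolding L using U fin[of "?a * x0"] by (simp add: diff_eq_0_iff_ennreal)
  finally have "AE \<omega> in M. U \<omega> - hit_value q 0 \<omega> = 0"
    by (subst (asm) nn_integral_0_iff_AE) auto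
  moreover have "AE \<omega> in M. hit_value q 0 \<omega> \<noteq> \<infinity>"
    using fin[of "?a * x0"] by (intro nn_integral_PInf_AE) (auto simp: L)
  ultimately show ?thesis using up
  proof eventually_elim
    case (elim \<omega>)
    then have "U \<omega> \<le> hit_value q 0 \<omega>" by (auto simp: diff_eq_0_iff_ennreal top.not_eq_extremum)
    then show ?case using elim(3) hit_value_lower[OF q, of \<omega>] by (intro antisym) (auto intro: order_trans)
  qed
qed

end

section \<open>The substitution t = r^2 and the conclusion\<close>

lemma exit_integrand_measurable [measurable]: "exit_integrand x \<in> borel_measurable borel"
  unfolding exit_integrand_def [abs_def] hypergeom_1F2_def by measurable

text \<open>The derivative 2 r of the substitution t = r^2 is the factor in
  \<open>exit_density_sq\<close>, and integrability is transported by the same change of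
  variables.\<close>

lemma exit_density_eq:
  assumes x: "x > 0"
  shows "set_integrable lborel {0<..} (exit_integrand x)" and "exit_density x = exit_density_sq x"
proof -
  let ?f = "exit_integrand x"
  let ?k = "\<lambda>r. 2 * r * exp (- (r\<^sup>2 * x)) * hit_im r"
  have img: "(\<lambda>r::real. r\<^sup>2) ` {0<..} = {0<..}"
  proof (intro equalityI subsetI)
    fix y :: real assume "y \<in> {0<..}"
    then have "y = (sqrt y)\<^sup>2" "sqrt y \<in> {0<..}" by auto
    then show "y \<in> (\<lambda>r. r\<^sup>2) ` {0<..}" by (rule image_eqI)
  qed auto
  have k: "\<bar>2 * r\<bar> * ?f (r\<^sup>2) = ?k r" if "r \<in> {0<..}" for r
    using that by (simp add: exit_integrand_hit_im)
  note int = hit_im_kernel_integrable[OF x]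
  have "(\<lambda>r. indicator {0<..} r *\<^sub>R (\<bar>2 * r\<bar> * ?f (r\<^sup>2))) = (\<lambda>r. indicator {0<..} r *\<^sub>R ?k r)"
  proof (rule ext)
    fix r :: real
    show "indicator {0<..} r *\<^sub>R (\<bar>2 * r\<bar> * ?f (r\<^sup>2)) = indicator {0<..} r *\<^sub>R ?k r"
    proof (cases "r \<in> {0<..}")
      case True
      show ?thesis unfolding k[OF True] ..
    qed simp
  qed
  moreover have "set_integrable lebesgue {0<..} ?k"
    using int unfolding set_integrable_def by (subst integrable_completion) auto
  ultimately have 1: "(\<lambda>r. \<bar>2 * r\<bar> * ?f (r\<^sup>2)) absolutely_integrable_on {0<..}"
    unfolding set_integrable_def by (simp only:)
  have 2: "integral {0<..} (\<lambda>r. \<bar>2 * r\<bar> * ?f (r\<^sup>2)) = (LBINT r:{0<..}. ?k r)"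
    unfolding set_borel_integral_eq_integral(2)[OF int] by (rule integral_cong) (rule k)
  have "?f absolutely_integrable_on ((\<lambda>r. r\<^sup>2) ` {0<..}) \<and> integral ((\<lambda>r. r\<^sup>2) ` {0<..}) ?f = (LBINT r:{0<..}. ?k r)"
  proof (rule has_absolute_integral_change_of_variables_1'[where g = "\<lambda>r. r\<^sup>2" and g' = "\<lambda>r. 2 * r", THEN iffD1])
    show "((\<lambda>r. r\<^sup>2) has_real_derivative 2 * r) (at r within {0<..})" for r :: real
      by (auto intro!: derivative_eq_intros)
    show "inj_on (\<lambda>r::real. r\<^sup>2) {0<..}"
      by (intro inj_onI) (auto simp: power2_eq_iff)
  qed (use 1 2 in simp_all)
  then have r: "?f absolutely_integrable_on {0<..}" "integral {0<..} ?f = (LBINT r:{0<..}. ?k r)"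
    unfolding img by auto
  show s: "set_integrable lborel {0<..} ?f"
    using r(1) unfolding set_integrable_def by (subst (asm) integrable_completion) auto
  show "exit_density x = exit_density_sq x"
    unfolding exit_density_def exit_density_sq_def set_borel_integral_eq_integral(2)[OF s] r(2) ..
qed

theorem corollary8:
  fixes M :: "'a measure" and X :: "real \<Rightarrow> 'a \<Rightarrow> real" and \<tau> :: "'a \<Rightarrow> ennreal"
  assumes "symmetric_stable_process_from (2/3) M X 1"
    and "\<tau> = exit_time X {0<..}"
  shows "(\<forall>x>0. set_integrable lborel {0<..} (exit_integrand x) \<and> 0 \<le> exit_density x)
    \<and> \<tau> \<in> borel_measurable (completion M)
    \<and> (AE \<omega> in completion M. \<tau> \<omega> < \<infinity>)
    \<and> distributed (completion M) lborel (\<lambda>\<omega>. enn2real (\<tau> \<omega>))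
         (\<lambda>x. ennreal (exit_density x) * indicator {0<..} x)
    \<and> (\<forall>t>0. (\<integral>\<omega>. exp_neg t (\<tau> \<omega>) \<partial>completion M)
         = sqrt 3 / (2 * pi) * Gamma (2/3) * upper_Gamma (1/3) (t powr (3/2)) * exp (t powr (3/2)))"
proof -
  have "prob_space M"
    using assms(1) by (simp add: symmetric_stable_process_from_def levy_process_from_def)
  then interpret prob_space M .
  interpret stable_process M X 1
    by unfold_locales (rule assms(1))
  \<comment> \<open>\<open>\<phi>\<close> inverts s -> \<open>exp_neg 1 s\<close>, with 0
    corresponding to an infinite time. It turns the measurable \<open>hit_value 1 0\<close> into a
    version \<sigma> of \<tau> that is measurable before completion.\<close>
  define \<phi> where "\<phi> y = (if y = 0 then \<infinity> else ennreal (- ln (enn2real y)))" for y :: ennreal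
  define \<sigma> where "\<sigma> \<omega> = \<phi> (hit_value 1 0 \<omega>)" for \<omega>
  have [measurable]: "\<phi> \<in> borel_measurable borel" unfolding \<phi>_def [abs_def] by measurable
  have sm [measurable]: "\<sigma> \<in> borel_measurable M" unfolding \<sigma>_def [abs_def] by measurable
  have ae: "AE \<omega> in M. \<tau> \<omega> = \<sigma> \<omega>"
    using AE_exit_time_hit_value[OF zero_less_one]
  proof eventually_elim
    case (elim \<omega>)
    have "\<phi> (ennreal (exp_neg 1 s)) = s" for s
    proof (cases "s = \<infinity>")
      case False
      then show ?thesis by (simp add: \<phi>_def exp_neg_def top.not_eq_extremum)
    qed (simp add: \<phi>_def exp_neg_def)
    then show ?case unfolding assms(2) \<sigma>_def elim[symmetric] by simp
  qed
  then have aec: "AE \<omega> in completion M. \<tau> \<omega> = \<sigma> \<omega>" by (rule AE_completion)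
  \<comment> \<open>Preimages under \<tau> and \<sigma> differ by null sets, and these belong to the
    completion.\<close>
  have \<tau>_meas: "\<tau> \<in> borel_measurable (completion M)"
  proof (rule measurableI)
    fix S :: "ennreal set" assume S: "S \<in> sets borel"
    show "\<tau> -` S \<inter> space (completion M) \<in> sets (completion M)"
    proof (rule completion.in_sets_AE)
      show "AE \<omega> in completion M. \<omega> \<in> \<sigma> -` S \<inter> space M \<longleftrightarrow> \<omega> \<in> \<tau> -` S \<inter> space (completion M)"
        using aec by eventually_elim auto
      show "\<sigma> -` S \<inter> space M \<in> sets (completion M)"
        using measurable_sets[OF sm S] by (rule sets_completionI_sets)
    qed auto
  qed simp
  have lap: "(\<integral>\<^sup>+\<omega>. ennreal (exp_neg u (\<sigma> \<omega>)) \<partial>M) = ennreal (hit_laplace (sqrt u))" if u: "u > 0" for u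
  proof -
    have "(\<integral>\<^sup>+\<omega>. ennreal (exp_neg u (\<sigma> \<omega>)) \<partial>M) = (\<integral>\<^sup>+\<omega>. hit_value u 0 \<omega> \<partial>M)"
      using ae AE_exit_time_hit_value[OF u]
      by (intro nn_integral_cong_AE, eventually_elim) (simp add: assms(2))
    also have "\<dots> = hit_transform (u powr (3 / 2))" using expected_hit_value[OF u, of 0] by simp
    also have "\<dots> = ennreal (hit_laplace (root 3 (u powr (3 / 2))))" by (simp add: hit_transform_eq_hit_laplace)
    also have "u powr (3 / 2) = sqrt u ^ 3"
    proof -
      have "sqrt u ^ 3 = (u powr (1 / 2)) powr 3" using u by (simp add: powr_half_sqrt)
      then show ?thesis by (simp add: powr_powr)
    qed
    finally show ?thesis using u by (simp add: real_root_power_cancel)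
  qed
  have exp_neg_meas [measurable]: "exp_neg u \<in> borel_measurable borel" for u
    unfolding exp_neg_def [abs_def] by measurable
  \<comment> \<open>The transform at any positive u is at most the probability of a finite time. As
    u tends to 0 it tends to \<open>hit_laplace 0\<close> = 1.\<close>
  have \<sigma>_fin: "AE \<omega> in M. \<sigma> \<omega> < \<infinity>"
  proof -
    have "hit_laplace (sqrt (1 / real (Suc n))) \<le> prob {\<omega> \<in> space M. \<sigma> \<omega> < \<infinity>}" for n
    proof -
      have "ennreal (hit_laplace (sqrt (1 / real (Suc n)))) = (\<integral>\<^sup>+\<omega>. ennreal (exp_neg (1 / real (Suc n)) (\<sigma> \<omega>)) \<partial>M)"
        by (rule lap[symmetric]) simp
      also have "\<dots> \<le> (\<integral>\<^sup>+\<omega>. indicator {\<omega> \<in> space M. \<sigma> \<omega> < \<infinity>} \<omega> \<partial>M)"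
        by (intro nn_integral_mono) (auto simp: exp_neg_def top.not_eq_extremum split: split_indicator)
      also have "\<dots> = ennreal (prob {\<omega> \<in> space M. \<sigma> \<omega> < \<infinity>})"
        by (simp add: emeasure_eq_measure)
      finally show ?thesis by simp
    qed
    moreover have "(\<lambda>n. hit_laplace (sqrt (1 / real (Suc n)))) \<longlonglongrightarrow> hit_laplace (sqrt 0)"
      by (rule continuous_on_tendsto_compose[OF hit_laplace_continuous tendsto_real_sqrt[OF LIMSEQ_Suc[OF lim_1_over_n]]]) auto
    ultimately have "hit_laplace (sqrt 0) \<le> prob {\<omega> \<in> space M. \<sigma> \<omega> < \<infinity>}"
      by (intro LIMSEQ_le_const2) auto
    then have "prob {\<omega> \<in> space M. \<sigma> \<omega> < \<infinity>} = 1" by (simp add: hit_laplace_0 antisym)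
    then show ?thesis by (subst (asm) prob_Collect_eq_1) auto
  qed
  define \<nu> where "\<nu> = distr M borel (\<lambda>\<omega>. enn2real (\<sigma> \<omega>))"
  have law: "\<forall>x>0. 0 \<le> exit_density_sq x" "\<nu> = density lborel (\<lambda>x. ennreal (exit_density_sq x) * indicator {0<..} x)"
  proof -
    have 1: "finite_measure \<nu>" unfolding \<nu>_def by (rule finite_measure_distr) measurable
    have 2: "sets \<nu> = sets borel" by (simp add: \<nu>_def)
    have 3: "AE x in \<nu>. 0 \<le> x" unfolding \<nu>_def by (subst AE_distr_iff) auto
    have 4: "(\<integral>\<^sup>+x. ennreal (exp (- (u * x))) \<partial>\<nu>) = ennreal (hit_laplace (sqrt u))" if "u > 0" for u
    proof -
      have "(\<integral>\<^sup>+x. ennreal (exp (- (u * x))) \<partial>\<nu>) = (\<integral>\<^sup>+\<omega>. ennreal (exp (- (u * enn2real (\<sigma> \<omega>)))) \<partial>M)"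
        unfolding \<nu>_def by (subst nn_integral_distr) auto
      also have "\<dots> = (\<integral>\<^sup>+\<omega>. ennreal (exp_neg u (\<sigma> \<omega>)) \<partial>M)"
        using \<sigma>_fin by (intro nn_integral_cong_AE) (auto elim!: eventually_mono simp: exp_neg_def)
      finally show ?thesis using lap[OF that] by simp
    qed
    have 5: "(\<lambda>n. hit_laplace (sqrt (real n))) \<longlonglongrightarrow> 0"
    proof (rule Lim_null_comparison)
      show "(\<lambda>n. (1 / (3 * exp_cube_total)) * (1 / real n)) \<longlonglongrightarrow> 0"
        by (intro tendsto_mult_right_zero lim_1_over_n)
      show "\<forall>\<^sub>F n in sequentially. norm (hit_laplace (sqrt (real n))) \<le> (1 / (3 * exp_cube_total)) * (1 / real n)"
        using eventually_ge_at_top[of 1]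
      proof eventually_elim
        case (elim n)
        then show ?case using hit_laplace_le[of "sqrt (real n)"] hit_laplace_nonneg[of "sqrt (real n)"] by (simp add: mult_ac)
      qed
    qed
    show "\<forall>x>0. 0 \<le> exit_density_sq x" "\<nu> = density lborel (\<lambda>x. ennreal (exit_density_sq x) * indicator {0<..} x)"
      using exit_law[OF 1 2 3 4 5 hit_laplace_nonneg] by blast+
  qed
  have dens: "(\<lambda>x. ennreal (exit_density x) * indicator {0<..} x) = (\<lambda>x. ennreal (exit_density_sq x) * indicator {0<..} x)"
    by (auto simp: fun_eq_iff exit_density_eq(2) split: split_indicator)
  have "distributed (completion M) lborel (\<lambda>\<omega>. enn2real (\<tau> \<omega>)) (\<lambda>x. ennreal (exit_density x) * indicator {0<..} x)"
    unfolding distributed_def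
  proof (intro conjI)
    have [measurable]: "(\<lambda>\<omega>. enn2real (\<tau> \<omega>)) \<in> borel_measurable (completion M)"
      using \<tau>_meas by measurable
    show "(\<lambda>\<omega>. enn2real (\<tau> \<omega>)) \<in> measurable (completion M) lborel" by simp
    have "distr (completion M) lborel (\<lambda>\<omega>. enn2real (\<tau> \<omega>)) = distr (completion M) borel (\<lambda>\<omega>. enn2real (\<sigma> \<omega>))"
      using aec by (intro distr_cong_AE) (auto elim!: eventually_mono intro!: measurable_completion)
    also have "\<dots> = \<nu>" unfolding \<nu>_def by (rule distr_completion) measurable
    finally show "distr (completion M) lborel (\<lambda>\<omega>. enn2real (\<tau> \<omega>)) = density lborel (\<lambda>x. ennreal (exit_density x) * indicator {0<..} x)"
      unfolding dens law(2) .
    show "(\<lambda>x. ennreal (exit_density x) * indicator {0<..} x) \<in> borel_measurable lborel"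
      unfolding dens by measurable
  qed
  moreover have "(\<integral>\<omega>. exp_neg t (\<tau> \<omega>) \<partial>completion M)
         = sqrt 3 / (2 * pi) * Gamma (2/3) * upper_Gamma (1/3) (t powr (3/2)) * exp (t powr (3/2))" if t: "t > 0" for t
  proof -
    have "(\<integral>\<omega>. exp_neg t (\<tau> \<omega>) \<partial>completion M) = (\<integral>\<omega>. exp_neg t (\<sigma> \<omega>) \<partial>completion M)"
      using aec \<tau>_meas by (intro integral_cong_AE) (auto elim!: eventually_mono intro!: measurable_completion)
    also have "\<dots> = (\<integral>\<omega>. exp_neg t (\<sigma> \<omega>) \<partial>M)" by (rule integral_completion) measurable
    also have "\<dots> = hit_laplace (sqrt t)"
      using lap[OF t] t hit_laplace_nonneg[of "sqrt t"] by (subst integral_eq_nn_integral) (auto simp: exp_neg_def)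
    also have "\<dots> = sqrt 3 / (2 * pi) * Gamma (2/3) * upper_Gamma (1/3) (sqrt t ^ 3) * exp (sqrt t ^ 3)"
      using t by (intro laplace_closed_form[symmetric]) simp
    also have "sqrt t ^ 3 = t powr (3/2)"
    proof -
      have "sqrt t ^ 3 = (t powr (1 / 2)) powr 3" using t by (simp add: powr_half_sqrt)
      then show ?thesis by (simp add: powr_powr)
    qed
    finally show ?thesis .
  qed
  moreover have "AE \<omega> in completion M. \<tau> \<omega> < \<infinity>"
    using aec AE_completion[OF \<sigma>_fin] by eventually_elim simp
  ultimately show ?thesis
    using \<tau>_meas exit_density_eq law(1) by auto
qed

end
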